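(* (i) Let $L/K$ be a geometric cyclic extension of degree $\ell$, where $q\equiv-1\pmod\ell$. Then there exists a Kummer generator $w$ for $L(\xi)/K(\xi)$, with minimal polynomial $X^\ell-a$, such that $y:=\sigma(w)+w$ is a generator for $L/K$ and $u:=\sigma(w)w\in K$, and the minimal polynomial of $y$ over $K$ is $P^{\ell}_{u,\alpha}(X)$ with $\alpha=a+\sigma(a)$. (ii) Conversely, let $L/K$ be a geometric extension of degree $\ell$, where $q\equiv-1\pmod\ell$, having a generator $y$ whose minimal polynomial over $K$ is $P^{\ell}_{u,\alpha}(X)$ for some $u,\alpha\in K$ such that $u^\ell=a\sigma(a)$ and $\alpha=a+\sigma(a)$ for some $a\in K(\xi)\setminus K$. Then $L/K$ is a cyclic extension.
   Context: Let $p$ be a prime, $q=p^n$, and $K$ a function field in one variable with field of constants $\mathbb{F}_q$. Let $\ell$ be a positive integer with $\gcd(\ell,p)=1$ and $q\equiv-1\pmod\ell$, and let $\xi$ be a primitive $\ell$-th root of unity; then $[\mathbb{F}_q(\xi):\mathbb{F}_q]=2$. An extension $L/K$ is geometric if $\mathbb{F}_q$ is the full field of constants of $L$. For a field $M\supseteq K$ not containing $\xi$, $\sigma$ denotes the automorphism of $M(\xi)$ over $M$ with $\sigma(\xi)=\xi^{-1}$ (compatible under restriction). A generator of $L/K$ is $y$ with $L=K(y)$; a Kummer generator for $L(\xi)/K(\xi)$ is $w\in L(\xi)$ with $L(\xi)=K(\xi)(w)$ and $w^\ell\in K(\xi)$. Coefficients: for $r\in\{0,1\}$ and $0\le s\le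 j$, define integers $c^r_{s,j}$ (viewed in $\mathbb{F}_p$) by $c^r_{0,j}=1$ and $c^r_{s,j}=-\sum_{k=1}^{s}\binom{2j+r}{k}c^r_{s-k,j-k}$ for $1\le s\le j$. For $\ell=2\iota+r$, $r\in\{0,1\}$, put $P^{\ell}_{u,\alpha}(X)=\sum_{s=0}^{\iota}c^r_{s,\iota}u^sX^{\ell-2s}-\alpha$ (e.g. $P^3_{u,\alpha}=X^3-3uX-\alpha$, $P^4_{u,\alpha}=X^4-4uX^2+2u^2-\alpha$). *)

theory Defs
  imports
    "HOL-Algebra.Finite_Extensions"
    "HOL-Algebra.Generated_Fields"
    "HOL-Algebra.Elementary_Groups"
    "HOL-Algebra.Bij"
    "HOL-Number_Theory.Cong"
begin

text \<open>
  All fields are subfields of one ambient field \<open>R\<close>, so that composita such as \<open>L(\<xi>)\<close>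
  make sense.
\<close>

definition adjoin :: "('a, 'b) ring_scheme \<Rightarrow> 'a set \<Rightarrow> 'a \<Rightarrow> 'a set"
  where "adjoin R M x = generate_field R (insert x M)"

definition field_extension :: "('a, 'b) ring_scheme \<Rightarrow> 'a set \<Rightarrow> 'a set \<Rightarrow> bool"
  where "field_extension R M E \<longleftrightarrow> subfield M R \<and> subfield E R \<and> M \<subseteq> E"

definition full_constant_field :: "('a, 'b) ring_scheme \<Rightarrow> 'a set \<Rightarrow> 'a set \<Rightarrow> bool"
  where "full_constant_field R F E \<longleftrightarrow>
    field_extension R F E \<and> {x \<in> E. (ring.algebraic R over F) x} = F"

definition function_field :: "('a, 'b) ring_scheme \<Rightarrow> 'a set \<Rightarrow> 'a set \<Rightarrow> bool"
  where "function_field R F K \<longleftrightarrow>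
    full_constant_field R F K \<and>
    (\<exists>t\<in>K. (ring.transcendental R over F) t \<and> ring.finite_dimension R (adjoin R F t) K)"

definition geometric_extension ::
    "('a, 'b) ring_scheme \<Rightarrow> 'a set \<Rightarrow> 'a set \<Rightarrow> 'a set \<Rightarrow> bool"
  where "geometric_extension R F K L \<longleftrightarrow> field_extension R K L \<and> full_constant_field R F L"

definition galois_group :: "('a, 'b) ring_scheme \<Rightarrow> 'a set \<Rightarrow> 'a set \<Rightarrow> ('a \<Rightarrow> 'a) monoid"
  where "galois_group R M E = BijGroup E
    \<lparr>carrier := {f \<in> Bij E. f \<in> ring_hom (R\<lparr>carrier := E\<rparr>) (R\<lparr>carrier := E\<rparr>) \<and>
                           (\<forall>x\<in>M. f x = x)}\<rparr>"

definition galois_extension :: "('a, 'b) ring_scheme \<Rightarrow> 'a set \<Rightarrow> 'a set \<Rightarrow> bool"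
  where "galois_extension R M E \<longleftrightarrow>
    field_extension R M E \<and> ring.finite_dimension R M E \<and>
    {x \<in> E. \<forall>f\<in>carrier (galois_group R M E). f x = x} = M"

definition cyclic_extension :: "('a, 'b) ring_scheme \<Rightarrow> 'a set \<Rightarrow> 'a set \<Rightarrow> bool"
  where "cyclic_extension R M E \<longleftrightarrow>
    galois_extension R M E \<and> cyclic_group (galois_group R M E)"

definition primitive_root_of_unity :: "('a, 'b) ring_scheme \<Rightarrow> nat \<Rightarrow> 'a \<Rightarrow> bool"
  where "primitive_root_of_unity R l \<xi> \<longleftrightarrow>
    \<xi> \<in> carrier (mult_of R) \<and> 0 < l \<and> group.ord (mult_of R) \<xi> = l"

text \<open>
  The automorphism \<open>\<sigma>\<close> of \<open>M(\<xi>)\<close> over \<open>M\<close>. Elements of Galois groups are extensional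
  functions, hence it is determined uniquely. If \<open>\<xi> = \<xi>\<inverse>\<close> it is the identity.
\<close>

definition xi_conj :: "('a, 'b) ring_scheme \<Rightarrow> 'a set \<Rightarrow> 'a \<Rightarrow> 'a \<Rightarrow> 'a"
  where "xi_conj R M \<xi> =
    (THE f. f \<in> carrier (galois_group R M (adjoin R M \<xi>)) \<and> f \<xi> = inv\<^bsub>R\<^esub> \<xi>)"

definition kummer_generator ::
    "('a, 'b) ring_scheme \<Rightarrow> 'a set \<Rightarrow> 'a set \<Rightarrow> 'a \<Rightarrow> nat \<Rightarrow> 'a \<Rightarrow> bool"
  where "kummer_generator R K L \<xi> l w \<longleftrightarrow>
    w \<in> adjoin R L \<xi> \<and> adjoin R L \<xi> = adjoin R (adjoin R K \<xi>) w \<and>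
    w [^]\<^bsub>R\<^esub> l \<in> adjoin R K \<xi>"

text \<open>The integers \<open>c\<^sup>r\<^sub>s\<^sub>,\<^sub>j\<close>; only the values with \<open>s \<le> j\<close> are meaningful.\<close>

fun ccoeff :: "nat \<Rightarrow> nat \<Rightarrow> nat \<Rightarrow> int"
  where "ccoeff r s j =
    (if s = 0 then 1
     else - (\<Sum>k = 1..s. int ((2 * j + r) choose k) * ccoeff r (s - k) (j - k)))"

declare ccoeff.simps [simp del]

text \<open>
  Library polynomials are normalised coefficient lists. The coefficients below may vanish in \<open>R\<close>,
  so the terms are built from constants and powers of the variable rather than with \<open>monom\<close>.
\<close>

definition P_poly :: "('a, 'b) ring_scheme \<Rightarrow> 'a set \<Rightarrow> nat \<Rightarrow> 'a \<Rightarrow> 'a \<Rightarrow> 'a list"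
  where "P_poly R K l u \<alpha> =
    (\<Oplus>\<^bsub>K[X]\<^bsub>R\<^esub>\<^esub> s \<in> {0..l div 2}.
        ring.poly_of_const R ([ccoeff (l mod 2) s (l div 2)] \<cdot>\<^bsub>R\<^esub> (u [^]\<^bsub>R\<^esub> s))
          \<otimes>\<^bsub>K[X]\<^bsub>R\<^esub>\<^esub> X\<^bsub>R\<^esub> [^]\<^bsub>K[X]\<^bsub>R\<^esub>\<^esub> (l - 2 * s))
    \<ominus>\<^bsub>K[X]\<^bsub>R\<^esub>\<^esub> ring.poly_of_const R \<alpha>"

definition kummer_poly :: "('a, 'b) ring_scheme \<Rightarrow> 'a set \<Rightarrow> nat \<Rightarrow> 'a \<Rightarrow> 'a list"
  where "kummer_poly R M l a =
    X\<^bsub>R\<^esub> [^]\<^bsub>M[X]\<^bsub>R\<^esub>\<^esub> l \<ominus>\<^bsub>M[X]\<^bsub>R\<^esub>\<^esub> ring.poly_of_const R a"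

end

theory Submission
  imports Defs Complex_Main
begin

text \<open>
  Let \<open>\<tau>\<close> be the extension to \<open>L(\<xi>)\<close>, trivial on \<open>\<xi>\<close>, of a generator of the Galois group
  of \<open>L/K\<close>. A Lagrange resolvent gives \<open>w \<noteq> 0\<close> with \<open>\<tau> w = \<xi> w\<close>. As \<open>\<tau>\<close> and \<open>\<sigma>\<close> commute,
  \<open>\<tau> (\<sigma> w) = \<xi>\<inverse> \<sigma> w\<close>, so \<open>u = \<sigma>(w) w\<close> is fixed by both, \<open>y = \<sigma>(w) + w\<close> lies in \<open>L\<close>,
  and its conjugates \<open>\<xi>\<^sup>i w + \<xi>\<^sup>-\<^sup>i \<sigma>(w)\<close> are distinct. The polynomial \<open>P\<close> is the Dickson
  polynomial, characterised by \<open>w\<^sup>l + v\<^sup>l = P(w + v) + \<alpha>\<close> for \<open>w v = u\<close>, hence \<open>P(y) = 0\<close>.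

  Conversely, \<open>w\<close> is recovered from \<open>y\<close> and \<open>a\<close> by a rational formula in Lucas sequences:
  it satisfies \<open>w\<^sup>2 - y w + u = 0\<close> and \<open>w\<^sup>l = a\<close>. Then \<open>\<xi> w + \<xi>\<inverse> \<sigma>(w)\<close> is a root of \<open>P\<close> in
  \<open>L\<close>, and mapping \<open>y\<close> to it defines an automorphism of order \<open>l\<close>.
\<close>

text \<open>The constant field yields two facts: \<xi> plus its inverse is a constant, as the
  q-Frobenius exchanges the two, and \<xi> lies in a field with constants F only if \<xi> is its own
  inverse. The whole Galois argument is run from these; the second keeps l \<le> 2, where \<xi> is 1
  or -1 and \<sigma> is trivial, within the same proof. The resolvent closes up only if the
  generator has order exactly l, whereas cyclicity is phrased through fixed fields; hence
  independence of characters and Artin's argument appear for a single automorphism. Minimal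
  polynomials are identified without an irreducibility criterion: l distinct conjugates force the
  degree. The integers c come from a binomial recursion, so their three-term recursion is derived
  over the integers from power sums and only then carried to R, where they may vanish. In the
  converse, a outside K means that a differs from \<sigma>(a). This makes the Lucas denominator
  nonzero, selects the right root of a quadratic for \<sigma>(w) and for \<tau>(w), and separates
  the conjugates of y.\<close>

section \<open>Dickson polynomials and Lucas sequences\<close>

text \<open>For l > 0 this is the coefficient of u^s X^(l-2s) in the Dickson polynomial D_l(X,u).
  Extension by zero lets sums run past \<open>l div 2\<close>. At l = 0 the constant is 1, while D_0
  would be 2.\<close>

definition dcoeff :: "nat \<Rightarrow> nat \<Rightarrow> int"
  where "dcoeff l s = (if 2 * s \<le> l then ccoeff (l mod 2) s (l div 2) else 0)"

lemma dcoeff_0 [simp]: "dcoeff l 0 = 1"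
  by (simp add: dcoeff_def ccoeff.simps)

text \<open>The k = 0 term is the coefficient itself, so the defining recursion is the vanishing of
  the whole sum. Lowering both s and j by k at fixed parity r is lowering l by 2k.\<close>

lemma dcoeff_rec:
  assumes "2 * s \<le> l" "0 < s"
  shows "(\<Sum>k\<le>s. int (l choose k) * dcoeff (l - 2 * k) (s - k)) = 0"
proof -
  have eq: "ccoeff (l mod 2) (s - k) (l div 2 - k) = dcoeff (l - 2 * k) (s - k)"
    if "k \<in> {1..s}" for k
  proof -
    have "2 * k \<le> l" using that assms by auto
    then obtain m where m: "l = 2 * k + m" using le_Suc_ex by blast
    have "(l - 2 * k) mod 2 = l mod 2" "(l - 2 * k) div 2 = l div 2 - k"
      unfolding m by simp_all
    then show ?thesis using assms that by (auto simp: dcoeff_def)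
  qed
  have "dcoeff l s = - (\<Sum>k = 1..s. int (l choose k) * dcoeff (l - 2 * k) (s - k))"
    using assms by (subst dcoeff_def, subst ccoeff.simps) (simp add: eq)
  moreover have "{..s} = insert 0 {1..s}" by auto
  ultimately show ?thesis by simp
qed

text \<open>For l > 0 this is D_l(y,u) at y = 1, u = z. Nothing is lost by this, since D_l is
  homogeneous with y of weight 1 and u of weight 2.\<close>

definition dsum :: "nat \<Rightarrow> int \<Rightarrow> int"
  where "dsum l z = (\<Sum>s\<le>l div 2. dcoeff l s * z ^ s)"

text \<open>Collecting powers of z with s = k + j turns the inner sum into that of
  \<open>dcoeff_rec\<close>, which kills every s > 0.\<close>

lemma dsum_convolution: "(\<Sum>k\<le>l div 2. int (l choose k) * z ^ k * dsum (l - 2 * k) z) = 1"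
proof -
  let ?g = "\<lambda>s k. int (l choose k) * dcoeff (l - 2 * k) (s - k) * z ^ s"
  have "(\<Sum>k\<le>l div 2. int (l choose k) * z ^ k * dsum (l - 2 * k) z)
      = (\<Sum>k\<le>l div 2. \<Sum>j\<le>l div 2 - k. ?g (k + j) k)"
  proof (rule sum.cong[OF refl])
    fix k assume "k \<in> {..l div 2}"
    then have "2 * k \<le> l" by auto
    then obtain m where m: "l = 2 * k + m" using le_Suc_ex by blast
    have "(l - 2 * k) div 2 = l div 2 - k" unfolding m by simp
    then show "int (l choose k) * z ^ k * dsum (l - 2 * k) z = (\<Sum>j\<le>l div 2 - k. ?g (k + j) k)"
      by (simp add: dsum_def sum_distrib_left power_add mult_ac)
  qed
  also have "\<dots> = (\<Sum>s\<le>l div 2. \<Sum>k\<le>s. ?g s k)"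
  proof -
    have "(\<Sum>k\<le>l div 2. \<Sum>j\<le>l div 2 - k. ?g (k + j) k)
      = (\<Sum>(k, j)\<in>(SIGMA k:{..l div 2}. {..l div 2 - k}). ?g (k + j) k)"
      by (subst sum.Sigma) auto
    also have "\<dots> = (\<Sum>(s, k)\<in>(SIGMA s:{..l div 2}. {..s}). ?g s k)"
      by (rule sum.reindex_bij_witness[where i = "\<lambda>(s, k). (k, s - k)" and j = "\<lambda>(k, j). (k + j, k)"]) auto
    also have "\<dots> = (\<Sum>s\<le>l div 2. \<Sum>k\<le>s. ?g s k)"
      by (subst sum.Sigma) auto
    finally show ?thesis .
  qed
  also have "\<dots> = (\<Sum>s\<le>l div 2. if s = 0 then 1 else 0)"
  proof (rule sum.cong[OF refl])
    fix s assume "s \<in> {..l div 2}"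
    then have "2 * s \<le> l" by auto
    moreover have "(\<Sum>k\<le>s. ?g s k) = (\<Sum>k\<le>s. int (l choose k) * dcoeff (l - 2 * k) (s - k)) * z ^ s"
      by (simp add: sum_distrib_right)
    ultimately show "(\<Sum>k\<le>s. ?g s k) = (if s = 0 then 1 else 0)"
      using dcoeff_rec[of s l] by (auto simp del: sum_distrib_right)
  qed
  also have "\<dots> = 1" by simp
  finally show ?thesis .
qed

text \<open>Expand 1 = (w + v)^l and pair the terms k and l - k, which share the factor (w v)^k. For
  even l the middle term has no partner; this is the origin of the value 1 at l = 2k.\<close>

lemma power_sum_convolution:
  fixes w v :: int
  assumes "w + v = 1"
  shows "(\<Sum>k\<le>l div 2. int (l choose k) * (w * v) ^ k *
            (if l = 2 * k then 1 else w ^ (l - 2 * k) + v ^ (l - 2 * k))) = 1"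
proof -
  let ?f = "\<lambda>k. int (l choose k) * w ^ k * v ^ (l - k)"
  let ?A = "{k. 2 * k < l}" and ?B = "{k. 2 * k = l}" and ?C = "{k. k \<le> l \<and> l < 2 * k}"
  have fin: "finite ?A" "finite ?B" "finite ?C"
    by (auto intro: finite_subset[of _ "{..l}"])
  have 1: "1 = (\<Sum>k\<le>l. ?f k)" using binomial_ring[of w v l] assms by simp
  have "{..l} = ?A \<union> ?B \<union> ?C" by auto
  then have "(\<Sum>k\<le>l. ?f k) = sum ?f ?A + sum ?f ?B + sum ?f ?C"
    using fin by (simp, subst sum.union_disjoint, auto, subst sum.union_disjoint, auto)
  also have "sum ?f ?C = (\<Sum>k\<in>?A. int (l choose k) * w ^ (l - k) * v ^ k)"
    by (rule sum.reindex_bij_witness[where i = "\<lambda>k. l - k" and j = "\<lambda>k. l - k"])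
       (auto simp: binomial_symmetric[symmetric])
  also have "sum ?f ?A + sum ?f ?B + (\<Sum>k\<in>?A. int (l choose k) * w ^ (l - k) * v ^ k)
     = (\<Sum>k\<in>?A. int (l choose k) * (w * v) ^ k * (w ^ (l - 2 * k) + v ^ (l - 2 * k)))
        + (\<Sum>k\<in>?B. int (l choose k) * (w * v) ^ k)"
  proof -
    have "?f k + int (l choose k) * w ^ (l - k) * v ^ k
       = int (l choose k) * (w * v) ^ k * (w ^ (l - 2 * k) + v ^ (l - 2 * k))" if "k \<in> ?A" for k
    proof -
      from that have "2 * k \<le> l" by simp
      then obtain m where "l = 2 * k + m" using le_Suc_ex by blast
      then have "l - k = k + m" "l - 2 * k = m" by simp_all
      then show ?thesis by (simp add: power_add power_mult_distrib algebra_simps)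
    qed
    moreover have "?f k = int (l choose k) * (w * v) ^ k" if "k \<in> ?B" for k
    proof -
      have "v ^ (l - k) = v ^ k" using that by auto
      then show ?thesis by (simp add: power_mult_distrib)
    qed
    ultimately have "(\<Sum>k\<in>?A. ?f k + int (l choose k) * w ^ (l - k) * v ^ k)
       = (\<Sum>k\<in>?A. int (l choose k) * (w * v) ^ k * (w ^ (l - 2 * k) + v ^ (l - 2 * k)))"
      "sum ?f ?B = (\<Sum>k\<in>?B. int (l choose k) * (w * v) ^ k)"
      by (auto intro: sum.cong)
    then show ?thesis unfolding sum.distrib by linarith
  qed
  also have "\<dots> = (\<Sum>k\<in>?A \<union> ?B. int (l choose k) * (w * v) ^ k *
            (if l = 2 * k then 1 else w ^ (l - 2 * k) + v ^ (l - 2 * k)))"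
    using fin by (subst sum.union_disjoint) (auto intro!: arg_cong2[where f = "(+)"] sum.cong)
  also have "?A \<union> ?B = {..l div 2}" by auto
  finally show ?thesis using 1 by simp
qed

text \<open>Both sides satisfy the same convolution. Its k = 0 term has coefficient 1, so the value
  at l is determined by those at l - 2k with k > 0.\<close>

lemma dsum_eq_power_sum:
  fixes w v :: int
  assumes "w + v = 1"
  shows "dsum l (w * v) = (if l = 0 then 1 else w ^ l + v ^ l)"
proof (induction l rule: less_induct)
  case (less l)
  let ?T = "\<lambda>m. if m = 0 then 1 else w ^ m + v ^ m"
  have split: "(\<Sum>k\<le>l div 2. g k) = g 0 + (\<Sum>k\<in>{1..l div 2}. g k)" for g :: "nat \<Rightarrow> int"
  proof -
    have "{..l div 2} = insert 0 {1..l div 2}" by auto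
    then show ?thesis by simp
  qed
  have "(\<Sum>k\<le>l div 2. int (l choose k) * (w * v) ^ k * dsum (l - 2 * k) (w * v))
      = (\<Sum>k\<le>l div 2. int (l choose k) * (w * v) ^ k * ?T (l - 2 * k))"
    by (rule trans[OF dsum_convolution], rule trans[OF power_sum_convolution[OF assms, symmetric, of l]])
       (intro sum.cong, auto)
  moreover have "(\<Sum>k\<in>{1..l div 2}. int (l choose k) * (w * v) ^ k * dsum (l - 2 * k) (w * v))
      = (\<Sum>k\<in>{1..l div 2}. int (l choose k) * (w * v) ^ k * ?T (l - 2 * k))"
    by (intro sum.cong refl) (subst less.IH, auto)
  ultimately show ?case unfolding split by simp
qed

text \<open>The case \<open>w + v = 1\<close>, \<open>z = w v\<close> of the power sum identity determines the coefficients,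
  as \<open>z\<close> takes infinitely many values.\<close>

lemma dcoeff_Suc:
  assumes "0 < l"
  shows "dcoeff (Suc (Suc l)) (Suc s) = dcoeff (Suc l) (Suc s) - dcoeff l s"
proof -
  \<comment> \<open>The coefficients of D_(l+2) - D_(l+1) + z D_l at y = 1, as a polynomial in z;
    the aim is that they vanish.\<close>
  let ?e = "\<lambda>s. dcoeff (Suc (Suc l)) s - dcoeff (Suc l) s + (case s of 0 \<Rightarrow> 0 | Suc r \<Rightarrow> dcoeff l r)"
  let ?N = "Suc (l + s)"
  have pad: "dsum m z = (\<Sum>s\<le>n. dcoeff m s * z ^ s)" if "m div 2 \<le> n" for m n z
    unfolding dsum_def by (rule sum.mono_neutral_left) (use that in \<open>auto simp: dcoeff_def\<close>)
  have root: "(\<Sum>i\<le>?N. ?e i * (w * (1 - w)) ^ i) = 0" for w :: int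
  proof -
    define z where "z = w * (1 - w)"
    have "(\<Sum>i\<le>?N. ?e i * z ^ i) = (\<Sum>i\<le>?N. dcoeff (Suc (Suc l)) i * z ^ i)
        - (\<Sum>i\<le>?N. dcoeff (Suc l) i * z ^ i) + (\<Sum>i\<le>?N. (case i of 0 \<Rightarrow> 0 | Suc r \<Rightarrow> dcoeff l r) * z ^ i)"
      unfolding distrib_right left_diff_distrib sum.distrib sum_subtractf ..
    also have "(\<Sum>i\<le>?N. (case i of 0 \<Rightarrow> 0 | Suc r \<Rightarrow> dcoeff l r) * z ^ i) = z * (\<Sum>i\<le>l + s. dcoeff l i * z ^ i)"
      by (subst sum.atMost_Suc_shift) (simp add: sum_distrib_left mult_ac)
    also have "(\<Sum>i\<le>?N. dcoeff (Suc (Suc l)) i * z ^ i) = dsum (Suc (Suc l)) z"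
      by (rule pad[symmetric]) simp
    also have "(\<Sum>i\<le>?N. dcoeff (Suc l) i * z ^ i) = dsum (Suc l) z"
      by (rule pad[symmetric]) simp
    also have "(\<Sum>i\<le>l + s. dcoeff l i * z ^ i) = dsum l z"
      by (rule pad[symmetric]) simp
    \<comment> \<open>Power sums obey this recurrence because w and 1 - w are the roots of X^2 - X +
      z. For l = 0 it would fail, the value there being 1 and not 2.\<close>
    also have "dsum (Suc (Suc l)) z - dsum (Suc l) z + z * dsum l z = 0"
      using assms dsum_eq_power_sum[of w "1 - w"] unfolding z_def by (simp add: algebra_simps)
    finally show ?thesis by (simp add: z_def)
  qed
  have "infinite (range (\<lambda>w::nat. int w * (1 - int w)))" 
  proof
    assume "finite (range (\<lambda>w::nat. int w * (1 - int w)))"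
    \<comment> \<open>w = 0 and w = 1 give the same product, so injectivity is claimed from 1
      on.\<close>
    moreover have "inj_on (\<lambda>w::nat. int w * (1 - int w)) {1..}"
    proof (rule inj_onI)
      fix x y :: nat assume "x \<in> {1..}" "y \<in> {1..}" "int x * (1 - int x) = int y * (1 - int y)"
      then have "(int x - int y) * (1 - int x - int y) = 0" by (simp add: algebra_simps)
      then show "x = y" using \<open>x \<in> {1..}\<close> \<open>y \<in> {1..}\<close> by auto
    qed
    moreover have "(\<lambda>w::nat. int w * (1 - int w)) ` {1..} \<subseteq> range (\<lambda>w::nat. int w * (1 - int w))"
      by blast
    ultimately have "finite {1::nat..}"
      using finite_subset finite_imageD by blast
    then show False using infinite_Ici by blast
  qed
  then have "infinite (real_of_int ` range (\<lambda>w::nat. int w * (1 - int w)))"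
    by (simp add: finite_image_iff inj_on_def)
  moreover have "(\<Sum>i\<le>?N. real_of_int (?e i) * real_of_int (int w * (1 - int w)) ^ i) = 0" for w :: nat
    unfolding of_int_power[symmetric] of_int_mult[symmetric] of_int_sum[symmetric]
    by (simp only: root of_int_0)
  then have "real_of_int ` range (\<lambda>w::nat. int w * (1 - int w))
      \<subseteq> {z. (\<Sum>i\<le>?N. real_of_int (?e i) * z ^ i) = 0}"
    by blast
  ultimately have "infinite {z::real. (\<Sum>i\<le>?N. real_of_int (?e i) * z ^ i) = 0}"
    using finite_subset by blast
  then have "\<not> (real_of_int (?e (Suc s)) \<noteq> 0 \<and> Suc s \<le> ?N)"
    using polyfun_finite_roots[of "\<lambda>i. real_of_int (?e i)" ?N] by blast
  then have "?e (Suc s) = 0" by simp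
  then show ?thesis by simp
qed

section \<open>Lucas sequences and homogeneous Dickson polynomials in a commutative ring\<close>

context cring
begin

text \<open>The Lucas sequences of X^2 - y X + u: for distinct roots w and v in a field, U_n is (w^n
  - v^n)/(w - v), and V_n is w^n + v^n. The recursive form involves neither division nor the
  roots.\<close>

fun lucasU :: "'a \<Rightarrow> 'a \<Rightarrow> nat \<Rightarrow> 'a" where
  "lucasU y u 0 = \<zero>"
| "lucasU y u (Suc 0) = \<one>"
| "lucasU y u (Suc (Suc n)) = y \<otimes> lucasU y u (Suc n) \<ominus> u \<otimes> lucasU y u n"

fun lucasV :: "'a \<Rightarrow> 'a \<Rightarrow> nat \<Rightarrow> 'a" where
  "lucasV y u 0 = \<one> \<oplus> \<one>"
| "lucasV y u (Suc 0) = y"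
| "lucasV y u (Suc (Suc n)) = y \<otimes> lucasV y u (Suc n) \<ominus> u \<otimes> lucasV y u n"

lemma lucasU_closed [simp, intro]:
  "y \<in> carrier R \<Longrightarrow> u \<in> carrier R \<Longrightarrow> lucasU y u n \<in> carrier R"
  by (induction y u n rule: lucasU.induct) auto

lemma lucasV_closed [simp, intro]:
  "y \<in> carrier R \<Longrightarrow> u \<in> carrier R \<Longrightarrow> lucasV y u n \<in> carrier R"
  by (induction y u n rule: lucasV.induct) auto

lemma lucasV_eq_power_sum:
  assumes "w \<in> carrier R" "v \<in> carrier R"
  shows "lucasV (w \<oplus> v) (w \<otimes> v) n = w [^] n \<oplus> v [^] n"
proof (induction n rule: induct_nat_012)
  case (ge2 n)
  have "lucasV (w \<oplus> v) (w \<otimes> v) (Suc (Suc n)) =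
     (w \<oplus> v) \<otimes> (w [^] n \<otimes> w \<oplus> v [^] n \<otimes> v) \<ominus> (w \<otimes> v) \<otimes> (w [^] n \<oplus> v [^] n)"
    using ge2 by simp
  also have "\<dots> = w [^] n \<otimes> w \<otimes> w \<oplus> v [^] n \<otimes> v \<otimes> v"
    using assms nat_pow_closed[OF assms(1), of n] nat_pow_closed[OF assms(2), of n]
    by algebra
  finally show ?case by simp
qed (use assms in auto)

text \<open>If w is a root of X^2 - y X + u, then w^(n+1) = w U_(n+1) - u U_n, and the identity
  takes traces on both sides. Stated in y and u alone, it is available before a root is
  known.\<close>

lemma lucasV_eq_lucasU:
  assumes "y \<in> carrier R" "u \<in> carrier R"
  shows "lucasV y u (Suc n) = y \<otimes> lucasU y u (Suc n) \<ominus> (u \<otimes> lucasU y u n \<oplus> u \<otimes> lucasU y u n)"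
proof (induction n rule: induct_nat_012)
  case 0
  then show ?case using assms by (simp, algebra)
next
  case 1
  then show ?case using assms by (simp, algebra)
next
  case (ge2 n)
  note c = assms lucasU_closed[OF assms, of n] lucasU_closed[OF assms, of "Suc n"]
  \<comment> \<open>Here a, b, c are three consecutive values of U; c stays an atom except in the
    products u c.\<close>
  have aux: "y \<otimes> (y \<otimes> c \<ominus> (u \<otimes> b \<oplus> u \<otimes> b)) \<ominus> u \<otimes> (y \<otimes> b \<ominus> (u \<otimes> a \<oplus> u \<otimes> a))
     = y \<otimes> (y \<otimes> c \<ominus> u \<otimes> b) \<ominus> (u \<otimes> c \<oplus> u \<otimes> c)"
    if abc: "a \<in> carrier R" "b \<in> carrier R" "c = y \<otimes> b \<ominus> u \<otimes> a" for a b c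
  proof -
    have c: "c \<in> carrier R" using abc assms by simp
    have "u \<otimes> c = u \<otimes> (y \<otimes> b) \<ominus> u \<otimes> (u \<otimes> a)" unfolding abc(3) using abc(1,2) assms by algebra
    moreover have "y \<otimes> (y \<otimes> c \<ominus> (u \<otimes> b \<oplus> u \<otimes> b)) \<ominus> u \<otimes> (y \<otimes> b \<ominus> (u \<otimes> a \<oplus> u \<otimes> a))
     = y \<otimes> (y \<otimes> c \<ominus> u \<otimes> b) \<ominus> ((u \<otimes> (y \<otimes> b) \<ominus> u \<otimes> (u \<otimes> a)) \<oplus> (u \<otimes> (y \<otimes> b) \<ominus> u \<otimes> (u \<otimes> a)))"
      using abc(1,2) assms c by algebra
    ultimately show ?thesis by simp
  qed
  show ?case
    unfolding lucasV.simps(3)[of _ _ "Suc n"] ge2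
    using aux[OF c(3,4) lucasU.simps(3)] by simp
qed

text \<open>The norm counterpart of \<open>lucasV_eq_lucasU\<close>: the norm of w U_(n+1) - u U_n
  is u times the left-hand side and should be u^(n+1). Passing from n to n + 1 multiplies the
  quadratic form by u.\<close>

lemma lucasU_cassini:
  assumes "y \<in> carrier R" "u \<in> carrier R"
  shows "lucasU y u (Suc n) \<otimes> lucasU y u (Suc n) \<ominus> y \<otimes> (lucasU y u (Suc n) \<otimes> lucasU y u n)
     \<oplus> u \<otimes> (lucasU y u n \<otimes> lucasU y u n) = u [^] n"
proof (induction n)
  case 0
  then show ?case using assms by (simp, algebra)
next
  case (Suc n)
  note c = assms lucasU_closed[OF assms, of n] lucasU_closed[OF assms, of "Suc n"]
  show ?case
    unfolding nat_pow_Suc Suc[symmetric] unfolding lucasU.simps(3) using c by algebra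
qed

lemma power_eq_lucasU:
  assumes "y \<in> carrier R" "u \<in> carrier R" "w \<in> carrier R" "w \<otimes> w = y \<otimes> w \<ominus> u"
  shows "w [^] Suc n = w \<otimes> lucasU y u (Suc n) \<ominus> u \<otimes> lucasU y u n"
proof (induction n)
  case 0
  then show ?case using assms by (simp, algebra)
next
  case (Suc n)
  note c = assms(1-3) lucasU_closed[OF assms(1,2), of n] lucasU_closed[OF assms(1,2), of "Suc n"]
  have "w [^] Suc (Suc n) = (w \<otimes> w) \<otimes> lucasU y u (Suc n) \<ominus> u \<otimes> w \<otimes> lucasU y u n"
    unfolding nat_pow_Suc[of _ "Suc n"] Suc using c by algebra
  also have "\<dots> = w \<otimes> lucasU y u (Suc (Suc n)) \<ominus> u \<otimes> lucasU y u (Suc n)"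
    unfolding assms(4) unfolding lucasU.simps(3) using c by algebra
  finally show ?case .
qed

lemma add_pow_int_0 [simp]: "[(0::int)] \<cdot> x = \<zero>"
  by (simp add: add_pow_def)

text \<open>The upper limit is independent of l so that the sums for l, l + 1 and l + 2 can be
  compared term by term. Beyond \<open>l div 2\<close> the truncated exponent is harmless, the
  coefficient being zero.\<close>

definition dickson_sum :: "'a \<Rightarrow> 'a \<Rightarrow> nat \<Rightarrow> nat \<Rightarrow> 'a"
  where "dickson_sum y u l n = (\<Oplus>s\<in>{..n}. [dcoeff l s] \<cdot> (u [^] s \<otimes> y [^] (l - 2 * s)))"

lemma dickson_sum_pad:
  assumes "y \<in> carrier R" "u \<in> carrier R" "l div 2 \<le> n"
  shows "dickson_sum y u l n = dickson_sum y u l (l div 2)"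
  unfolding dickson_sum_def
proof (rule add.finprod_mono_neutral_cong_right)
  fix s assume "s \<in> {..n} - {..l div 2}"
  then have "dcoeff l s = 0" by (auto simp: dcoeff_def)
  then show "[dcoeff l s] \<cdot> (u [^] s \<otimes> y [^] (l - 2 * s)) = \<zero>" by simp
qed (use assms in auto)

text \<open>\<open>dcoeff_Suc\<close> made homogeneous. The s = 0 terms are split off because they
  have no predecessor in the sum for l.\<close>

lemma dickson_sum_rec:
  assumes "y \<in> carrier R" "u \<in> carrier R" "0 < l" "l \<le> n"
  shows "dickson_sum y u (Suc (Suc l)) (Suc n)
    = y \<otimes> dickson_sum y u (Suc l) (Suc n) \<ominus> u \<otimes> dickson_sum y u l n"
proof -
  let ?t = "\<lambda>l s. [dcoeff l s] \<cdot> (u [^] s \<otimes> y [^] (l - 2 * s))"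
  have cl: "?t m s \<in> carrier R" for m s using assms by simp
  have step: "?t (Suc (Suc l)) (Suc s) = y \<otimes> ?t (Suc l) (Suc s) \<oplus> (\<ominus> u) \<otimes> ?t l s" for s
  proof -
    let ?z = "u [^] Suc s \<otimes> y [^] (l - 2 * s)"
    have z: "?z \<in> carrier R" using assms by simp
    have "?t (Suc (Suc l)) (Suc s) = [(dcoeff (Suc l) (Suc s) - dcoeff l s)] \<cdot> ?z"
      using dcoeff_Suc[OF assms(3)] by simp
    also have "\<dots> = [dcoeff (Suc l) (Suc s)] \<cdot> ?z \<ominus> [dcoeff l s] \<cdot> ?z"
      using add.int_pow_diff[OF z, of "dcoeff (Suc l) (Suc s)" "dcoeff l s"] by (simp add: a_minus_def)
    also have "[dcoeff (Suc l) (Suc s)] \<cdot> ?z = y \<otimes> ?t (Suc l) (Suc s)"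
    proof (cases "2 * Suc s \<le> Suc l")
      case True
      then have "l - 2 * s = Suc (Suc l - 2 * Suc s)" by simp
      then have "?z = y \<otimes> (u [^] Suc s \<otimes> y [^] (Suc l - 2 * Suc s))"
        using assms by (simp add: m_ac)
      then show ?thesis using assms by (simp add: add_pow_rdistr_int)
    next
      case False
      \<comment> \<open>The truncated exponents no longer match here; the coefficient vanishes
        instead.\<close>
      then have "dcoeff (Suc l) (Suc s) = 0" by (simp add: dcoeff_def)
      then show ?thesis using assms by simp
    qed
    also have "[dcoeff l s] \<cdot> ?z = u \<otimes> ?t l s"
      using assms by (simp add: add_pow_rdistr_int m_ac)
    finally show ?thesis using assms by (simp add: a_minus_def l_minus)
  qed
  have t0: "?t (Suc (Suc l)) 0 = y \<otimes> ?t (Suc l) 0" using assms by (simp add: m_ac)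
  have sc: "(\<Oplus>s\<in>{..n}. z \<otimes> f s) = z \<otimes> (\<Oplus>s\<in>{..n}. f s)"
    if "z \<in> carrier R" "\<And>s. f s \<in> carrier R" for z f
    using that by (subst finsum_rdistr) auto
  have "dickson_sum y u (Suc (Suc l)) (Suc n) = (\<Oplus>s\<in>{..n}. ?t (Suc (Suc l)) (Suc s)) \<oplus> ?t (Suc (Suc l)) 0"
    unfolding dickson_sum_def using cl by (subst finsum_Suc2) auto
  also have "(\<Oplus>s\<in>{..n}. ?t (Suc (Suc l)) (Suc s))
     = y \<otimes> (\<Oplus>s\<in>{..n}. ?t (Suc l) (Suc s)) \<oplus> (\<ominus> u) \<otimes> dickson_sum y u l n"
    unfolding step dickson_sum_def using cl assms
    by (subst finsum_addf) (auto simp: sc)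
  also have "\<dots> \<oplus> ?t (Suc (Suc l)) 0 =
      y \<otimes> ((\<Oplus>s\<in>{..n}. ?t (Suc l) (Suc s)) \<oplus> ?t (Suc l) 0) \<ominus> u \<otimes> dickson_sum y u l n"
  proof -
    have "(\<Oplus>s\<in>{..n}. ?t (Suc l) (Suc s)) \<in> carrier R" "dickson_sum y u l n \<in> carrier R"
      unfolding dickson_sum_def using assms by (auto intro!: finsum_closed)
    moreover have "y \<otimes> a \<oplus> (\<ominus> u) \<otimes> d \<oplus> y \<otimes> t = y \<otimes> (a \<oplus> t) \<ominus> u \<otimes> d"
      if "a \<in> carrier R" "d \<in> carrier R" "t \<in> carrier R" for a d t
      using that assms(1,2) by algebra
    ultimately show ?thesis unfolding t0 using cl[of "Suc l" 0] by blast
  qed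
  also have "(\<Oplus>s\<in>{..n}. ?t (Suc l) (Suc s)) \<oplus> ?t (Suc l) 0 = dickson_sum y u (Suc l) (Suc n)"
    unfolding dickson_sum_def using cl by (intro finsum_Suc2[symmetric]) auto
  finally show ?thesis .
qed

text \<open>Both sides satisfy the same recurrence. The base cases are l = 1 and l = 2 rather than 0
  and 1, since the sum for l = 0 is 1 whereas V_0 is 2.\<close>

lemma dickson_sum_eq_lucasV:
  assumes "y \<in> carrier R" "u \<in> carrier R" "0 < l"
  shows "dickson_sum y u l (l div 2) = lucasV y u l"
  using assms(3)
proof (induction l rule: less_induct)
  case (less l)
  consider "l = 1" | "l = 2" | m where "l = Suc (Suc m)" "0 < m"
    using less.prems by (metis One_nat_def Suc_1 gr0_conv_Suc not0_implies_Suc)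
  then show ?case
  proof cases
    case 1
    then show ?thesis using assms by (simp add: dickson_sum_def)
  next
    case 2
    have "dcoeff 2 1 = -2" using dcoeff_rec[of 1 2] by (simp add: numeral_2_eq_2)
    then have "dickson_sum y u 2 1 = [(-2::int)] \<cdot> u \<oplus> y \<otimes> y"
      using assms by (simp add: dickson_sum_def numeral_2_eq_2)
    moreover have "[(-2::int)] \<cdot> u = \<ominus> (u \<oplus> u)"
      using assms by (simp add: add_pow_int_lt numeral_2_eq_2)
    ultimately show ?thesis using 2 assms
      by (simp add: numeral_2_eq_2) algebra
  next
    case 3
    have "dickson_sum y u l (l div 2) = dickson_sum y u (Suc (Suc m)) (Suc m)"
      using 3 dickson_sum_pad[OF assms(1,2), of l "Suc m"] by simp
    also have "\<dots> = y \<otimes> dickson_sum y u (Suc m) (Suc m) \<ominus> u \<otimes> dickson_sum y u m m"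
      using 3 by (intro dickson_sum_rec assms) auto
    also have "dickson_sum y u (Suc m) (Suc m) = lucasV y u (Suc m)"
      using less.IH[of "Suc m"] dickson_sum_pad[OF assms(1,2), of "Suc m" "Suc m"] 3 by simp
    also have "dickson_sum y u m m = lucasV y u m"
      using less.IH[of m] dickson_sum_pad[OF assms(1,2), of m m] 3 by simp
    finally show ?thesis using 3 by simp
  qed
qed

lemma P_sum_eq_lucasV:
  assumes "y \<in> carrier R" "u \<in> carrier R" "0 < l"
  shows "(\<Oplus>s\<in>{0..l div 2}. [ccoeff (l mod 2) s (l div 2)] \<cdot> (u [^] s) \<otimes> y [^] (l - 2 * s)) = lucasV y u l"
  unfolding dickson_sum_eq_lucasV[OF assms, symmetric] dickson_sum_def atMost_atLeast0
  by (rule finsum_cong') (use assms in \<open>auto simp: dcoeff_def add_pow_ldistr_int\<close>)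

end

section \<open>Homomorphisms of subfields\<close>

lemma (in field) subfield_closed:
  assumes "subfield E R"
  shows "\<And>x. x \<in> E \<Longrightarrow> x \<in> carrier R" "\<zero> \<in> E" "\<one> \<in> E"
    "\<And>x. x \<in> E \<Longrightarrow> \<ominus> x \<in> E"
    "\<And>x y. x \<in> E \<Longrightarrow> y \<in> E \<Longrightarrow> x \<oplus> y \<in> E"
    "\<And>x y. x \<in> E \<Longrightarrow> y \<in> E \<Longrightarrow> x \<otimes> y \<in> E"
    "\<And>x y. x \<in> E \<Longrightarrow> y \<in> E \<Longrightarrow> x \<ominus> y \<in> E"
    "\<And>x. x \<in> E \<Longrightarrow> x \<noteq> \<zero> \<Longrightarrow> inv x \<in> E"
    "\<And>x n. x \<in> E \<Longrightarrow> x [^] (n::nat) \<in> E"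
    "\<And>f A. f \<in> A \<rightarrow> E \<Longrightarrow> (\<Oplus>i\<in>A. f i) \<in> E"
proof -
  note r = subringE[OF subfieldE(1)[OF assms]]
  show c: "\<And>x. x \<in> E \<Longrightarrow> x \<in> carrier R" "\<zero> \<in> E" "\<one> \<in> E"
    "\<And>x. x \<in> E \<Longrightarrow> \<ominus> x \<in> E"
    "\<And>x y. x \<in> E \<Longrightarrow> y \<in> E \<Longrightarrow> x \<oplus> y \<in> E"
    "\<And>x y. x \<in> E \<Longrightarrow> y \<in> E \<Longrightarrow> x \<otimes> y \<in> E"
    using r by auto
  show "\<And>x y. x \<in> E \<Longrightarrow> y \<in> E \<Longrightarrow> x \<ominus> y \<in> E" using c by (simp add: a_minus_def)
  show "\<And>x. x \<in> E \<Longrightarrow> x \<noteq> \<zero> \<Longrightarrow> inv x \<in> E" using subfield_m_inv(1)[OF assms] by auto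
  show "x [^] n \<in> E" if "x \<in> E" for x and n :: nat
    by (induction n) (use that c in auto)
  show "(\<Oplus>i\<in>A. f i) \<in> E" if "f \<in> A \<rightarrow> E" for f :: "'c \<Rightarrow> 'a" and A
    using that
  proof (induction A rule: infinite_finite_induct)
    case (insert x A)
    then have "(\<Oplus>i\<in>insert x A. f i) = f x \<oplus> (\<Oplus>i\<in>A. f i)"
      using c(1) by (subst finsum_insert) auto
    then show ?case using insert c by auto
  qed (use c in auto)
qed

lemma (in ring) finsum_lessThan_Suc:
  assumes "\<And>i. i \<le> n \<Longrightarrow> f i \<in> carrier R"
  shows "(\<Oplus>i\<in>{..<Suc n}. f i) = (\<Oplus>i\<in>{..<n}. f i) \<oplus> f n"
  using assms by (simp add: lessThan_Suc Pi_def a_comm)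

text \<open>Maps go into the ambient field, so that automorphisms of E, their iterates and
  embeddings are all covered; stability of E is stated separately where it matters.\<close>

locale subfield_hom = field R for R (structure) +
  fixes E :: "'a set" and h :: "'a \<Rightarrow> 'a"
  assumes E: "subfield E R" and h: "h \<in> ring_hom (R\<lparr>carrier := E\<rparr>) R"
begin

lemmas E_closed = subfield_closed[OF E]

lemma h_closed: "x \<in> E \<Longrightarrow> h x \<in> carrier R"
  using ring_hom_closed[OF h] by simp

lemma h_add: "x \<in> E \<Longrightarrow> y \<in> E \<Longrightarrow> h (x \<oplus> y) = h x \<oplus> h y"
  using ring_hom_add[OF h] by simp

lemma h_mult: "x \<in> E \<Longrightarrow> y \<in> E \<Longrightarrow> h (x \<otimes> y) = h x \<otimes> h y"
  using ring_hom_mult[OF h] by simp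

lemma h_one: "h \<one> = \<one>"
  using ring_hom_one[OF h] by simp

lemma h_zero: "h \<zero> = \<zero>"
  using h_add[OF E_closed(2,2)] h_closed[OF E_closed(2)] by simp

lemma h_neg: "x \<in> E \<Longrightarrow> h (\<ominus> x) = \<ominus> h x"
  using h_add[of "\<ominus> x" x] h_closed E_closed(1,4) h_zero
  by (metis l_neg minus_equality)

lemma h_diff: "x \<in> E \<Longrightarrow> y \<in> E \<Longrightarrow> h (x \<ominus> y) = h x \<ominus> h y"
  using h_add h_neg E_closed(4) by (simp add: a_minus_def)

lemma h_inv:
  assumes "x \<in> E" "x \<noteq> \<zero>" shows "h (inv x) = inv (h x)" "h x \<noteq> \<zero>"
proof -
  have ix: "inv x \<in> E" using assms E_closed(8) by blast
  have *: "h (inv x) \<otimes> h x = \<one>"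
    using h_mult[OF ix assms(1)] h_one subfield_m_inv(3)[OF E, of x] assms by simp
  then show "h x \<noteq> \<zero>" using h_closed[OF ix] by auto
  show "h (inv x) = inv (h x)"
    using * h_closed ix assms(1) by (metis comm_inv_char m_comm)
qed

lemma h_eq_zero_iff: "x \<in> E \<Longrightarrow> h x = \<zero> \<longleftrightarrow> x = \<zero>"
  using h_inv(2) h_zero by blast

lemma h_inj: "inj_on h E"
proof (rule inj_onI)
  fix x y assume xy: "x \<in> E" "y \<in> E" "h x = h y"
  then have "h (x \<ominus> y) = \<zero>" using h_diff h_closed by (simp add: r_right_minus_eq)
  then show "x = y" using h_eq_zero_iff E_closed(1,7) xy by simp
qed

lemma h_pow: "x \<in> E \<Longrightarrow> h (x [^] (n::nat)) = h x [^] n"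
  by (induction n) (simp_all add: h_one h_mult E_closed(9))

lemma h_finsum: "finite A \<Longrightarrow> f \<in> A \<rightarrow> E \<Longrightarrow> h (\<Oplus>i\<in>A. f i) = (\<Oplus>i\<in>A. h (f i))"
proof (induction A rule: finite_induct)
  case (insert x A)
  have "(\<Oplus>i\<in>insert x A. f i) = f x \<oplus> (\<Oplus>i\<in>A. f i)"
    using insert E_closed(1) by (subst finsum_insert) auto
  moreover have "(\<Oplus>i\<in>insert x A. h (f i)) = h (f x) \<oplus> (\<Oplus>i\<in>A. h (f i))"
    using insert h_closed by (subst finsum_insert) auto
  ultimately show ?case using insert h_add[of "f x" "\<Oplus>i\<in>A. f i"] E_closed(10)[of f A] by auto
qed (simp_all add: h_zero)

text \<open>The source of all conjugate roots below: if h fixes the coefficients, it sends a root in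
  E to a root.\<close>

lemma h_eval:
  assumes "set p \<subseteq> E" "x \<in> E" "\<And>c. c \<in> set p \<Longrightarrow> h c = c"
  shows "h (eval p x) = eval p (h x) \<and> eval p x \<in> E"
  using assms
proof (induction p)
  case Nil
  then show ?case by (simp add: h_zero E_closed)
next
  case (Cons c p)
  then show ?case
    by (simp add: h_add h_mult h_pow E_closed)
qed

end

lemma (in field) subfield_homI:
  assumes "subfield E R"
    "\<And>x. x \<in> E \<Longrightarrow> h x \<in> carrier R" "\<And>x y. x \<in> E \<Longrightarrow> y \<in> E \<Longrightarrow> h (x \<oplus> y) = h x \<oplus> h y"
    "\<And>x y. x \<in> E \<Longrightarrow> y \<in> E \<Longrightarrow> h (x \<otimes> y) = h x \<otimes> h y" "h \<one> = \<one>"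
  shows "subfield_hom R E h"
proof (intro subfield_hom.intro subfield_hom_axioms.intro)
  show "field R" by (rule field_axioms)
  show "subfield E R" by (fact assms(1))
  show "h \<in> ring_hom (R\<lparr>carrier := E\<rparr>) R"
    by (rule ring_hom_memI) (simp_all add: assms(2-))
qed

lemma (in field) subfield_hom_funpow:
  assumes "subfield_hom R E g" "g ` E \<subseteq> E"
  shows "subfield_hom R E (g ^^ n)" "\<And>x. x \<in> E \<Longrightarrow> (g ^^ n) x \<in> E"
proof -
  interpret g: subfield_hom R E g by fact
  have *: "\<And>x. x \<in> E \<Longrightarrow> (g ^^ n) x \<in> E" by (induction n) (use assms(2) in auto)
  show "\<And>x. x \<in> E \<Longrightarrow> (g ^^ n) x \<in> E" by (rule *)
  show "subfield_hom R E (g ^^ n)"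
  proof (rule subfield_homI[OF g.E])
    fix x assume "x \<in> E"
    then show "(g ^^ n) x \<in> carrier R" using * g.E_closed(1) by blast
  next
    fix x y assume "x \<in> E" "y \<in> E"
    moreover from this have "\<And>m. (g ^^ m) x \<in> E" "\<And>m. (g ^^ m) y \<in> E"
      using assms(2) by (induct_tac m, auto)+
    ultimately show "(g ^^ n) (x \<oplus> y) = (g ^^ n) x \<oplus> (g ^^ n) y" "(g ^^ n) (x \<otimes> y) = (g ^^ n) x \<otimes> (g ^^ n) y"
      by (induction n) (auto simp: g.h_add g.h_mult)
  next
    show "(g ^^ n) \<one> = \<one>" by (induction n) (auto simp: g.h_one)
  qed
qed

section \<open>Independence of characters and fixed fields\<close>

text \<open>Gaussian elimination: a row i0 with nonzero last entry eliminates the last unknown from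
  the other rows, and a solution of the smaller system is extended by back substitution.\<close>

lemma (in field) homogeneous_system_solution:
  fixes a :: "'i \<Rightarrow> nat \<Rightarrow> 'a"
  assumes "subfield E R" "finite I" "card I < n" "\<And>i j. i \<in> I \<Longrightarrow> a i j \<in> E"
  shows "\<exists>c. (\<forall>j. c j \<in> E) \<and> (\<exists>j<n. c j \<noteq> \<zero>) \<and> (\<forall>i\<in>I. (\<Oplus>j\<in>{..<n}. c j \<otimes> a i j) = \<zero>)"
  using assms(2-)
proof (induction n arbitrary: I a)
  case 0
  then show ?case by simp
next
  case (Suc n)
  note cl = subfield_closed[OF assms(1)]
  have aE: "a i j \<in> E" "a i j \<in> carrier R" if "i \<in> I" for i j
    using Suc.prems(3) that cl(1) by auto
  show ?case
  proof (cases "\<forall>i\<in>I. a i n = \<zero>")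
    case True
    \<comment> \<open>The last column is zero, so the last unit vector is a solution.\<close>
    let ?c = "\<lambda>j. if j = n then \<one> else \<zero>"
    have "(\<Oplus>j\<in>{..<Suc n}. ?c j \<otimes> a i j) = \<zero>" if "i \<in> I" for i
    proof -
      have "(\<Oplus>j\<in>{..<Suc n}. ?c j \<otimes> a i j) = (\<Oplus>j\<in>{..<Suc n}. \<zero>)"
        by (rule finsum_cong') (use True that aE in auto)
      then show ?thesis by simp
    qed
    then show ?thesis using cl(2,3) one_not_zero by (intro exI[of _ ?c]) auto
  next
    case False
    then obtain i0 where i0: "i0 \<in> I" "a i0 n \<noteq> \<zero>" by blast
    let ?k = "\<lambda>i. a i n \<otimes> inv (a i0 n)"
    have inv0: "inv (a i0 n) \<in> E" using i0 aE cl(8) by blast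
    have kE: "?k i \<in> E" if "i \<in> I" for i using that inv0 aE cl(6) by blast
    let ?b = "\<lambda>i j. a i j \<ominus> ?k i \<otimes> a i0 j"
    have card: "card (I - {i0}) < n" using Suc.prems i0 by (metis card_Diff1_less less_Suc_eq_le order_less_le_trans)
    have bE: "?b i j \<in> E" if "i \<in> I - {i0}" for i j
      by (rule cl(7)[OF aE(1) cl(6)[OF kE aE(1)[OF i0(1)]]]) (use that in auto)
    obtain c where c: "\<And>j. c j \<in> E" "\<exists>j<n. c j \<noteq> \<zero>"
      "\<And>i. i \<in> I - {i0} \<Longrightarrow> (\<Oplus>j\<in>{..<n}. c j \<otimes> ?b i j) = \<zero>"
      using Suc.IH[of "I - {i0}" ?b] bE card Suc.prems(1) by blast
    have cC: "c j \<in> carrier R" for j using c(1) cl(1) by blast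
    let ?S = "\<lambda>i. \<Oplus>j\<in>{..<n}. c j \<otimes> a i j"
    have SE: "?S i \<in> E" if "i \<in> I" for i
      using that aE c(1) cl(6) by (intro cl(10)) auto
    \<comment> \<open>The last unknown is solved from row i0; the other rows then hold by the
      eliminated system.\<close>
    define d where "d = (\<lambda>j. if j = n then \<ominus> (inv (a i0 n) \<otimes> ?S i0) else c j)"
    have dn: "d n \<in> E" unfolding d_def using cl(4,6) inv0 SE[OF i0(1)] by simp
    have dE: "d j \<in> E" for j using dn c(1) unfolding d_def by auto
    have dC: "d j \<in> carrier R" for j using dE cl(1) by blast
    have split: "(\<Oplus>j\<in>{..<Suc n}. d j \<otimes> a i j) = ?S i \<oplus> d n \<otimes> a i n" if "i \<in> I" for i
    proof -
      have "(\<Oplus>j\<in>{..<Suc n}. d j \<otimes> a i j) = (\<Oplus>j\<in>{..<n}. d j \<otimes> a i j) \<oplus> d n \<otimes> a i n"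
        by (rule finsum_lessThan_Suc) (use dC aE that in auto)
      also have "(\<Oplus>j\<in>{..<n}. d j \<otimes> a i j) = ?S i"
        by (rule finsum_cong') (use cC aE that in \<open>auto simp: d_def\<close>)
      finally show ?thesis .
    qed
    have "(\<Oplus>j\<in>{..<Suc n}. d j \<otimes> a i j) = \<zero>" if i: "i \<in> I" for i
    proof -
      have carr: "inv (a i0 n) \<in> carrier R" "?S i0 \<in> carrier R" "?S i \<in> carrier R"
        "a i n \<in> carrier R" "a i0 n \<in> carrier R"
        using inv0 SE i i0 aE cl(1) by auto
      have "?S i = ?k i \<otimes> ?S i0"
      proof (cases "i = i0")
        case True
        have "?k i0 = \<one>" using i0 aE carr by (simp add: field_Units)
        then show ?thesis using True carr by simp
      next
        case False
        have "?S i \<ominus> ?k i \<otimes> ?S i0 = (\<Oplus>j\<in>{..<n}. c j \<otimes> ?b i j)"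
        proof -
          have "(\<Oplus>j\<in>{..<n}. c j \<otimes> ?b i j) = (\<Oplus>j\<in>{..<n}. c j \<otimes> a i j \<oplus> (\<ominus> ?k i) \<otimes> (c j \<otimes> a i0 j))"
          proof (rule finsum_cong')
            fix j
            show "c j \<otimes> ?b i j = c j \<otimes> a i j \<oplus> (\<ominus> ?k i) \<otimes> (c j \<otimes> a i0 j)"
              using cC[of j] aE(2)[OF i, of j] aE(2)[OF i0(1), of j] carr by algebra
          qed (use cC aE i i0 carr in auto)
          also have "\<dots> = ?S i \<oplus> (\<Oplus>j\<in>{..<n}. (\<ominus> ?k i) \<otimes> (c j \<otimes> a i0 j))"
            using cC aE i i0 carr by (intro finsum_addf) auto
          also have "(\<Oplus>j\<in>{..<n}. (\<ominus> ?k i) \<otimes> (c j \<otimes> a i0 j)) = (\<ominus> ?k i) \<otimes> ?S i0"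
            using cC aE i i0 carr by (intro finsum_rdistr[symmetric]) auto
          also have "?S i \<oplus> (\<ominus> ?k i) \<otimes> ?S i0 = ?S i \<ominus> ?k i \<otimes> ?S i0"
            using carr by (simp add: a_minus_def l_minus)
          finally show ?thesis by simp
        qed
        then have "?S i \<ominus> ?k i \<otimes> ?S i0 = \<zero>" using c(3) False i by simp
        then show ?thesis using carr by (simp add: r_right_minus_eq)
      qed
      moreover have "d n \<otimes> a i n = \<ominus> (?k i \<otimes> ?S i0)"
      proof -
        have "(\<ominus> (r \<otimes> s)) \<otimes> t = \<ominus> (t \<otimes> r \<otimes> s)"
          if "r \<in> carrier R" "s \<in> carrier R" "t \<in> carrier R" for r s t
          using that by algebra
        then show ?thesis unfolding d_def using carr by simp
      qed
      ultimately show ?thesis using split[OF i] carr by (simp add: r_neg)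
    qed
    moreover have "\<exists>j<Suc n. d j \<noteq> \<zero>"
      using c(2) unfolding d_def by (metis less_Suc_eq less_irrefl)
    ultimately show ?thesis using dE by blast
  qed
qed

text \<open>Subtract \<open>h n z\<close> times the relation at x from the relation at z x. The term
  of \<open>h n\<close> cancels, and the other coefficients are multiplied by
  \<open>h i z \<ominus> h n z\<close>, which a suitable z makes nonzero for any given i.\<close>

lemma (in field) dedekind_independence:
  fixes i n :: nat
  assumes "i < n"
    and "\<And>i. i < n \<Longrightarrow> subfield_hom R E (h i)"
    and "\<And>i j. i < j \<Longrightarrow> j < n \<Longrightarrow> \<exists>z\<in>E. h i z \<noteq> h j z"
    and "\<And>i. c i \<in> carrier R"
    and "\<And>x. x \<in> E \<Longrightarrow> (\<Oplus>i\<in>{..<n}. c i \<otimes> h i x) = \<zero>"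
  shows "c i = \<zero>"
  using assms
proof (induction n arbitrary: c i)
  case 0
  then show ?case by simp
next
  case (Suc n)
  have hC: "h i x \<in> carrier R" if "i \<le> n" "x \<in> E" for i x
    using subfield_hom.h_closed[OF Suc.prems(2)[of i]] that by simp
  interpret hn: subfield_hom R E "h n" by (rule Suc.prems(2)) simp
  have cC: "c i \<in> carrier R" for i using Suc.prems by simp
  have low: "c i = \<zero>" if i: "i < n" for i
  proof -
    obtain z where z: "z \<in> E" "h i z \<noteq> h n z" using Suc.prems(3)[of i n] i by auto
    let ?d = "\<lambda>i. if i < n then c i \<otimes> (h i z \<ominus> h n z) else \<zero>"
    have "?d i = \<zero>"
    proof (rule Suc.IH[OF i])
      fix x assume x: "x \<in> E"
      have xz: "z \<otimes> x \<in> E" by (rule hn.E_closed(6)[OF z(1) x])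
      have eq0: "(\<Oplus>i\<in>{..<Suc n}. c i \<otimes> h i y) = (\<Oplus>i\<in>{..<n}. c i \<otimes> h i y) \<oplus> c n \<otimes> h n y" if "y \<in> E" for y
        by (rule finsum_lessThan_Suc) (use that cC hC in auto)
      have sC: "(\<Oplus>i\<in>{..<n}. c i \<otimes> h i y) \<in> carrier R" if "y \<in> E" for y
        by (rule finsum_closed) (use that cC hC in auto)
      have "(\<Oplus>i\<in>{..<n}. ?d i \<otimes> h i x) = (\<Oplus>i\<in>{..<n}. c i \<otimes> h i (z \<otimes> x) \<oplus> (\<ominus> h n z) \<otimes> (c i \<otimes> h i x))"
      proof (rule finsum_cong')
        fix i assume "i \<in> {..<n}"
        then have i: "i < n" by simp
        have m: "h i (z \<otimes> x) = h i z \<otimes> h i x"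
          using subfield_hom.h_mult[OF Suc.prems(2)[of i] z(1) x] i by simp
        show "?d i \<otimes> h i x = c i \<otimes> h i (z \<otimes> x) \<oplus> (\<ominus> h n z) \<otimes> (c i \<otimes> h i x)"
        proof -
          have "r \<otimes> (s \<ominus> t) \<otimes> k = r \<otimes> (s \<otimes> k) \<oplus> (\<ominus> t) \<otimes> (r \<otimes> k)"
            if "r \<in> carrier R" "s \<in> carrier R" "t \<in> carrier R" "k \<in> carrier R" for r s t k
            using that by algebra
          then show ?thesis
            using i hC[of i z] hC[of i x] hC[of n z] x z(1) cC[of i] unfolding m by simp
        qed
      qed (use cC hC xz x z in auto)
      also have "\<dots> = (\<Oplus>i\<in>{..<n}. c i \<otimes> h i (z \<otimes> x)) \<oplus> (\<Oplus>i\<in>{..<n}. (\<ominus> h n z) \<otimes> (c i \<otimes> h i x))"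
        using cC hC xz x z by (intro finsum_addf) auto
      also have "(\<Oplus>i\<in>{..<n}. (\<ominus> h n z) \<otimes> (c i \<otimes> h i x)) = (\<ominus> h n z) \<otimes> (\<Oplus>i\<in>{..<n}. c i \<otimes> h i x)"
        using cC hC xz x z by (intro finsum_rdistr[symmetric]) auto
      also have "(\<Oplus>i\<in>{..<n}. c i \<otimes> h i x) = \<ominus> (c n \<otimes> h n x)"
        using Suc.prems(5)[OF x] sC[OF x] cC[of n] hC[of n x] x unfolding eq0[OF x]
        by (metis le_refl m_closed minus_equality)
      also have "(\<Oplus>i\<in>{..<n}. c i \<otimes> h i (z \<otimes> x)) = \<ominus> (c n \<otimes> h n (z \<otimes> x))"
        using Suc.prems(5)[OF xz] sC[OF xz] cC[of n] hC[of n "z \<otimes> x"] xz unfolding eq0[OF xz]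
        by (metis le_refl m_closed minus_equality)
      also have "\<ominus> (c n \<otimes> h n (z \<otimes> x)) \<oplus> \<ominus> h n z \<otimes> \<ominus> (c n \<otimes> h n x) = \<zero>"
      proof -
        have "\<ominus> (r \<otimes> (s \<otimes> t)) \<oplus> \<ominus> s \<otimes> \<ominus> (r \<otimes> t) = \<zero>"
          if "r \<in> carrier R" "s \<in> carrier R" "t \<in> carrier R" for r s t
          using that by algebra
        then show ?thesis unfolding hn.h_mult[OF z(1) x] using cC[of n] hC[of n z] hC[of n x] x z(1) by simp
      qed
      finally show "(\<Oplus>i\<in>{..<n}. ?d i \<otimes> h i x) = \<zero>" .
    qed (use Suc.prems cC hC z in auto)
    then have "c i \<otimes> (h i z \<ominus> h n z) = \<zero>" using that by simp
    moreover have "h i z \<ominus> h n z \<noteq> \<zero>" using z hC[of i z] hC[of n z] that by (simp add: r_right_minus_eq)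
    ultimately show ?thesis using cC[of i] hC[of i z] hC[of n z] z that integral by fastforce
  qed
  \<comment> \<open>With the lower coefficients gone, the relation at \<one> isolates
    \<open>c n\<close>.\<close>
  have "(\<Oplus>i\<in>{..<Suc n}. c i \<otimes> h i \<one>) = (\<Oplus>i\<in>{..<n}. c i \<otimes> h i \<one>) \<oplus> c n \<otimes> h n \<one>"
    by (rule finsum_lessThan_Suc) (use cC hC hn.E_closed in auto)
  moreover have "(\<Oplus>i\<in>{..<n}. c i \<otimes> h i \<one>) = (\<Oplus>i\<in>{..<n}. \<zero>)"
    by (rule finsum_cong') (use low hC hn.E_closed in auto)
  ultimately have "c n = \<zero>"
    using Suc.prems(5)[OF hn.E_closed(3)] cC[of n] hn.h_one by simp
  then show ?case using low Suc.prems(1) less_antisym by blast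
qed

section \<open>The order of an automorphism and the degree over its fixed field\<close>

lemma (in field) combine_eq_finsum:
  assumes "set Us \<subseteq> carrier R" "\<And>i. d i \<in> carrier R" "n \<le> length Us"
  shows "combine (map d [0..<n]) (take n Us) = (\<Oplus>i\<in>{..<n}. d i \<otimes> Us ! i)"
  using assms(3)
proof (induction n)
  case (Suc n)
  have U: "Us ! i \<in> carrier R" if "i < length Us" for i using assms(1) that by auto
  have "combine (map d [0..<Suc n]) (take (Suc n) Us)
      = combine (map d [0..<n]) (take n Us) \<oplus> combine [d n] [Us ! n]"
    using Suc.prems assms U
    by (subst combine_append) (auto simp: take_Suc_conv_app_nth dest: in_set_takeD)
  also have "\<dots> = (\<Oplus>i\<in>{..<n}. d i \<otimes> Us ! i) \<oplus> d n \<otimes> Us ! n"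
    using Suc U assms(2) by simp
  also have "\<dots> = (\<Oplus>i\<in>{..<Suc n}. d i \<otimes> Us ! i)"
    by (rule finsum_lessThan_Suc[symmetric]) (use assms(2) U Suc.prems in auto)
  finally show ?case .
qed simp

text \<open>T is K-linear on E, so its values on generators decide. It is applied to L-linear
  combinations of powers of an automorphism.\<close>

lemma (in field) additive_vanishes_on_Span:
  assumes "subfield K R" "subfield E R" "K \<subseteq> E" "set Us \<subseteq> E"
    and "\<And>x. x \<in> E \<Longrightarrow> T x \<in> carrier R" "\<And>x y. x \<in> E \<Longrightarrow> y \<in> E \<Longrightarrow> T (x \<oplus> y) = T x \<oplus> T y"
    and "\<And>k x. k \<in> K \<Longrightarrow> x \<in> E \<Longrightarrow> T (k \<otimes> x) = k \<otimes> T x"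
    and "\<And>x. x \<in> set Us \<Longrightarrow> T x = \<zero>" and "x \<in> Span K Us"
  shows "T x = \<zero>"
proof -
  note cl = subfield_closed[OF assms(2)] and Kcl = subfield_closed(1)[OF assms(1)]
  have T0: "T \<zero> = \<zero>" using assms(6)[OF cl(2,2)] assms(5)[OF cl(2)] by simp
  have "set Us \<subseteq> carrier R" using assms(4) cl(1) by blast
  then obtain Ks where Ks: "set Ks \<subseteq> K" "x = combine Ks Us"
    using Span_mem_iff_length_version[OF assms(1)] assms(9) by blast
  have "combine Ks Us \<in> E \<and> T (combine Ks Us) = \<zero>"
    using Ks(1) assms(4,8)
  proof (induction Ks Us rule: combine.induct)
    case (1 k Ks u Us)
    then have *: "combine Ks Us \<in> E" "T (combine Ks Us) = \<zero>" "k \<in> K" "u \<in> E" "T u = \<zero>" by auto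
    have ku: "k \<otimes> u \<in> E" using * assms(3) cl(6) by blast
    have "T (k \<otimes> u \<oplus> combine Ks Us) = k \<otimes> T u \<oplus> \<zero>"
      using assms(6)[OF ku *(1)] assms(7)[OF *(3,4)] *(2) by simp
    then show ?case using * Kcl ku cl(5) by simp
  qed (use T0 cl in auto)
  then show ?thesis using Ks(2) by simp
qed

text \<open>Artin's argument: a relation over L that persists under all powers of g descends to K.
  With last coefficient 1, either all coefficients are fixed by g, or applying g and subtracting
  gives a shorter nontrivial relation.\<close>

lemma (in field) artin_dependence:
  fixes n :: nat
  assumes "\<exists>i<n. c i \<noteq> \<zero>"
    and "subfield_hom R L g" "g ` L \<subseteq> L" "subfield K R" "K \<subseteq> L" "\<And>x. x \<in> L \<Longrightarrow> g x = x \<longleftrightarrow> x \<in> K"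
    and "\<And>i. x i \<in> L" "\<And>i. c i \<in> L"
    and "\<And>j. (\<Oplus>i\<in>{..<n}. c i \<otimes> (g ^^ j) (x i)) = \<zero>"
  shows "\<exists>d. (\<forall>i. d i \<in> K) \<and> (\<exists>i<n. d i \<noteq> \<zero>) \<and> (\<Oplus>i\<in>{..<n}. d i \<otimes> x i) = \<zero>"
  using assms(1,7-)
proof (induction n arbitrary: c x)
  case 0
  then show ?case by simp
next
  case (Suc n)
  interpret g: subfield_hom R L g by fact
  note cl = g.E_closed and Kcl = subfield_closed[OF assms(4)]
  have gL: "\<And>x. x \<in> L \<Longrightarrow> g x \<in> L" using assms(3) by blast
  have gj: "\<And>x j. x \<in> L \<Longrightarrow> (g ^^ j) x \<in> L" using subfield_hom_funpow(2)[OF assms(2,3)] .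
  have xL: "\<And>i. x i \<in> L" and cL: "\<And>i. c i \<in> L" using Suc.prems by auto
  have prodC: "\<And>i j. e i \<in> L \<Longrightarrow> e i \<otimes> (g ^^ j) (x i) \<in> carrier R" for e
    using gj xL cl(1,6) by blast
  have spl: "(\<Oplus>i\<in>{..<Suc n}. e i \<otimes> (g ^^ j) (x i))
      = (\<Oplus>i\<in>{..<n}. e i \<otimes> (g ^^ j) (x i)) \<oplus> e n \<otimes> (g ^^ j) (x n)" if "\<And>i. e i \<in> L" for e j
    by (rule finsum_lessThan_Suc) (use that prodC in auto)
  have sumC: "(\<Oplus>i\<in>{..<n}. e i \<otimes> (g ^^ j) (x i)) \<in> carrier R" if "\<And>i. e i \<in> L" for e j
    by (rule finsum_closed) (use that prodC in auto)
  \<comment> \<open>A shorter relation over K is enough, as it can be padded with zero.\<close>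
  have lift: ?case if "\<forall>i. d i \<in> K" "\<exists>i<n. d i \<noteq> \<zero>" "(\<Oplus>i\<in>{..<n}. d i \<otimes> x i) = \<zero>" for d
  proof -
    let ?d = "\<lambda>i. if i < n then d i else \<zero>"
    have dL: "\<And>i. ?d i \<in> L" using that(1) assms(5) cl(2) by auto
    have "(\<Oplus>i\<in>{..<Suc n}. ?d i \<otimes> (g ^^ 0) (x i)) = (\<Oplus>i\<in>{..<n}. ?d i \<otimes> (g ^^ 0) (x i)) \<oplus> ?d n \<otimes> (g ^^ 0) (x n)"
      by (rule spl[OF dL])
    also have "(\<Oplus>i\<in>{..<n}. ?d i \<otimes> (g ^^ 0) (x i)) = (\<Oplus>i\<in>{..<n}. d i \<otimes> x i)"
      by (rule finsum_cong') (use that(1) xL Kcl cl in auto)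
    finally have "(\<Oplus>i\<in>{..<Suc n}. ?d i \<otimes> x i) = \<zero>" using that(3) xL cl(1) by simp
    then show ?thesis using that(1,2) Kcl(2) less_SucI by (intro exI[of _ ?d]) auto
  qed
  show ?case
  proof (cases "c n = \<zero>")
    case True
    have "(\<Oplus>i\<in>{..<n}. c i \<otimes> (g ^^ j) (x i)) = \<zero>" for j
      using Suc.prems(4)[of j] spl[of c j, OF cL] sumC[of c j, OF cL] True gj[OF xL] cl(1) by simp
    moreover have "\<exists>i<n. c i \<noteq> \<zero>" using Suc.prems(1) True less_antisym by blast
    ultimately show ?thesis using Suc.IH[of c x] xL cL lift by blast
  next
    case False
    define e where "e = (\<lambda>i. inv (c n) \<otimes> c i)"
    have icn: "inv (c n) \<in> L" using False cL cl(8) by blast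
    have eL: "\<And>i. e i \<in> L" unfolding e_def using icn cL cl(6) by blast
    have en: "e n = \<one>" unfolding e_def using False cL cl(1) field_Units by simp
    have rel: "(\<Oplus>i\<in>{..<Suc n}. e i \<otimes> (g ^^ j) (x i)) = \<zero>" for j
    proof -
      have "(\<Oplus>i\<in>{..<Suc n}. e i \<otimes> (g ^^ j) (x i)) = (\<Oplus>i\<in>{..<Suc n}. inv (c n) \<otimes> (c i \<otimes> (g ^^ j) (x i)))"
        by (rule finsum_cong') (use icn cL gj xL cl(1) in \<open>auto simp: e_def m_assoc\<close>)
      also have "\<dots> = inv (c n) \<otimes> (\<Oplus>i\<in>{..<Suc n}. c i \<otimes> (g ^^ j) (x i))"
        using icn cL prodC cl(1) by (intro finsum_rdistr[symmetric]) auto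
      finally show ?thesis using Suc.prems(4) icn cl(1) by simp
    qed
    show ?thesis
    proof (cases "\<forall>i<n. g (e i) = e i")
      case True
      let ?d = "\<lambda>i. if i \<le> n then e i else \<zero>"
      have dK: "\<forall>i. ?d i \<in> K" 
      proof
        fix i show "?d i \<in> K"
          using True assms(6)[OF eL, of i] en Kcl(2,3) by (cases "i < n"; cases "i = n") auto
      qed
      have "(\<Oplus>i\<in>{..<Suc n}. ?d i \<otimes> x i) = (\<Oplus>i\<in>{..<Suc n}. e i \<otimes> (g ^^ 0) (x i))"
        by (rule finsum_cong') (use eL xL cl(1) in auto)
      then have "(\<Oplus>i\<in>{..<Suc n}. ?d i \<otimes> x i) = \<zero>" using rel[of 0] by simp
      moreover have "\<exists>i<Suc n. ?d i \<noteq> \<zero>" using en by (intro exI[of _ n]) simp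
      ultimately show ?thesis using dK by (intro exI[of _ ?d] conjI)
    next
      case False
      let ?f = "\<lambda>i. g (e i) \<ominus> e i"
      have fL: "\<And>i. ?f i \<in> L" using eL gL cl(7) by blast
      have nz: "\<exists>i<n. ?f i \<noteq> \<zero>" using False eL gL cl(1) by (auto simp: r_right_minus_eq)
      \<comment> \<open>Applying g to the relation for j, and taking the relation for j + 1, both
        give last summand g^(j+1) (x n) with coefficient 1. Their difference involves only i < n and
        is a relation for the elements \<open>g (x i)\<close>.\<close>
      have frel: "(\<Oplus>i\<in>{..<n}. ?f i \<otimes> (g ^^ j) (g (x i))) = \<zero>" for j
      proof -
        have gx: "\<And>i. (g ^^ j) (g (x i)) = g ((g ^^ j) (x i))"
          by (simp add: funpow_swap1)
        have cC: "\<And>i. (g ^^ j) (x i) \<in> L" "\<And>i. g ((g ^^ j) (x i)) \<in> L" using gj xL gL by auto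
        have geL: "\<And>i. g (e i) \<in> L" using eL gL by blast
        have A: "(\<Oplus>i\<in>{..<n}. g (e i) \<otimes> g ((g ^^ j) (x i))) \<oplus> g ((g ^^ j) (x n)) = \<zero>"
        proof -
          have "g (\<Oplus>i\<in>{..<Suc n}. e i \<otimes> (g ^^ j) (x i)) = (\<Oplus>i\<in>{..<Suc n}. g (e i \<otimes> (g ^^ j) (x i)))"
            by (rule g.h_finsum) (use eL cC cl(6) in auto)
          also have "\<dots> = (\<Oplus>i\<in>{..<Suc n}. g (e i) \<otimes> g ((g ^^ j) (x i)))"
            by (rule finsum_cong') (use eL cC g.h_mult geL cl(1) in auto)
          also have "\<dots> = (\<Oplus>i\<in>{..<n}. g (e i) \<otimes> g ((g ^^ j) (x i))) \<oplus> g (e n) \<otimes> g ((g ^^ j) (x n))"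
            by (rule finsum_lessThan_Suc) (use geL cC cl(1) in auto)
          finally show ?thesis using rel[of j] g.h_zero en g.h_one cC(2)[of n] cl(1) by simp
        qed
        have B: "(\<Oplus>i\<in>{..<n}. e i \<otimes> g ((g ^^ j) (x i))) \<oplus> g ((g ^^ j) (x n)) = \<zero>"
          using rel[of "Suc j"] spl[of e "Suc j", OF eL] en cC(2)[of n] cl(1) by simp
        have sC: "(\<Oplus>i\<in>{..<n}. g (e i) \<otimes> g ((g ^^ j) (x i))) \<in> carrier R"
            "(\<Oplus>i\<in>{..<n}. e i \<otimes> g ((g ^^ j) (x i))) \<in> carrier R"
          by (rule finsum_closed, use geL eL cC cl(1) in auto)+
        have AB: "(\<Oplus>i\<in>{..<n}. g (e i) \<otimes> g ((g ^^ j) (x i))) = (\<Oplus>i\<in>{..<n}. e i \<otimes> g ((g ^^ j) (x i)))"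
          by (rule add.r_cancel[OF trans[OF A B[symmetric]] sC cl(1)[OF cC(2)[of n]]])
        have "(\<Oplus>i\<in>{..<n}. ?f i \<otimes> (g ^^ j) (g (x i)))
          = (\<Oplus>i\<in>{..<n}. g (e i) \<otimes> g ((g ^^ j) (x i)) \<oplus> (\<ominus> \<one>) \<otimes> (e i \<otimes> g ((g ^^ j) (x i))))"
        proof (rule finsum_cong')
          fix i
          have "(r \<ominus> s) \<otimes> t = r \<otimes> t \<oplus> (\<ominus> \<one>) \<otimes> (s \<otimes> t)"
            if "r \<in> carrier R" "s \<in> carrier R" "t \<in> carrier R" for r s t
            using that by algebra
          then show "?f i \<otimes> (g ^^ j) (g (x i)) = g (e i) \<otimes> g ((g ^^ j) (x i)) \<oplus> (\<ominus> \<one>) \<otimes> (e i \<otimes> g ((g ^^ j) (x i)))"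
            unfolding gx using cl(1)[OF geL] cl(1)[OF eL] cl(1)[OF cC(2)] by blast
        qed (use geL eL cC cl(1) in auto)
        also have "\<dots> = (\<Oplus>i\<in>{..<n}. g (e i) \<otimes> g ((g ^^ j) (x i)))
            \<oplus> (\<Oplus>i\<in>{..<n}. (\<ominus> \<one>) \<otimes> (e i \<otimes> g ((g ^^ j) (x i))))"
          using geL eL cC cl(1) by (intro finsum_addf) auto
        also have "(\<Oplus>i\<in>{..<n}. (\<ominus> \<one>) \<otimes> (e i \<otimes> g ((g ^^ j) (x i))))
            = (\<ominus> \<one>) \<otimes> (\<Oplus>i\<in>{..<n}. e i \<otimes> g ((g ^^ j) (x i)))"
          using geL eL cC cl(1) by (intro finsum_rdistr[symmetric]) auto
        finally show ?thesis using AB sC by (simp add: l_minus r_neg)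
      qed
      obtain d where d: "\<forall>i. d i \<in> K" "\<exists>i<n. d i \<noteq> \<zero>" "(\<Oplus>i\<in>{..<n}. d i \<otimes> g (x i)) = \<zero>"
        using Suc.IH[OF nz, of "\<lambda>i. g (x i)"] frel fL gL xL by blast
      have dL: "\<And>i. d i \<in> L" using d(1) assms(5) by blast
      \<comment> \<open>The coefficients d lie in K, so injectivity of g carries the relation back
        from the \<open>g (x i)\<close> to the \<open>x i\<close>.\<close>
      have "g (\<Oplus>i\<in>{..<n}. d i \<otimes> x i) = (\<Oplus>i\<in>{..<n}. g (d i \<otimes> x i))"
        by (rule g.h_finsum) (use dL xL cl(6) in auto)
      also have "\<dots> = (\<Oplus>i\<in>{..<n}. d i \<otimes> g (x i))"
      proof (rule finsum_cong')
        fix i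
        have "g (d i) = d i" using assms(6)[OF dL] d(1) by blast
        then show "g (d i \<otimes> x i) = d i \<otimes> g (x i)" using g.h_mult[OF dL xL] by simp
      qed (use dL xL gL cl(1) in auto)
      finally have "(\<Oplus>i\<in>{..<n}. d i \<otimes> x i) = \<zero>"
        using d(3) g.h_eq_zero_iff[of "\<Oplus>i\<in>{..<n}. d i \<otimes> x i"] dL xL cl(6) cl(10)[of "\<lambda>i. d i \<otimes> x i" "{..<n}"]
        by auto
      then show ?thesis using lift d by blast
    qed
  qed
qed

text \<open>A period at most l comes from independence of characters, the absence of a smaller one
  from descent of relations; both compare the number of powers of g with a basis of l
  elements.\<close>

lemma (in field) fixed_field_order:
  assumes "subfield_hom R L g" "g ` L \<subseteq> L" "subfield K R" "K \<subseteq> L" "\<And>x. x \<in> L \<Longrightarrow> g x = x \<longleftrightarrow> x \<in> K"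
    and "dimension l K L"
  shows "\<And>x. x \<in> L \<Longrightarrow> (g ^^ l) x = x"
    and "\<And>i. 0 < i \<Longrightarrow> i < l \<Longrightarrow> \<exists>z\<in>L. (g ^^ i) z \<noteq> z"
proof -
  interpret g: subfield_hom R L g by fact
  note cl = g.E_closed
  note gn = subfield_hom_funpow[OF assms(1,2)]
  obtain Us where Us: "set Us \<subseteq> carrier R" "independent K Us" "length Us = l" "Span K Us = L"
    using exists_base[OF assms(3,6)] by blast
  have UL: "set Us \<subseteq> L" using Span_base_incl[OF assms(3) Us(1)] Us(4) by simp
  have gK: "\<And>k n. k \<in> K \<Longrightarrow> (g ^^ n) k = k"
  proof -
    fix k n assume "k \<in> K"
    then have "g k = k" using assms(4,5) by blast
    then show "(g ^^ n) k = k" by (induction n) auto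
  qed
  have "\<exists>m>0. m \<le> l \<and> (\<forall>x\<in>L. (g ^^ m) x = x)"
  proof (rule ccontr)
    assume neg: "\<not> ?thesis"
    \<comment> \<open>Without a period up to l, the powers g^0, ..., g^l are distinct
      characters.\<close>
    have dist: "\<exists>z\<in>L. (g ^^ i) z \<noteq> (g ^^ j) z" if ij: "i < j" "j < Suc l" for i j
    proof (rule ccontr)
      assume "\<not> ?thesis"
      then have eq: "\<forall>z\<in>L. (g ^^ i) z = (g ^^ j) z" by blast
      have "(g ^^ (j - i)) z = z" if z: "z \<in> L" for z
      proof -
        have "(g ^^ i) ((g ^^ (j - i)) z) = (g ^^ i) z"
          using eq z ij by (metis add_diff_inverse_nat comp_apply funpow_add less_imp_le_nat not_less)
        then show ?thesis
          using subfield_hom.h_inj[OF gn(1)[of i]] gn(2) z by (meson inj_onD)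
      qed
      then show False using neg ij by (metis diff_le_self le_trans less_Suc_eq_le zero_less_diff)
    qed
    \<comment> \<open>l equations in l + 1 unknowns: a nontrivial L-combination of the powers of g
      vanishes on the basis, hence on L, against independence of characters.\<close>
    obtain c where c: "\<And>i. c i \<in> L" "\<exists>i<Suc l. c i \<noteq> \<zero>"
      "\<And>k. k \<in> {..<l} \<Longrightarrow> (\<Oplus>i\<in>{..<Suc l}. c i \<otimes> (g ^^ i) (Us ! k)) = \<zero>"
    proof -
      have "\<exists>c. (\<forall>i. c i \<in> L) \<and> (\<exists>i<Suc l. c i \<noteq> \<zero>) \<and>
          (\<forall>k\<in>{..<l}. (\<Oplus>i\<in>{..<Suc l}. c i \<otimes> (g ^^ i) (Us ! k)) = \<zero>)"
        by (rule homogeneous_system_solution[OF g.E]) (use gn(2) UL Us(3) in \<open>auto simp: subset_iff\<close>)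
      then show ?thesis using that by blast
    qed
    define T where "T = (\<lambda>x. \<Oplus>i\<in>{..<Suc l}. c i \<otimes> (g ^^ i) x)"
    have pc: "c i \<otimes> (g ^^ i) x \<in> carrier R" if "x \<in> L" for i x
      using c(1) gn(2) that cl(1) by auto
    have "T x = \<zero>" if "x \<in> L" for x
    proof (rule additive_vanishes_on_Span[OF assms(3) g.E assms(4) UL, where T = T])
      show "x \<in> Span K Us" using that Us(4) by simp
      fix x assume x: "x \<in> L"
      show "T x \<in> carrier R" unfolding T_def by (rule finsum_closed) (use pc x in auto)
      fix y assume y: "y \<in> L"
      have "T (x \<oplus> y) = (\<Oplus>i\<in>{..<Suc l}. c i \<otimes> (g ^^ i) x \<oplus> c i \<otimes> (g ^^ i) y)"
        unfolding T_def
        by (rule finsum_cong') (use x y pc c(1) gn(2) cl(1) subfield_hom.h_add[OF gn(1)] in \<open>auto simp: r_distr\<close>)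
      also have "\<dots> = T x \<oplus> T y" unfolding T_def by (rule finsum_addf) (use pc x y in auto)
      finally show "T (x \<oplus> y) = T x \<oplus> T y" .
    next
      fix k x assume kx: "k \<in> K" "x \<in> L"
      then have k: "k \<in> L" "k \<in> carrier R" using assms(4) cl(1) by auto
      have "T (k \<otimes> x) = (\<Oplus>i\<in>{..<Suc l}. k \<otimes> (c i \<otimes> (g ^^ i) x))"
        unfolding T_def
      proof (rule finsum_cong')
        fix i
        have "(g ^^ i) (k \<otimes> x) = k \<otimes> (g ^^ i) x"
          using subfield_hom.h_mult[OF gn(1) k(1) kx(2)] gK kx by simp
        then show "c i \<otimes> (g ^^ i) (k \<otimes> x) = k \<otimes> (c i \<otimes> (g ^^ i) x)"
          using m_lcomm c(1) gn(2) kx k cl(1) by simp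
      qed (use pc kx k in auto)
      also have "\<dots> = k \<otimes> T x" unfolding T_def by (rule finsum_rdistr[symmetric]) (use pc kx k in auto)
      finally show "T (k \<otimes> x) = k \<otimes> T x" .
    next
      fix x assume "x \<in> set Us"
      then obtain k where "k < l" "x = Us ! k" using Us(3) by (metis in_set_conv_nth)
      then show "T x = \<zero>" unfolding T_def using c(3) by simp
    qed
    then have rel: "(\<Oplus>i\<in>{..<Suc l}. c i \<otimes> (g ^^ i) x) = \<zero>" if "x \<in> L" for x
      using that unfolding T_def .
    have "c i = \<zero>" if "i < Suc l" for i
      by (rule dedekind_independence[OF that, where h = "\<lambda>i. g ^^ i" and E = L])
         (rule gn(1) | rule cl(1)[OF c(1)] | erule dist, assumption | erule rel)+
    then show False using c(2) by blast
  qed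
  then obtain m0 where m0: "0 < m0" "m0 \<le> l" "\<forall>x\<in>L. (g ^^ m0) x = x" by blast
  define m where "m = (LEAST m. 0 < m \<and> (\<forall>x\<in>L. (g ^^ m) x = x))"
  have m: "0 < m" "\<forall>x\<in>L. (g ^^ m) x = x"
    using LeastI[of "\<lambda>m. 0 < m \<and> (\<forall>x\<in>L. (g ^^ m) x = x)" m0] m0 unfolding m_def by auto
  have least: "\<And>i. 0 < i \<Longrightarrow> i < m \<Longrightarrow> \<exists>z\<in>L. (g ^^ i) z \<noteq> z"
    using not_less_Least[of _ "\<lambda>m. 0 < m \<and> (\<forall>x\<in>L. (g ^^ m) x = x)"] unfolding m_def by blast
  have "m \<le> l" unfolding m_def
    by (rule order_trans[OF Least_le m0(2)]) (use m0 in auto)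
  moreover have "\<not> m < l"
  proof
    assume "m < l"
    let ?x = "\<lambda>i. if i < l then Us ! i else \<zero>"
    have xL: "\<And>i. ?x i \<in> L" using UL Us(3) cl(2) by auto
    \<comment> \<open>Now m < l equations in l unknowns. Periodicity extends the relations from j <
      m to every j, and descent to K contradicts independence of the basis.\<close>
    obtain c where c: "\<And>i. c i \<in> L" "\<exists>i<l. c i \<noteq> \<zero>"
      "\<And>j. j \<in> {..<m} \<Longrightarrow> (\<Oplus>i\<in>{..<l}. c i \<otimes> (g ^^ j) (?x i)) = \<zero>"
    proof -
      have "\<exists>c. (\<forall>i. c i \<in> L) \<and> (\<exists>i<l. c i \<noteq> \<zero>) \<and>
          (\<forall>j\<in>{..<m}. (\<Oplus>i\<in>{..<l}. c i \<otimes> (g ^^ j) (?x i)) = \<zero>)"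
        by (rule homogeneous_system_solution[OF g.E]) (use gn(2)[OF xL] \<open>m < l\<close> in auto)
      then show ?thesis using that by blast
    qed
    have "(\<Oplus>i\<in>{..<l}. c i \<otimes> (g ^^ j) (?x i)) = \<zero>" for j
    proof -
      have "(g ^^ j) (?x i) = (g ^^ (j mod m)) (?x i)" for i
        using funpow_mod_eq[of m g "?x i" j] m xL by simp
      then show ?thesis using c(3)[of "j mod m"] m(1) by simp
    qed
    then obtain d where d: "\<forall>i. d i \<in> K" "\<exists>i<l. d i \<noteq> \<zero>" "(\<Oplus>i\<in>{..<l}. d i \<otimes> ?x i) = \<zero>"
      using artin_dependence[OF c(2) assms(1-5), of ?x] xL c(1) by blast
    have dC: "\<And>i. d i \<in> carrier R" using d(1) assms(4) cl(1) by blast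
    have "(\<Oplus>i\<in>{..<l}. d i \<otimes> Us ! i) = (\<Oplus>i\<in>{..<l}. d i \<otimes> ?x i)"
      by (rule finsum_cong') (use dC Us(1,3) in \<open>auto simp: subset_iff\<close>)
    then have "combine (map d [0..<l]) Us = \<zero>"
      using combine_eq_finsum[OF Us(1), of d l] dC Us(3) d(3) by simp
    then have "set (take (length Us) (map d [0..<l])) \<subseteq> {\<zero>}"
      using independent_imp_trivial_combine[OF assms(3) Us(2), of "map d [0..<l]"] d(1) by auto
    then show False using d(2) Us(3) by (auto simp: image_subset_iff)
  qed
  ultimately have "m = l" by simp
  then show "\<And>x. x \<in> L \<Longrightarrow> (g ^^ l) x = x" "\<And>i. 0 < i \<Longrightarrow> i < l \<Longrightarrow> \<exists>z\<in>L. (g ^^ i) z \<noteq> z"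
    using m least by auto
qed

section \<open>Minimal polynomials\<close>

context field
begin

lemma length_poly_ring_add:
  assumes "subfield K R" "p \<in> carrier (K[X])" "q \<in> carrier (K[X])" "length p \<le> n" "length q \<le> n"
  shows "length (p \<oplus>\<^bsub>K[X]\<^esub> q) \<le> n"
  using poly_add_length_le[of p q] assms(4,5) unfolding univ_poly_add by simp

lemma coeff_poly_ring_add:
  assumes "subfield K R" "p \<in> carrier (K[X])" "q \<in> carrier (K[X])"
  shows "coeff (p \<oplus>\<^bsub>K[X]\<^esub> q) n = coeff p n \<oplus> coeff q n"
proof -
  have "set p \<subseteq> carrier R" "set q \<subseteq> carrier R"
    using assms polynomial_in_carrier[OF subfieldE(1)[OF assms(1)]] unfolding univ_poly_carrier[symmetric] by auto
  then show ?thesis unfolding univ_poly_add by (subst poly_add_coeff) auto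
qed

lemma length_poly_ring_finsum:
  assumes "subfield K R" "finite A" "f \<in> A \<rightarrow> carrier (K[X])" "\<And>i. i \<in> A \<Longrightarrow> length (f i) \<le> n"
  shows "length (finsum (K[X]) f A) \<le> n"
proof -
  interpret UP: domain "K[X]" using univ_poly_is_domain[OF subfieldE(1)[OF assms(1)]] .
  show ?thesis using assms(2-)
  proof (induction A rule: finite_induct)
    case empty
    then show ?case by (simp add: univ_poly_zero)
  next
    case (insert x A)
    then have "finsum (K[X]) f (insert x A) = f x \<oplus>\<^bsub>K[X]\<^esub> finsum (K[X]) f A"
      by (intro UP.finsum_insert) auto
    then show ?case using insert length_poly_ring_add[OF assms(1)] UP.finsum_closed[of f A] by auto
  qed
qed

text \<open>A nonempty coefficient list has length degree + 1, so \<open>length r \<le> n\<close>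
  says that r does not reach X^n. The polynomials to be recognised as minimal are brought into this
  form.\<close>

lemma monic_polynomial:
  assumes "subfield K R" "r \<in> carrier (K[X])" "length r \<le> n"
  defines "p \<equiv> X [^]\<^bsub>K[X]\<^esub> n \<oplus>\<^bsub>K[X]\<^esub> r"
  shows "p \<in> carrier (K[X])" "length p = Suc n" "lead_coeff p = \<one>" "coeff p n = \<one>"
    "\<And>x. x \<in> carrier R \<Longrightarrow> eval p x = x [^] n \<oplus> eval r x"
proof -
  note K = subfieldE(1)[OF assms(1)]
  interpret UP: domain "K[X]" using univ_poly_is_domain[OF K] .
  have m: "X [^]\<^bsub>K[X]\<^esub> n = monom \<one> n" using unitary_monom_eq_var_pow[OF K] by simp
  have Xn: "X [^]\<^bsub>K[X]\<^esub> n \<in> carrier (K[X])" using var_pow_closed[OF K] .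
  show p: "p \<in> carrier (K[X])" unfolding p_def using Xn assms(2) by simp
  have lm: "length (monom \<one> n) = Suc n" by (simp add: monom_def)
  have pol: "polynomial K (monom \<one> n)" "polynomial K r"
    using Xn assms(2) unfolding m univ_poly_carrier[symmetric] by auto
  show len: "length p = Suc n"
    unfolding p_def univ_poly_add m using poly_add_length_eq[OF K pol] lm assms(3) by simp
  have "coeff p n = coeff (monom \<one> n) n \<oplus> coeff r n"
    unfolding p_def m using coeff_poly_ring_add[OF assms(1) Xn assms(2)] m by simp
  also have "\<dots> = \<one>" using coeff_length[of r n] assms(3) by (simp add: monom_coeff)
  finally show c: "coeff p n = \<one>" .
  then show "lead_coeff p = \<one>" using lead_coeff_simp[of p] len by (metis diff_Suc_1 length_0_conv nat.simps(3))
  fix x assume x: "x \<in> carrier R"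
  interpret ev: ring_hom_ring "K[X]" R "\<lambda>p. eval p x" using eval_ring_hom[OF K x] .
  show "eval p x = x [^] n \<oplus> eval r x"
    unfolding p_def using Xn assms(2) var_closed(1)[OF K] x by (simp add: ev.hom_nat_pow eval_var)
qed

text \<open>A nonempty p would have degree below the number of elements of S, all of them
  roots.\<close>

lemma polynomial_eq_Nil_if_many_roots:
  assumes "subfield K R" "p \<in> carrier (K[X])" "S \<subseteq> carrier R" "\<And>x. x \<in> S \<Longrightarrow> eval p x = \<zero>"
    "length p \<le> card S"
  shows "p = []"
proof (rule ccontr)
  assume ne: "p \<noteq> []"
  have p: "p \<in> carrier (poly_ring R)"
    using assms(2) carrier_polynomial[OF subfieldE(1)[OF assms(1)]] by (simp add: univ_poly_carrier[symmetric])
  have "S \<subseteq> set_mset (roots p)"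
    using assms(3,4) ne roots_mem_iff_is_root[OF p] by (auto simp: is_root_def)
  then have "card S \<le> card (set_mset (roots p))" by (intro card_mono) auto
  also have "\<dots> \<le> size (roots p)"
    by (metis mset_set_set_mset_msubset size_mset_mono size_mset_set)
  also have "\<dots> \<le> degree p" by (rule size_roots_le_degree[OF p])
  finally show False using assms(5) ne by (cases p) auto
qed

text \<open>n distinct roots force the degree of \<open>Irr K x\<close> to be at least n, while it
  divides a monic polynomial of degree n. The difference of the two has degree below n and still
  vanishes on S.\<close>

lemma Irr_eqI:
  assumes "subfield K R" "x \<in> carrier R" "r \<in> carrier (K[X])" "length r \<le> n"
    and "eval (X [^]\<^bsub>K[X]\<^esub> n \<oplus>\<^bsub>K[X]\<^esub> r) x = \<zero>"
    and "S \<subseteq> carrier R" "card S = n" "\<And>z. z \<in> S \<Longrightarrow> eval (Irr K x) z = \<zero>"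
  shows "Irr K x = X [^]\<^bsub>K[X]\<^esub> n \<oplus>\<^bsub>K[X]\<^esub> r" (is "_ = ?p")
proof -
  note K = subfieldE(1)[OF assms(1)]
  interpret UP: domain "K[X]" using univ_poly_is_domain[OF K] .
  note p = monic_polynomial[OF assms(1,3,4)]
  have alg: "(algebraic over K) x" by (rule algebraicI[OF p(1) _ assms(5)]) (use p(2) in auto)
  note I = IrrE[OF assms(1,2) alg]
  have ne: "Irr K x \<noteq> []" using I(2) by (metis UP.ring_irreducibleE(1) I(1) univ_poly_zero)
  have ge: "n < length (Irr K x)"
    using polynomial_eq_Nil_if_many_roots[OF assms(1) I(1) assms(6,8)] ne assms(7) by (meson not_le)
  have dvd: "Irr K x pdivides ?p" by (rule Irr_minimal[OF assms(1,2) alg p(1) assms(5)])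
  then have "degree (Irr K x) \<le> degree ?p"
    using pdivides_imp_degree_le[OF K I(1) p(1)] p(2) by fastforce
  then have len: "length (Irr K x) = Suc n" using p(2) ge by linarith
  have cI: "coeff (Irr K x) n = \<one>" using lead_coeff_simp[OF ne] I(3) len by simp
  let ?d = "?p \<ominus>\<^bsub>K[X]\<^esub> Irr K x"
  have nI: "\<ominus>\<^bsub>K[X]\<^esub> Irr K x \<in> carrier (K[X])" using I(1) by simp
  have d: "?d \<in> carrier (K[X])" using p(1) I(1) by simp
  have lend: "length ?d \<le> Suc n"
    unfolding a_minus_def by (rule length_poly_ring_add[OF assms(1) p(1) nI])
      (use p(2) len univ_poly_a_inv_length[OF K I(1)] in auto)
  have "coeff (\<ominus>\<^bsub>K[X]\<^esub> Irr K x) n = \<ominus> \<one>"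
  proof -
    have "coeff (map (\<lambda>a. \<ominus> a) p) i = \<ominus> (coeff p i)" for p i by (induction p) auto
    then show ?thesis using univ_poly_a_inv_def'[OF K I(1)] cI by simp
  qed
  then have c0: "coeff ?d n = \<zero>"
    unfolding a_minus_def using coeff_poly_ring_add[OF assms(1) p(1) nI] p(4) by (simp add: r_neg)
  have "length ?d \<noteq> Suc n"
  proof
    assume l: "length ?d = Suc n"
    then have "?d \<noteq> []" by auto
    then have "lead_coeff ?d = \<zero>" using lead_coeff_simp[of ?d] l c0 by simp
    then show False using d \<open>?d \<noteq> []\<close> unfolding univ_poly_carrier[symmetric] polynomial_def by simp
  qed
  then have lend': "length ?d \<le> card S" using lend assms(7) by simp
  have "eval ?d z = \<zero>" if z: "z \<in> S" for z
  proof -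
    have zc: "z \<in> carrier R" using z assms(6) by blast
    interpret ev: ring_hom_ring "K[X]" R "\<lambda>p. eval p z" using eval_ring_hom[OF K zc] .
    obtain q where q: "q \<in> carrier (K[X])" "?p = Irr K x \<otimes>\<^bsub>K[X]\<^esub> q"
      using dvd unfolding pdivides_iff_shell[OF assms(1) I(1) p(1)] factor_def by blast
    have "eval ?p z = eval (Irr K x) z \<otimes> eval q z"
      unfolding q(2) using I(1) q(1) by simp
    then have "eval ?p z = \<zero>" using assms(8)[OF z] q(1) by simp
    then show ?thesis unfolding a_minus_def using p(1) I(1) assms(8)[OF z] by simp
  qed
  then have "?d = []" using polynomial_eq_Nil_if_many_roots[OF assms(1) d assms(6) _ lend'] by blast
  then have "?d = \<zero>\<^bsub>K[X]\<^esub>" by (simp add: univ_poly_zero)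
  then have "?p = Irr K x" using UP.r_right_minus_eq[OF p(1) I(1)] by blast
  then show ?thesis by simp
qed

lemma poly_of_const_props:
  assumes "subfield K R" "c \<in> K"
  shows "poly_of_const c \<in> carrier (K[X])" "length (poly_of_const c) \<le> 1"
    "\<And>x. x \<in> carrier R \<Longrightarrow> eval (poly_of_const c) x = c"
proof -
  have c: "c \<in> carrier R" using subfield_closed[OF assms(1)] assms(2) by blast
  show "poly_of_const c \<in> carrier (K[X])"
    unfolding poly_of_const_def univ_poly_carrier[symmetric] using normalize_gives_polynomial[of "[c]" K] assms(2) by simp
  show "length (poly_of_const c) \<le> 1"
    unfolding poly_of_const_def using normalize_length_le[of "[c]"] by simp
  show "\<And>x. x \<in> carrier R \<Longrightarrow> eval (poly_of_const c) x = c"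
    using c by (auto simp: poly_of_const_def)
qed

lemma kummer_poly_eq:
  assumes "subfield M R" "a \<in> M" "0 < l"
  obtains r where "r \<in> carrier (M[X])" "length r \<le> l" "kummer_poly R M l a = X [^]\<^bsub>M[X]\<^esub> l \<oplus>\<^bsub>M[X]\<^esub> r"
    "\<And>x. x \<in> carrier R \<Longrightarrow> eval r x = \<ominus> a"
proof
  note K = subfieldE(1)[OF assms(1)]
  interpret UP: domain "M[X]" using univ_poly_is_domain[OF K] .
  note c = poly_of_const_props[OF assms(1,2)]
  let ?r = "\<ominus>\<^bsub>M[X]\<^esub> poly_of_const a"
  show "?r \<in> carrier (M[X])" using c by simp
  show "length ?r \<le> l" using univ_poly_a_inv_length[OF K c(1)] c(2) assms(3) by simp
  show "kummer_poly R M l a = X [^]\<^bsub>M[X]\<^esub> l \<oplus>\<^bsub>M[X]\<^esub> ?r"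
    by (simp add: kummer_poly_def a_minus_def)
  fix x assume x: "x \<in> carrier R"
  interpret ev: ring_hom_ring "M[X]" R "\<lambda>p. eval p x" using eval_ring_hom[OF K x] .
  show "eval ?r x = \<ominus> a" using c x by simp
qed

text \<open>The s = 0 term is X^l, and r collects the terms with s \<ge> 1 together with \<alpha>.
  Evaluation becomes a Lucas value, which turns roots of P into a statement on power sums.\<close>

lemma P_poly_eq:
  assumes "subfield K R" "u \<in> K" "\<alpha> \<in> K" "0 < l"
  obtains r where "r \<in> carrier (K[X])" "length r \<le> l" "P_poly R K l u \<alpha> = X [^]\<^bsub>K[X]\<^esub> l \<oplus>\<^bsub>K[X]\<^esub> r"
    "\<And>x. x \<in> carrier R \<Longrightarrow> eval (P_poly R K l u \<alpha>) x = lucasV x u l \<ominus> \<alpha>"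
proof
  note K = subfieldE(1)[OF assms(1)]
  note cl = subfield_closed[OF assms(1)]
  interpret UP: domain "K[X]" using univ_poly_is_domain[OF K] .
  let ?c = "\<lambda>s. [ccoeff (l mod 2) s (l div 2)] \<cdot> (u [^] s)"
  have addpow: "[k] \<cdot> z \<in> K" if "z \<in> K" for k :: int and z
  proof -
    have nat: "[n] \<cdot> z \<in> K" for n :: nat
      using cl that by (induction n) (auto simp: add_pow_def nat_pow_def)
    show ?thesis
      by (cases "k \<ge> 0") (use nat cl(4) in \<open>auto simp: add_pow_int_ge add_pow_int_lt\<close>)
  qed
  have cK: "?c s \<in> K" for s using addpow cl(9)[OF assms(2)] by blast
  note pc = poly_of_const_props[OF assms(1) cK] and pa = poly_of_const_props[OF assms(1,3)]
  have Xn: "X [^]\<^bsub>K[X]\<^esub> (n::nat) \<in> carrier (K[X])" for n using var_pow_closed[OF K] .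
  let ?t = "\<lambda>s. poly_of_const (?c s) \<otimes>\<^bsub>K[X]\<^esub> X [^]\<^bsub>K[X]\<^esub> (l - 2 * s)"
  have tc: "?t s \<in> carrier (K[X])" for s using pc(1) Xn by simp
  let ?r = "finsum (K[X]) ?t {1..l div 2} \<ominus>\<^bsub>K[X]\<^esub> poly_of_const \<alpha>"
  have fc: "finsum (K[X]) ?t A \<in> carrier (K[X])" for A using tc by (intro UP.finsum_closed) auto
  show r: "?r \<in> carrier (K[X])" using fc pa(1) by simp
  have tlen: "length (?t s) \<le> l" if "s \<in> {1..l div 2}" for s
  \<comment> \<open>The coefficient may be zero in R. The product is then the empty list; the
    monomial form is available only otherwise.\<close>
  proof (cases "?c s = \<zero>")
    case True
    then have "poly_of_const (?c s) = \<zero>\<^bsub>K[X]\<^esub>" by (simp add: poly_of_const_def univ_poly_zero)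
    then have "?t s = []" using Xn by (simp add: UP.l_null) (simp add: univ_poly_zero)
    then show ?thesis by simp
  next
    case False
    have "poly_of_const (?c s) = [?c s]" using False by (simp add: poly_of_const_def)
    then have "?t s = monom (?c s) (l - 2 * s)"
      using monom_eq_var_pow[OF K, of "?c s"] False cK cl(1) by simp
    then show ?thesis using that by (auto simp: monom_def)
  qed
  have "length (finsum (K[X]) ?t {1..l div 2}) \<le> l"
    by (rule length_poly_ring_finsum[OF assms(1)]) (use tc tlen in auto)
  then show "length ?r \<le> l"
    unfolding a_minus_def
    by (intro length_poly_ring_add[OF assms(1)]) (use fc pa assms(4) univ_poly_a_inv_length[OF K pa(1)] in auto)
  have set: "{0..l div 2} = insert 0 {1..l div 2}" by auto
  have "poly_of_const (?c 0) = \<one>\<^bsub>K[X]\<^esub>"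
    by (simp add: ccoeff.simps poly_of_const_def univ_poly_one)
  then have t0: "?t 0 = X [^]\<^bsub>K[X]\<^esub> l" using Xn by simp
  have "finsum (K[X]) ?t {0..l div 2} = ?t 0 \<oplus>\<^bsub>K[X]\<^esub> finsum (K[X]) ?t {1..l div 2}"
    unfolding set by (rule UP.finsum_insert) (use tc tc[of 0] in auto)
  then show "P_poly R K l u \<alpha> = X [^]\<^bsub>K[X]\<^esub> l \<oplus>\<^bsub>K[X]\<^esub> ?r"
    unfolding P_poly_def t0 a_minus_def using Xn[of l] fc[of "{1..l div 2}"] pa(1) by (simp add: UP.a_assoc)
  fix x assume x: "x \<in> carrier R"
  interpret ev: ring_hom_ring "K[X]" R "\<lambda>p. eval p x" using eval_ring_hom[OF K x] .
  have "eval (P_poly R K l u \<alpha>) x = eval (finsum (K[X]) ?t {0..l div 2}) x \<ominus> \<alpha>"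
    unfolding P_poly_def a_minus_def using fc[of "{0..l div 2}"] pa x by simp
  also have "eval (finsum (K[X]) ?t {0..l div 2}) x = (\<Oplus>s\<in>{0..l div 2}. eval (?t s) x)"
    using ev.hom_finsum[of ?t "{0..l div 2}"] tc by (simp add: comp_def)
  also have "\<dots> = (\<Oplus>s\<in>{0..l div 2}. ?c s \<otimes> x [^] (l - 2 * s))"
  proof (rule finsum_cong')
    fix s
    show "eval (?t s) x = ?c s \<otimes> x [^] (l - 2 * s)"
      using pc(1)[of s] pc(3)[OF x, of s] Xn var_closed(1)[OF K] x by (simp add: ev.hom_nat_pow eval_var)
  qed (use cK cl(1) x in auto)
  also have "\<dots> = lucasV x u l"
    by (rule P_sum_eq_lucasV[OF x _ assms(4)]) (use assms(2) cl(1) in blast)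
  finally show "eval (P_poly R K l u \<alpha>) x = lucasV x u l \<ominus> \<alpha>" .
qed

end

section \<open>The quadratic extension by a root of unity\<close>

context field
begin

lemma adjoin_props:
  assumes "subfield M R" "x \<in> carrier R"
  shows "subfield (adjoin R M x) R" "M \<subseteq> adjoin R M x" "x \<in> adjoin R M x"
    "\<And>E. subfield E R \<Longrightarrow> M \<subseteq> E \<Longrightarrow> x \<in> E \<Longrightarrow> adjoin R M x \<subseteq> E"
proof -
  have c: "insert x M \<subseteq> carrier R" using assms subfieldE(3) by blast
  show "subfield (adjoin R M x) R" "M \<subseteq> adjoin R M x" "x \<in> adjoin R M x"
    "\<And>E. subfield E R \<Longrightarrow> M \<subseteq> E \<Longrightarrow> x \<in> E \<Longrightarrow> adjoin R M x \<subseteq> E"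
    unfolding adjoin_def
    using generate_field_is_subfield[OF c] generate_fieldE(2)[OF c refl] generate_field_min_subfield1[OF c]
    by auto
qed

lemma adjoin_absorb:
  assumes "subfield M R" "x \<in> M" shows "adjoin R M x = M"
  using adjoin_props[OF assms(1), of x] assms subfieldE(3)[OF assms(1)] by blast

lemma adjoin_eq_simple_extension:
  assumes "subfield K R" "x \<in> carrier R" "(algebraic over K) x"
  shows "adjoin R K x = simple_extension K x"
proof
  have "subfield (simple_extension K x) R" using simple_extension_is_subfield[OF assms(1,2)] assms(3) by blast
  then show "adjoin R K x \<subseteq> simple_extension K x"
    using adjoin_props(4)[OF assms(1,2)] simple_extension_incl[OF subfieldE(3)[OF assms(1)] assms(2)]
      simple_extension_mem[OF subfieldE(1)[OF assms(1)] assms(2)] by blast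
  show "simple_extension K x \<subseteq> adjoin R K x"
    by (rule simple_extension_subring_incl[OF subfieldE(1)[OF adjoin_props(1)[OF assms(1,2)]]])
       (use adjoin_props[OF assms(1,2)] in auto)
qed

text \<open>The bound on the degree of p is what later lets a fixed element be tested against the
  conjugates of the generator by counting roots.\<close>

lemma adjoin_eq_eval_image:
  assumes "subfield K R" "x \<in> carrier R" "(algebraic over K) x" "z \<in> adjoin R K x"
  obtains p where "p \<in> carrier (K[X])" "length p < length (Irr K x)" "z = eval p x"
proof -
  have "z \<in> simple_extension K x" using assms adjoin_eq_simple_extension by blast
  moreover have "simple_extension K x = Span K (exp_base x (degree (Irr K x)))"
    using Span_exp_base[OF assms(1-3)] by simp
  moreover have "Span K (exp_base x n) = (\<lambda>p. eval p x) ` { p \<in> carrier (K[X]). length p \<le> n }" for n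
    using Span_eq_eval_img[OF assms(1,2)] by blast
  moreover have "Irr K x \<noteq> []"
    using IrrE(2)[OF assms(1-3)] IrrE(1)[OF assms(1-3)]
      domain.ring_irreducibleE(1)[OF univ_poly_is_domain[OF subfieldE(1)[OF assms(1)]]]
    by (metis univ_poly_zero)
  ultimately show ?thesis using that
    by (smt (verit, best) One_nat_def Suc_pred imageE le_imp_less_Suc length_greater_0_conv mem_Collect_eq)
qed

end

text \<open>\<xi> is a root of X^2 - t X + 1 with t in M, and it lies in M only if it is its own
  inverse. This covers quadratic M(\<xi>) as well as \<xi> equal to 1 or -1, where conjugation is
  the identity.\<close>

locale unit_quadratic = field R for R (structure) +
  fixes M :: "'a set" and \<xi> :: 'a
  assumes M: "subfield M R" and xi: "\<xi> \<in> carrier R" "\<xi> \<noteq> \<zero>"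
    and trace: "\<xi> \<oplus> inv \<xi> \<in> M" and xi_in: "\<xi> \<in> M \<Longrightarrow> \<xi> = inv \<xi>"
begin

lemmas M_closed = subfield_closed[OF M]

abbreviation t where "t \<equiv> \<xi> \<oplus> inv \<xi>"
abbreviation N where "N \<equiv> adjoin R M \<xi>"

lemma inv_xi: "inv \<xi> \<in> carrier R" "\<xi> \<otimes> inv \<xi> = \<one>" "inv \<xi> \<otimes> \<xi> = \<one>" "inv \<xi> \<noteq> \<zero>"
  using xi field_Units by auto

lemma t_closed: "t \<in> carrier R" using trace M_closed(1) by blast

lemma xi_square: "\<xi> \<otimes> \<xi> = t \<otimes> \<xi> \<ominus> \<one>" "inv \<xi> \<otimes> inv \<xi> = t \<otimes> inv \<xi> \<ominus> \<one>"
proof -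
  have "\<xi> \<otimes> \<xi> = t \<otimes> \<xi> \<ominus> inv \<xi> \<otimes> \<xi>" "inv \<xi> \<otimes> inv \<xi> = t \<otimes> inv \<xi> \<ominus> \<xi> \<otimes> inv \<xi>"
    using xi(1) inv_xi(1) by algebra+
  then show "\<xi> \<otimes> \<xi> = t \<otimes> \<xi> \<ominus> \<one>" "inv \<xi> \<otimes> inv \<xi> = t \<otimes> inv \<xi> \<ominus> \<one>"
    by (simp_all add: inv_xi)
qed

lemma xi_algebraic: "(algebraic over M) \<xi>"
proof (rule algebraicI)
  show "[\<one>, \<ominus> t, \<one>] \<in> carrier (M[X])"
    unfolding univ_poly_carrier[symmetric] polynomial_def using M_closed trace by auto
  have "\<xi> \<otimes> \<xi> \<oplus> (\<ominus> t \<otimes> \<xi> \<oplus> \<one>) = \<zero>"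
    unfolding xi_square(1) using xi(1) t_closed by algebra
  then show "eval [\<one>, \<ominus> t, \<one>] \<xi> = \<zero>"
    using xi t_closed by (simp add: numeral_2_eq_2)
qed simp

lemma N_subfield: "subfield N R" and M_subset: "M \<subseteq> N" and xi_N: "\<xi> \<in> N"
  using adjoin_props[OF M xi(1)] by auto

lemmas N_closed = subfield_closed[OF N_subfield]

lemma N_repr: assumes "x \<in> N" obtains a b where "a \<in> M" "b \<in> M" "x = a \<oplus> b \<otimes> \<xi>"
proof -
  have "x \<in> simple_extension M \<xi>" using assms adjoin_eq_simple_extension[OF M xi(1) xi_algebraic] by simp
  \<comment> \<open>Elements arise by Horner steps: multiplying by \<xi> and adding a constant keeps
    the linear form once \<xi>^2 is reduced.\<close>
  then have "\<exists>a\<in>M. \<exists>b\<in>M. x = a \<oplus> b \<otimes> \<xi>"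
  proof (induction rule: simple_extension.induct)
    case zero
    then show ?case using M_closed(2) xi by (intro bexI[of _ \<zero>]) auto
  next
    case (lin k1 k2)
    then obtain a b where ab: "a \<in> M" "b \<in> M" "k1 = a \<oplus> b \<otimes> \<xi>" by blast
    have c: "a \<in> carrier R" "b \<in> carrier R" "k2 \<in> carrier R" using ab lin M_closed(1) by auto
    have "k1 \<otimes> \<xi> \<oplus> k2 = a \<otimes> \<xi> \<oplus> b \<otimes> (\<xi> \<otimes> \<xi>) \<oplus> k2"
      unfolding ab using c xi(1) by algebra
    also have "\<dots> = (k2 \<ominus> b) \<oplus> (a \<oplus> b \<otimes> t) \<otimes> \<xi>"
      unfolding xi_square(1) using c xi(1) t_closed by algebra
    finally show ?case
      using M_closed(7)[OF lin(2) ab(2)] M_closed(5)[OF ab(1) M_closed(6)[OF ab(2) trace]] by blast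
  qed
  then show ?thesis using that by blast
qed

lemma repr_N: "a \<in> M \<Longrightarrow> b \<in> M \<Longrightarrow> a \<oplus> b \<otimes> \<xi> \<in> N"
  using M_subset xi_N N_closed(5,6) by blast

lemma inv_xi_N: "inv \<xi> \<in> N" using xi_N N_closed(8) xi(2) by blast

lemma repr_unique:
  assumes "\<xi> \<notin> M" "a \<in> M" "b \<in> M" "c \<in> M" "d \<in> M" "a \<oplus> b \<otimes> \<xi> = c \<oplus> d \<otimes> \<xi>"
  shows "a = c" "b = d"
proof -
  have car: "a \<in> carrier R" "b \<in> carrier R" "c \<in> carrier R" "d \<in> carrier R" using assms M_closed(1) by auto
  have "(b \<ominus> d) \<otimes> \<xi> = (a \<oplus> b \<otimes> \<xi>) \<ominus> a \<ominus> d \<otimes> \<xi>" using car xi(1) by algebra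
  also have "\<dots> = c \<ominus> a" unfolding assms(6) using car xi(1) by algebra
  finally have e: "(b \<ominus> d) \<otimes> \<xi> = c \<ominus> a" .
  show "b = d"
  proof (rule ccontr)
    assume "b \<noteq> d"
    then have nz: "b \<ominus> d \<in> M - {\<zero>}" using assms M_closed(7) car by (simp add: r_right_minus_eq)
    then have "\<xi> \<in> M" using subfield_m_inv_simprule[OF M nz xi(1)] e assms M_closed(7) by simp
    then show False using assms(1) by blast
  qed
  then show "a = c" using assms(6) car xi(1) by (metis add.r_cancel m_closed)
qed

text \<open>The image \<zeta> of \<xi> may be any root of X^2 - t X + 1. With \<zeta> = inv \<xi>
  and the identity on M this gives \<sigma>; with \<zeta> = \<xi> and an automorphism of L it gives
  \<tau>.\<close>

lemma extend_hom:
  assumes "\<xi> \<notin> M" "subfield_hom R M g" "g t = t" "\<zeta> \<in> carrier R" "\<zeta> \<otimes> \<zeta> = t \<otimes> \<zeta> \<ominus> \<one>"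
  obtains h where "subfield_hom R N h" "\<And>a b. a \<in> M \<Longrightarrow> b \<in> M \<Longrightarrow> h (a \<oplus> b \<otimes> \<xi>) = g a \<oplus> g b \<otimes> \<zeta>"
proof -
  interpret g: subfield_hom R M g by fact
  define h where "h = (\<lambda>x. THE y. \<exists>a\<in>M. \<exists>b\<in>M. x = a \<oplus> b \<otimes> \<xi> \<and> y = g a \<oplus> g b \<otimes> \<zeta>)"
  have h: "h (a \<oplus> b \<otimes> \<xi>) = g a \<oplus> g b \<otimes> \<zeta>" if "a \<in> M" "b \<in> M" for a b
    unfolding h_def
  proof (rule the_equality)
    fix y assume "\<exists>a'\<in>M. \<exists>b'\<in>M. a \<oplus> b \<otimes> \<xi> = a' \<oplus> b' \<otimes> \<xi> \<and> y = g a' \<oplus> g b' \<otimes> \<zeta>"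
    then show "y = g a \<oplus> g b \<otimes> \<zeta>" using repr_unique[OF assms(1) that] by metis
  qed (use that in blast)
  have "subfield_hom R N h"
  proof (rule subfield_homI[OF N_subfield])
    fix x assume "x \<in> N"
    then obtain a b where "a \<in> M" "b \<in> M" "x = a \<oplus> b \<otimes> \<xi>" by (rule N_repr)
    then show "h x \<in> carrier R" using h g.h_closed assms(4) by simp
  next
    fix x y assume "x \<in> N" "y \<in> N"
    then obtain a b c d where abcd: "a \<in> M" "b \<in> M" "x = a \<oplus> b \<otimes> \<xi>" "c \<in> M" "d \<in> M" "y = c \<oplus> d \<otimes> \<xi>"
      using N_repr by metis
    have car: "a \<in> carrier R" "b \<in> carrier R" "c \<in> carrier R" "d \<in> carrier R" using abcd M_closed(1) by auto
    have gcar: "g a \<in> carrier R" "g b \<in> carrier R" "g c \<in> carrier R" "g d \<in> carrier R" using abcd g.h_closed by auto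
    have "x \<oplus> y = (a \<oplus> c) \<oplus> (b \<oplus> d) \<otimes> \<xi>" unfolding abcd using car xi(1) by algebra
    then have "h (x \<oplus> y) = (g a \<oplus> g c) \<oplus> (g b \<oplus> g d) \<otimes> \<zeta>"
      using h abcd M_closed(5) g.h_add by simp
    also have "\<dots> = h x \<oplus> h y"
      unfolding abcd h[OF abcd(1,2)] h[OF abcd(4,5)] using gcar assms(4) by algebra
    finally show "h (x \<oplus> y) = h x \<oplus> h y" .
    \<comment> \<open>One product formula for any root z of the quadratic, so it serves for \<xi>
      before and for \<zeta> after applying h.\<close>
    have mult: "(p \<oplus> q \<otimes> z) \<otimes> (r \<oplus> s \<otimes> z) = (p \<otimes> r \<ominus> q \<otimes> s) \<oplus> (p \<otimes> s \<oplus> q \<otimes> r \<oplus> q \<otimes> s \<otimes> t) \<otimes> z"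
      if c: "p \<in> carrier R" "q \<in> carrier R" "r \<in> carrier R" "s \<in> carrier R" "z \<in> carrier R"
        and z: "z \<otimes> z = t \<otimes> z \<ominus> \<one>" for p q r s z
    proof -
      have "(p \<oplus> q \<otimes> z) \<otimes> (r \<oplus> s \<otimes> z) = p \<otimes> r \<oplus> (p \<otimes> s \<oplus> q \<otimes> r) \<otimes> z \<oplus> q \<otimes> s \<otimes> (z \<otimes> z)"
        using c by algebra
      also have "\<dots> = (p \<otimes> r \<ominus> q \<otimes> s) \<oplus> (p \<otimes> s \<oplus> q \<otimes> r \<oplus> q \<otimes> s \<otimes> t) \<otimes> z"
      proof -
        \<comment> \<open>t is generalised to a variable so that it is treated as an atom rather
          than as \<xi> plus its inverse.\<close>
        have "p \<otimes> r \<oplus> (p \<otimes> s \<oplus> q \<otimes> r) \<otimes> z \<oplus> q \<otimes> s \<otimes> (\<tau> \<otimes> z \<ominus> \<one>)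
           = (p \<otimes> r \<ominus> q \<otimes> s) \<oplus> (p \<otimes> s \<oplus> q \<otimes> r \<oplus> q \<otimes> s \<otimes> \<tau>) \<otimes> z" if "\<tau> \<in> carrier R" for \<tau>
          using c that by algebra
        then show ?thesis unfolding z using t_closed by blast
      qed
      finally show ?thesis .
    qed
    have "x \<otimes> y = (a \<otimes> c \<ominus> b \<otimes> d) \<oplus> (a \<otimes> d \<oplus> b \<otimes> c \<oplus> b \<otimes> d \<otimes> t) \<otimes> \<xi>"
      unfolding abcd by (rule mult[OF car xi(1) xi_square(1)])
    then have "h (x \<otimes> y) = g (a \<otimes> c \<ominus> b \<otimes> d) \<oplus> g (a \<otimes> d \<oplus> b \<otimes> c \<oplus> b \<otimes> d \<otimes> t) \<otimes> \<zeta>"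
      using h abcd M_closed(5,6,7) trace by simp
    also have "\<dots> = (g a \<otimes> g c \<ominus> g b \<otimes> g d) \<oplus> (g a \<otimes> g d \<oplus> g b \<otimes> g c \<oplus> g b \<otimes> g d \<otimes> t) \<otimes> \<zeta>"
      using abcd M_closed(5,6,7) trace assms(3) by (simp add: g.h_add g.h_mult g.h_diff)
    also have "\<dots> = h x \<otimes> h y"
      unfolding abcd h[OF abcd(1,2)] h[OF abcd(4,5)] by (rule mult[OF gcar assms(4,5), symmetric])
    finally show "h (x \<otimes> y) = h x \<otimes> h y" .
  next
    have "h (\<one> \<oplus> \<zero> \<otimes> \<xi>) = \<one>" using h[OF M_closed(3,2)] g.h_one g.h_zero assms(4) by simp
    then show "h \<one> = \<one>" using xi by simp
  qed
  then show ?thesis using h that by blast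
qed

end

section \<open>Galois groups\<close>

lemma galois_carrier:
  "f \<in> carrier (galois_group R M E) \<longleftrightarrow>
    f \<in> Bij E \<and> f \<in> ring_hom (R\<lparr>carrier := E\<rparr>) (R\<lparr>carrier := E\<rparr>) \<and> (\<forall>x\<in>M. f x = x)"
  by (auto simp: galois_group_def)

context field
begin

lemma galois_memD:
  assumes "subfield E R" "f \<in> carrier (galois_group R M E)"
  shows "subfield_hom R E f" "f ` E = E" "f \<in> extensional E" "\<And>x. x \<in> M \<Longrightarrow> f x = x"
proof -
  have f: "f \<in> Bij E" "f \<in> ring_hom (R\<lparr>carrier := E\<rparr>) (R\<lparr>carrier := E\<rparr>)" "\<forall>x\<in>M. f x = x"
    using assms(2) unfolding galois_carrier by auto
  show "f ` E = E" "f \<in> extensional E" using f(1) by (auto simp: Bij_def bij_betw_def)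
  show "\<And>x. x \<in> M \<Longrightarrow> f x = x" using f(3) by blast
  show "subfield_hom R E f"
    by (rule subfield_homI[OF assms(1)])
       (use ring_hom_memE[OF f(2)] subfield_closed(1)[OF assms(1)] in auto)
qed

lemma galois_memI:
  assumes "subfield_hom R E h" "h ` E = E" "M \<subseteq> E" "\<And>x. x \<in> M \<Longrightarrow> h x = x"
  shows "restrict h E \<in> carrier (galois_group R M E)"
proof -
  interpret h: subfield_hom R E h by fact
  have "restrict h E \<in> Bij E" using assms(2) h.h_inj by (simp add: Bij_def bij_betw_def)
  moreover have "restrict h E \<in> ring_hom (R\<lparr>carrier := E\<rparr>) (R\<lparr>carrier := E\<rparr>)"
    by (rule ring_hom_memI) (use assms(2) h.h_mult h.h_add h.h_one h.E_closed(3,5,6) in auto)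
  ultimately show ?thesis unfolding galois_carrier using assms(3,4) by auto
qed

lemma galois_mult:
  assumes "f \<in> carrier (galois_group R M E)" "g \<in> carrier (galois_group R M E)"
  shows "f \<otimes>\<^bsub>galois_group R M E\<^esub> g = compose E f g"
  using assms unfolding galois_carrier by (simp add: galois_group_def BijGroup_def)

lemma galois_one: "\<one>\<^bsub>galois_group R M E\<^esub> = (\<lambda>x\<in>E. x)"
  by (simp add: galois_group_def BijGroup_def)

lemma galois_group_is_group:
  assumes "subfield E R" "M \<subseteq> E"
  shows "group (galois_group R M E)"
proof (rule groupI)
  let ?G = "galois_group R M E"
  have comp: "compose E f g \<in> carrier ?G" if "f \<in> carrier ?G" "g \<in> carrier ?G" for f g
  proof -
    interpret f: subfield_hom R E f by (rule galois_memD(1)[OF assms(1) that(1)])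
    interpret g: subfield_hom R E g by (rule galois_memD(1)[OF assms(1) that(2)])
    note f = galois_memD[OF assms(1) that(1)] and g = galois_memD[OF assms(1) that(2)]
    have gE: "\<And>x. x \<in> E \<Longrightarrow> g x \<in> E" using g(2) by blast
    have "subfield_hom R E (f \<circ> g)"
      by (rule subfield_homI[OF assms(1)])
         (use gE f.h_closed f.h_add f.h_mult f.h_one g.h_add g.h_mult g.h_one in auto)
    moreover have "(f \<circ> g) ` E = E" by (simp only: image_comp[symmetric] f(2) g(2))
    moreover have "\<And>x. x \<in> M \<Longrightarrow> (f \<circ> g) x = x" using f(4) g(4) by simp
    ultimately have "restrict (f \<circ> g) E \<in> carrier ?G" using galois_memI assms(2) by blast
    moreover have "restrict (f \<circ> g) E = compose E f g" by (auto simp: compose_def restrict_def)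
    ultimately show ?thesis by simp
  qed
  fix f g h assume f: "f \<in> carrier ?G" and g: "g \<in> carrier ?G" and h: "h \<in> carrier ?G"
  show "f \<otimes>\<^bsub>?G\<^esub> g \<in> carrier ?G" using comp[OF f g] galois_mult[OF f g] by simp
  show "f \<otimes>\<^bsub>?G\<^esub> g \<otimes>\<^bsub>?G\<^esub> h = f \<otimes>\<^bsub>?G\<^esub> (g \<otimes>\<^bsub>?G\<^esub> h)"
    unfolding galois_mult[OF f g] galois_mult[OF comp[OF f g] h] galois_mult[OF g h] galois_mult[OF f comp[OF g h]]
    using galois_memD(2)[OF assms(1) h] by (auto simp: compose_def fun_eq_iff)
next
  let ?G = "galois_group R M E"
  have id: "subfield_hom R E (\<lambda>x. x)"
    by (rule subfield_homI[OF assms(1)]) (use subfield_closed(1)[OF assms(1)] in auto)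
  show one: "\<one>\<^bsub>?G\<^esub> \<in> carrier ?G" unfolding galois_one using galois_memI[OF id] assms(2) by auto
  fix f assume f: "f \<in> carrier ?G"
  interpret f: subfield_hom R E f by (rule galois_memD(1)[OF assms(1) f])
  note fp = galois_memD[OF assms(1) f]
  show "\<one>\<^bsub>?G\<^esub> \<otimes>\<^bsub>?G\<^esub> f = f" unfolding galois_mult[OF one f] unfolding galois_one
    using fp(2,3) by (auto simp: compose_def fun_eq_iff extensional_def)
  let ?i = "inv_into E f"
  have i: "\<And>x. x \<in> E \<Longrightarrow> f (?i x) = x" "\<And>x. x \<in> E \<Longrightarrow> ?i x \<in> E" "\<And>x. x \<in> E \<Longrightarrow> ?i (f x) = x"
    using fp(2) f.h_inj by (auto simp: f_inv_into_f inv_into_into inv_into_f_f)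
  have eqI: "?i x = y" if "y \<in> E" "f y = x" for x y using i(3) that by blast
  have "subfield_hom R E ?i"
  proof (rule subfield_homI[OF assms(1)])
    fix x y assume xy: "x \<in> E" "y \<in> E"
    show "?i x \<in> carrier R" using i(2) xy f.E_closed(1) by blast
    show "?i (x \<oplus> y) = ?i x \<oplus> ?i y" "?i (x \<otimes> y) = ?i x \<otimes> ?i y"
      by (rule eqI, use i xy f.E_closed(5,6) f.h_add f.h_mult in auto)+
  next
    show "?i \<one> = \<one>" by (rule eqI) (use f.E_closed(3) f.h_one in auto)
  qed
  moreover have "?i ` E = E" 
  proof
    show "?i ` E \<subseteq> E" using i(2) by blast
    show "E \<subseteq> ?i ` E" using i(3) fp(2) by (metis image_eqI subsetI)
  qed
  moreover have "\<And>x. x \<in> M \<Longrightarrow> ?i x = x" using fp(4) eqI assms(2) by blast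
  ultimately have ri: "restrict ?i E \<in> carrier ?G" using galois_memI assms(2) by blast
  moreover have "restrict ?i E \<otimes>\<^bsub>?G\<^esub> f = \<one>\<^bsub>?G\<^esub>"
    unfolding galois_mult[OF ri f] galois_one using i(3) fp(2) by (auto simp: compose_def fun_eq_iff)
  ultimately show "\<exists>y\<in>carrier ?G. y \<otimes>\<^bsub>?G\<^esub> f = \<one>\<^bsub>?G\<^esub>" by blast
qed

lemma galois_nat_pow:
  assumes "subfield E R" "M \<subseteq> E" "f \<in> carrier (galois_group R M E)"
  shows "f [^]\<^bsub>galois_group R M E\<^esub> (n::nat) = restrict (f ^^ n) E"
proof -
  interpret G: group "galois_group R M E" by (rule galois_group_is_group[OF assms(1,2)])
  have fE: "\<And>x. x \<in> E \<Longrightarrow> f x \<in> E" using galois_memD(2)[OF assms(1,3)] by blast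
  show ?thesis
  proof (induction n)
    case 0
    then show ?case by (simp add: galois_one restrict_def)
  next
    case (Suc n)
    have "f [^]\<^bsub>galois_group R M E\<^esub> Suc n = compose E (restrict (f ^^ n) E) f"
      unfolding G.nat_pow_Suc galois_mult[OF G.nat_pow_closed[OF assms(3)] assms(3)] unfolding Suc ..
    also have "\<dots> = restrict (f ^^ Suc n) E"
      using fE by (auto simp: compose_def fun_eq_iff funpow_swap1)
    finally show ?case .
  qed
qed

text \<open>Every group element is a power of the generator, negative powers included, so whatever
  the generator fixes is fixed by the whole group.\<close>

lemma cyclic_extension_generator:
  assumes "subfield K R" "subfield L R" "K \<subseteq> L" "cyclic_extension R K L"
  obtains g where "subfield_hom R L g" "g ` L = L" "\<And>x. x \<in> L \<Longrightarrow> g x = x \<longleftrightarrow> x \<in> K"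
proof -
  let ?G = "galois_group R K L"
  interpret G: group ?G by (rule galois_group_is_group[OF assms(2,3)])
  obtain g where g: "g \<in> carrier ?G" "carrier ?G = range (\<lambda>n::int. g [^]\<^bsub>?G\<^esub> n)"
    using assms(4) unfolding cyclic_extension_def G.cyclic_group by blast
  have fix_all: "{x \<in> L. \<forall>f\<in>carrier ?G. f x = x} = K"
    using assms(4) unfolding cyclic_extension_def galois_extension_def by blast
  have "x \<in> K" if x: "x \<in> L" "g x = x" for x
  proof -
    have nat: "(g [^]\<^bsub>?G\<^esub> (n::nat)) x = x" for n
    proof -
      have "(g ^^ n) x = x" using x(2) by (induction n) auto
      then show ?thesis using galois_nat_pow[OF assms(2,3) g(1)] x(1) by simp
    qed
    have "(g [^]\<^bsub>?G\<^esub> (n::int)) x = x" for n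
    proof (cases "n < 0")
      case False
      then show ?thesis using nat[of "nat n"] unfolding int_pow_def2 by simp
    next
      case True
      let ?f = "g [^]\<^bsub>?G\<^esub> nat (- n)"
      have f: "?f \<in> carrier ?G" "inv\<^bsub>?G\<^esub> ?f \<in> carrier ?G" using g(1) by auto
      have "(inv\<^bsub>?G\<^esub> ?f \<otimes>\<^bsub>?G\<^esub> ?f) x = x" using f x(1) by (simp add: galois_one)
      then have "(inv\<^bsub>?G\<^esub> ?f) (?f x) = x"
        unfolding galois_mult[OF f(2,1)] compose_def using x(1) by simp
      then have "(inv\<^bsub>?G\<^esub> ?f) x = x" unfolding nat .
      then show ?thesis using True unfolding int_pow_def2 by simp
    qed
    then have "\<forall>f\<in>carrier ?G. f x = x" using g(2) by auto
    then show ?thesis using fix_all x(1) by blast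
  qed
  then show ?thesis using that[of g] galois_memD[OF assms(2) g(1)] by blast
qed

text \<open>The last premise speaks of plain iterates of g on L; restriction to L turns them into
  powers in the group of extensional maps.\<close>

lemma cyclic_extensionI:
  assumes "subfield K R" "subfield L R" "K \<subseteq> L" "finite_dimension K L"
    and "subfield_hom R L g" "g ` L = L" "\<And>x. x \<in> L \<Longrightarrow> g x = x \<longleftrightarrow> x \<in> K"
    and "\<And>f. f \<in> carrier (galois_group R K L) \<Longrightarrow> \<exists>n. \<forall>x\<in>L. f x = (g ^^ n) x"
  shows "cyclic_extension R K L"
proof -
  let ?G = "galois_group R K L"
  interpret G: group ?G by (rule galois_group_is_group[OF assms(2,3)])
  let ?g = "restrict g L"
  have g: "?g \<in> carrier ?G" by (rule galois_memI[OF assms(5,6,3)]) (use assms(3,7) in blast)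
  have gL: "\<And>x. x \<in> L \<Longrightarrow> g x \<in> L" using assms(6) by blast
  have pow: "(?g ^^ n) x = (g ^^ n) x" if "x \<in> L" for n x
  proof -
    have "(?g ^^ n) x = (g ^^ n) x \<and> (g ^^ n) x \<in> L" using that gL by (induction n) auto
    then show ?thesis by blast
  qed
  have "f \<in> range (\<lambda>n::int. ?g [^]\<^bsub>?G\<^esub> n)" if f: "f \<in> carrier ?G" for f
  proof -
    obtain n where n: "\<forall>x\<in>L. f x = (g ^^ n) x" using assms(8)[OF f] by blast
    have "f = restrict (?g ^^ n) L"
      using n pow galois_memD(3)[OF assms(2) f] by (auto simp: fun_eq_iff extensional_def)
    also have "\<dots> = ?g [^]\<^bsub>?G\<^esub> int n" unfolding galois_nat_pow[OF assms(2,3) g, symmetric] by (simp add: int_pow_int)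
    finally show ?thesis by blast
  qed
  then have "carrier ?G = range (\<lambda>n::int. ?g [^]\<^bsub>?G\<^esub> n)" using g by auto
  then have "cyclic_group ?G" unfolding G.cyclic_group using g by blast
  moreover have "{x \<in> L. \<forall>f\<in>carrier ?G. f x = x} = K"
  proof
    show "{x \<in> L. \<forall>f\<in>carrier ?G. f x = x} \<subseteq> K" using g assms(7) by auto
    show "K \<subseteq> {x \<in> L. \<forall>f\<in>carrier ?G. f x = x}" using assms(3) galois_memD(4)[OF assms(2)] by blast
  qed
  ultimately show ?thesis
    using assms(1-4) unfolding cyclic_extension_def galois_extension_def field_extension_def by blast
qed

end

context unit_quadratic
begin

text \<open>Resolves the definite description in \<open>xi_conj\<close>: a candidate h is
  constructed, and any competitor agrees with it on M and on \<xi>. That nothing outside M is fixed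
  is the separability of X^2 - t X + 1 when \<xi> is not in M.\<close>

lemma conj_facts:
  shows "subfield_hom R N (xi_conj R M \<xi>)"
    and "\<And>a b. a \<in> M \<Longrightarrow> b \<in> M \<Longrightarrow> xi_conj R M \<xi> (a \<oplus> b \<otimes> \<xi>) = a \<oplus> b \<otimes> inv \<xi>"
    and "\<And>x. x \<in> N \<Longrightarrow> xi_conj R M \<xi> x \<in> N"
    and "\<And>x. x \<in> N \<Longrightarrow> xi_conj R M \<xi> (xi_conj R M \<xi> x) = x"
    and "\<And>x. x \<in> N \<Longrightarrow> xi_conj R M \<xi> x = x \<longleftrightarrow> x \<in> M"
    and "xi_conj R M \<xi> \<xi> = inv \<xi>"
proof -
  have idM: "subfield_hom R M (\<lambda>x. x)" by (rule subfield_homI[OF M]) (use M_closed(1) in auto)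
  obtain h where hom: "subfield_hom R N h"
    and h: "\<And>a b. a \<in> M \<Longrightarrow> b \<in> M \<Longrightarrow> h (a \<oplus> b \<otimes> \<xi>) = a \<oplus> b \<otimes> inv \<xi>"
  proof (cases "\<xi> \<in> M")
    case True
    then have "N = M" "inv \<xi> = \<xi>" using adjoin_absorb[OF M] xi_in by auto
    then show ?thesis using that[of "\<lambda>x. x"] idM by simp
  next
    case False
    show ?thesis by (rule extend_hom[OF False idM _ inv_xi(1) xi_square(2)]) (use that in auto)
  qed
  interpret h: subfield_hom R N h by fact
  have hN: "h x \<in> N" if x: "x \<in> N" for x
  proof -
    obtain a b where "a \<in> M" "b \<in> M" "x = a \<oplus> b \<otimes> \<xi>" using N_repr[OF x] .
    moreover from this have "a \<in> N" "b \<in> N" using M_subset by auto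
    ultimately show ?thesis using h inv_xi_N N_closed(5,6) by simp
  qed
  have hM: "h a = a" if "a \<in> M" for a
    using h[OF that M_closed(2)] that M_closed(1) xi(1) inv_xi(1) by simp
  have hxi: "h \<xi> = inv \<xi>"
    using h[OF M_closed(2,3)] xi(1) inv_xi(1) by simp
  have hixi: "h (inv \<xi>) = \<xi>"
    using h.h_inv(1)[OF xi_N xi(2)] hxi xi field_Units by simp
  have hh: "h (h x) = x" if x: "x \<in> N" for x
  proof -
    obtain a b where ab: "a \<in> M" "b \<in> M" "x = a \<oplus> b \<otimes> \<xi>" using N_repr[OF x] .
    have ab': "a \<in> N" "b \<in> N" using ab M_subset by auto
    have "h (h x) = h (a \<oplus> b \<otimes> inv \<xi>)" using h ab by simp
    also have "\<dots> = a \<oplus> b \<otimes> \<xi>"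
      using ab' ab(1,2) inv_xi_N hM hixi N_closed(6) by (simp add: h.h_add h.h_mult)
    finally show ?thesis using ab by simp
  qed
  have hfix: "h x = x \<longleftrightarrow> x \<in> M" if x: "x \<in> N" for x
  proof
    assume "h x = x"
    show "x \<in> M"
    proof (cases "\<xi> \<in> M")
      case True
      then show ?thesis using x adjoin_absorb[OF M] by simp
    next
      case False
      obtain a b where ab: "a \<in> M" "b \<in> M" "x = a \<oplus> b \<otimes> \<xi>" using N_repr[OF x] .
      have car: "a \<in> carrier R" "b \<in> carrier R" using ab M_closed(1) by auto
      have "a \<oplus> b \<otimes> inv \<xi> = a \<oplus> b \<otimes> \<xi>" using \<open>h x = x\<close> h ab by simp
      moreover have "a \<oplus> b \<otimes> inv \<xi> = (a \<oplus> b \<otimes> t) \<oplus> (\<ominus> b) \<otimes> \<xi>" using car xi(1) inv_xi(1) by algebra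
      ultimately have "(a \<oplus> b \<otimes> t) \<oplus> (\<ominus> b) \<otimes> \<xi> = a \<oplus> b \<otimes> \<xi>" by simp
      \<comment> \<open>In coordinates, being fixed means b t = 0 and 2 b = 0.\<close>
      from repr_unique[OF False _ _ ab(1,2) this] have eq: "a \<oplus> b \<otimes> t = a" "\<ominus> b = b"
        using M_closed(4,5,6) ab trace by auto
      then have "b \<otimes> t = \<zero>" using car t_closed by simp
      then have "b = \<zero> \<or> t = \<zero>" using integral car t_closed by blast
      \<comment> \<open>t = 0 with b nonzero would mean characteristic 2, where X^2 + 1 has the
        double root 1, contrary to \<xi> outside M.\<close>
      moreover have "b = \<zero>" if "t = \<zero>"
      proof (rule ccontr)
        assume "b \<noteq> \<zero>"
        have "b \<otimes> (\<one> \<oplus> \<one>) = b \<oplus> b" using car by algebra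
        also have "\<dots> = \<zero>" using eq(2) car by (metis l_neg)
        finally have two: "\<one> \<oplus> \<one> = \<zero>" using integral[of b "\<one> \<oplus> \<one>"] car \<open>b \<noteq> \<zero>\<close> by auto
        have "(\<xi> \<ominus> \<one>) \<otimes> (\<xi> \<ominus> \<one>) = \<xi> \<otimes> \<xi> \<oplus> \<one> \<ominus> (\<one> \<oplus> \<one>) \<otimes> \<xi>" using xi(1) by algebra
        also have "\<dots> = \<zero>" unfolding xi_square(1) two that using xi(1) by algebra
        finally have "\<xi> \<ominus> \<one> = \<zero>" using integral xi(1) by blast
        then have "\<xi> = \<one>" using xi(1) by (simp add: r_right_minus_eq)
        then show False using False M_closed(3) by simp
      qed
      ultimately have "b = \<zero>" by blast
      then show ?thesis using ab car xi by simp
    qed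
  qed (rule hM)
  have img: "h ` N = N" using hN hh by (metis image_subsetI subsetI image_eqI subset_antisym)
  have mem: "restrict h N \<in> carrier (galois_group R M N)"
    by (rule galois_memI[OF hom img M_subset hM])
  have eq: "xi_conj R M \<xi> = restrict h N"
    unfolding xi_conj_def
  proof (rule the_equality)
    show "restrict h N \<in> carrier (galois_group R M N) \<and> restrict h N \<xi> = inv \<xi>"
      using mem hxi xi_N by simp
    fix f assume f: "f \<in> carrier (galois_group R M N) \<and> f \<xi> = inv \<xi>"
    then have fm: "f \<in> carrier (galois_group R M N)" by blast
    interpret f: subfield_hom R N f by (rule galois_memD(1)[OF N_subfield fm])
    note fd = galois_memD[OF N_subfield fm]
    have "f x = h x" if x: "x \<in> N" for x
    proof -
      obtain a b where ab: "a \<in> M" "b \<in> M" "x = a \<oplus> b \<otimes> \<xi>" using N_repr[OF x] .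
      have ab': "a \<in> N" "b \<in> N" using ab M_subset by auto
      show ?thesis unfolding ab(3) h[OF ab(1,2)]
        using ab' ab(1,2) xi_N fd(4) f N_closed(6) by (simp add: f.h_add f.h_mult)
    qed
    then show "f = restrict h N" using fd(3) by (auto simp: fun_eq_iff extensional_def)
  qed
  show "subfield_hom R N (xi_conj R M \<xi>)" unfolding eq
    by (rule subfield_homI[OF N_subfield])
       (use h.h_closed h.h_add h.h_mult h.h_one N_closed(3,5,6) in auto)
  show "\<And>a b. a \<in> M \<Longrightarrow> b \<in> M \<Longrightarrow> xi_conj R M \<xi> (a \<oplus> b \<otimes> \<xi>) = a \<oplus> b \<otimes> inv \<xi>"
    unfolding eq using h repr_N by simp
  show "\<And>x. x \<in> N \<Longrightarrow> xi_conj R M \<xi> x \<in> N" "\<And>x. x \<in> N \<Longrightarrow> xi_conj R M \<xi> (xi_conj R M \<xi> x) = x"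
    "\<And>x. x \<in> N \<Longrightarrow> xi_conj R M \<xi> x = x \<longleftrightarrow> x \<in> M" "xi_conj R M \<xi> \<xi> = inv \<xi>"
    unfolding eq using hN hh hfix hxi xi_N by auto
qed

end

section \<open>Roots of unity over a finite field of constants\<close>

text \<open>The recursion expresses the coefficient through binomials \<open>p choose k\<close> with
  0 < k < p.\<close>

lemma prime_dvd_dcoeff:
  assumes "Factorial_Ring.prime p" "0 < s" "2 * s \<le> p"
  shows "int p dvd dcoeff p s"
proof -
  have "{..s} = insert 0 {1..s}" by auto
  then have "dcoeff p s = - (\<Sum>k\<in>{1..s}. int (p choose k) * dcoeff (p - 2 * k) (s - k))"
    using dcoeff_rec[OF assms(3,2)] by simp
  moreover have "int p dvd (\<Sum>k\<in>{1..s}. int (p choose k) * dcoeff (p - 2 * k) (s - k))"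
  proof (rule dvd_sum)
    fix k assume "k \<in> {1..s}"
    then have "p dvd (p choose k)" using assms by (intro dvd_choose_prime) auto
    then show "int p dvd int (p choose k) * dcoeff (p - 2 * k) (s - k)"
      by (intro dvd_mult2) (simp only: int_dvd_int_iff)
  qed
  ultimately show ?thesis by simp
qed

context field
begin

text \<open>The power sum identity for exponent \<open>p\<close> has all its lower coefficients divisible by \<open>p\<close>.\<close>

lemma frobenius_add:
  fixes p :: nat
  assumes "Factorial_Ring.prime p" "\<And>z. z \<in> carrier R \<Longrightarrow> [p] \<cdot> z = \<zero>"
    and "a \<in> carrier R" "b \<in> carrier R"
  shows "(a \<oplus> b) [^] p = a [^] p \<oplus> b [^] p"
proof -
  let ?y = "a \<oplus> b" and ?u = "a \<otimes> b"
  have p0: "0 < p" using prime_gt_0_nat[OF assms(1)] .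
  have c: "?y \<in> carrier R" "?u \<in> carrier R" using assms by auto
  have "a [^] p \<oplus> b [^] p = dickson_sum ?y ?u p (p div 2)"
    using dickson_sum_eq_lucasV[OF c p0] lucasV_eq_power_sum[OF assms(3,4)] by simp
  also have "\<dots> = (\<Oplus>s\<in>{..p div 2}. if s = 0 then ?y [^] p else \<zero>)"
    unfolding dickson_sum_def
  proof (rule finsum_cong')
    fix s assume s: "s \<in> {..p div 2}"
    show "[dcoeff p s] \<cdot> (?u [^] s \<otimes> ?y [^] (p - 2 * s)) = (if s = 0 then ?y [^] p else \<zero>)"
    proof (cases "s = 0")
      case True
      then show ?thesis using c by simp
    next
      case False
      let ?z = "?u [^] s \<otimes> ?y [^] (p - 2 * s)"
      have z: "?z \<in> carrier R" using c by simp
      have "2 * s \<le> p" using s by auto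
      then obtain k where k: "dcoeff p s = int p * k"
        using prime_dvd_dcoeff[OF assms(1), of s] False by (auto simp: dvd_def)
      have "[(int p * k)] \<cdot> ?z = [k] \<cdot> ([(int p)] \<cdot> ?z)"
        using add.int_pow_pow[OF z, of k "int p"] by (simp add: mult.commute)
      also have "[(int p)] \<cdot> ?z = \<zero>" using assms(2)[OF z] by (simp add: add_pow_int_ge)
      finally show ?thesis using k False by simp
    qed
  qed (use c in auto)
  also have "\<dots> = ?y [^] p"
    using add.finprod_singleton[of 0 "{..p div 2}" "\<lambda>_. ?y [^] p"] c by simp
  finally show ?thesis by simp
qed

lemma frobenius_iter_add:
  fixes p :: nat
  assumes "Factorial_Ring.prime p" "\<And>z. z \<in> carrier R \<Longrightarrow> [p] \<cdot> z = \<zero>"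
    and "a \<in> carrier R" "b \<in> carrier R"
  shows "(a \<oplus> b) [^] (p ^ n) = a [^] (p ^ n) \<oplus> b [^] (p ^ n)"
proof (induction n)
  case 0
  then show ?case using assms by (simp del: One_nat_def)
next
  case (Suc n)
  have *: "x [^] (p ^ Suc n) = (x [^] (p ^ n)) [^] p" if "x \<in> carrier R" for x
    using that by (simp add: nat_pow_pow mult.commute)
  show ?case unfolding *[OF add.m_closed[OF assms(3,4)]] *[OF assms(3)] *[OF assms(4)] Suc
    using frobenius_add[OF assms(1,2)] assms(3,4) by simp
qed

text \<open>p^n kills \<one> by Lagrange in the additive group of F. Since p^n times \<one> is the
  n-th power of p times \<one>, already p kills \<one>.\<close>

lemma finite_subfield_char:
  assumes "subfield F R" "card F = p ^ n" "z \<in> carrier R"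
  shows "[(p::nat)] \<cdot> z = \<zero>"
proof -
  interpret FF: field "R\<lparr>carrier := F\<rparr>" by (rule subfield_iff(2)[OF assms(1)])
  have pow_eq: "add_pow (R\<lparr>carrier := F\<rparr>) k x = add_pow R k x" for k :: nat and x
    by (simp add: add_pow_def nat_pow_def)
  have "\<one> \<in> carrier (R\<lparr>carrier := F\<rparr>)" using subfield_closed(3)[OF assms(1)] by simp
  then have q1: "[(p ^ n)] \<cdot> \<one> = \<zero>"
    using FF.add.pow_order_eq_1[of "\<one>"] assms(2) by (simp add: order_def pow_eq)
  have "([p] \<cdot> \<one>) [^] k = [(p ^ k)] \<cdot> \<one>" for k :: nat
  proof (induction k)
    case (Suc k)
    have c: "[(p ^ k)] \<cdot> \<one> \<in> carrier R" by simp
    have "([p] \<cdot> \<one>) [^] Suc k = [(p ^ k)] \<cdot> \<one> \<otimes> [p] \<cdot> \<one>" using Suc by simp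
    also have "\<dots> = [p] \<cdot> ([(p ^ k)] \<cdot> \<one>)" using add_pow_rdistr[OF c one_closed, of p] c by simp
    also have "\<dots> = [(p ^ Suc k)] \<cdot> \<one>" using add.nat_pow_pow[OF one_closed, of p "p ^ k"] by (simp add: mult.commute)
    finally show ?case .
  qed simp
  then have "([p] \<cdot> \<one>) [^] n = \<zero>" using q1 by simp
  moreover have "x = \<zero>" if "x \<in> carrier R" "x [^] (k::nat) = \<zero>" for x k
    using that by (induction k) (use integral in auto)
  ultimately have "[p] \<cdot> \<one> = \<zero>" by (meson add.nat_pow_closed one_closed)
  then have "\<zero> = [p] \<cdot> \<one> \<otimes> z" using assms(3) by simp
  also have "\<dots> = [p] \<cdot> z" using add_pow_ldistr[OF one_closed assms(3), of p] assms(3) by simp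
  finally show ?thesis by simp
qed

lemma finite_subfield_pow_card:
  assumes "subfield F R" "finite F" "x \<in> F"
  shows "x [^] card F = x"
proof (cases "x = \<zero>")
  case True
  moreover have "card F \<noteq> 0" using assms by auto
  ultimately show ?thesis using nat_pow_zero by simp
next
  case False
  interpret FF: field "R\<lparr>carrier := F\<rparr>" by (rule subfield_iff(2)[OF assms(1)])
  interpret G: group "Multiplicative_Group.mult_of (R\<lparr>carrier := F\<rparr>)" by (rule FF.field_mult_group)
  have xc: "x \<in> carrier R" using assms subfield_closed(1) by blast
  have x: "x \<in> carrier (Multiplicative_Group.mult_of (R\<lparr>carrier := F\<rparr>))" using False assms(3) by simp
  have c: "card F = Suc (card (F - {\<zero>}))"
    using assms(2) subfield_closed(2)[OF assms(1)] by (metis card_Suc_Diff1)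
  have "x [^] (card (F - {\<zero>})) = \<one>"
    using G.pow_order_eq_1[OF x] by (simp add: order_def nat_pow_def)
  then show ?thesis unfolding c using xc by simp
qed

text \<open>Otherwise X^q - X, with q the cardinality of F, would have q + 1 roots: x and all of
  F.\<close>

lemma pow_card_imp_mem:
  assumes "subfield F R" "finite F" "x \<in> carrier R" "x [^] card F = x"
  shows "x \<in> F"
proof (rule ccontr)
  assume nx: "x \<notin> F"
  note K = subfieldE(1)[OF assms(1)] and cl = subfield_closed[OF assms(1)]
  interpret UP: domain "F[X]" using univ_poly_is_domain[OF K] .
  let ?q = "card F" and ?r = "\<ominus>\<^bsub>F[X]\<^esub> X"
  have Xc: "X \<in> carrier (F[X])" using var_closed(1)[OF K] .
  have "card {\<zero>, \<one>} \<le> ?q" using assms(2) cl(2,3) by (intro card_mono) auto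
  then have "2 \<le> ?q" by simp
  then have "length ?r \<le> ?q" using univ_poly_a_inv_length[OF K Xc] by (simp add: var_def)
  note p = monic_polynomial[OF assms(1) UP.a_inv_closed[OF Xc] this]
  let ?p = "X [^]\<^bsub>F[X]\<^esub> ?q \<oplus>\<^bsub>F[X]\<^esub> ?r"
  have "?p = []"
  proof (rule polynomial_eq_Nil_if_many_roots[OF assms(1) p(1)])
    show "insert x F \<subseteq> carrier R" using assms(3) cl(1) by blast
    show "length ?p \<le> card (insert x F)" using p(2) nx assms(2) by simp
    fix z assume z: "z \<in> insert x F"
    then have zc: "z \<in> carrier R" using assms(3) cl(1) by blast
    interpret ev: ring_hom_ring "F[X]" R "\<lambda>p. eval p z" using eval_ring_hom[OF K zc] .
    have "eval ?r z = \<ominus> z" using Xc eval_var[OF zc] by simp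
    moreover have "z [^] ?q = z" using z assms(4) finite_subfield_pow_card[OF assms(1,2)] by blast
    ultimately show "eval ?p z = \<zero>" using p(5)[OF zc] zc by (simp add: r_neg)
  qed
  then show False using p(2) by simp
qed

lemma mult_of_eq: "Ring_Divisibility.mult_of R = Multiplicative_Group.mult_of R"
  by (simp add: Ring_Divisibility.mult_of_def Multiplicative_Group.mult_of_def)

lemma primitive_root_props:
  assumes "primitive_root_of_unity R l \<xi>"
  shows "\<xi> \<in> carrier R" "\<xi> \<noteq> \<zero>" "0 < l" "\<And>n::nat. \<xi> [^] n = \<one> \<longleftrightarrow> l dvd n"
proof -
  interpret G: group "Multiplicative_Group.mult_of R" by (rule field_mult_group)
  have x: "\<xi> \<in> carrier (Multiplicative_Group.mult_of R)" "G.ord \<xi> = l" "0 < l"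
    using assms unfolding primitive_root_of_unity_def mult_of_eq by auto
  then show "\<xi> \<in> carrier R" "\<xi> \<noteq> \<zero>" "0 < l" by auto
  show "\<xi> [^] n = \<one> \<longleftrightarrow> l dvd n" for n :: nat
    using G.pow_eq_id[OF x(1), of n] x(2) by (simp add: Multiplicative_Group.nat_pow_mult_of)
qed

text \<open>As q is -1 modulo l, \<xi>^q is the inverse of \<xi>; Frobenius exchanges the two, and
  their sum lies in F. If \<xi> is in M, it is a constant, being algebraic over F, so that also
  \<xi>^q = \<xi>.\<close>

lemma root_of_unity_unit_quadratic:
  assumes "Factorial_Ring.prime p" "q = p ^ n" "subfield F R" "card F = q"
    and "[int q = - 1] (mod int l)" "primitive_root_of_unity R l \<xi>" "full_constant_field R F M"
  shows "unit_quadratic R M \<xi>"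
proof -
  note x = primitive_root_props[OF assms(6)]
  have ix: "inv \<xi> \<in> carrier R" "inv \<xi> \<otimes> \<xi> = \<one>" "\<xi> \<otimes> inv \<xi> = \<one>" "inv \<xi> \<noteq> \<zero>" using x(1,2) field_Units by auto
  have "0 < q" using assms(1,2) prime_gt_0_nat by simp
  then have fin: "finite F" using assms(4) card_ge_0_finite[of F] by simp
  have "int l dvd int q + 1" using assms(5) by (simp add: cong_iff_dvd_diff)
  then have "l dvd Suc q" by (metis int_dvd_int_iff of_nat_Suc add.commute)
  then have s: "\<xi> [^] q \<otimes> \<xi> = \<one>" using x(4)[of "Suc q"] by simp
  have xq: "\<xi> [^] q = inv \<xi>"
    using s x(1) ix by (metis inv_unique nat_pow_closed)
  have ixq: "inv \<xi> [^] q = \<xi>"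
  proof -
    have "inv \<xi> [^] q \<otimes> inv \<xi> = inv \<xi> [^] q \<otimes> \<xi> [^] q" using xq by simp
    also have "\<dots> = (inv \<xi> \<otimes> \<xi>) [^] q" using ix(1) x(1) by (simp add: nat_pow_distrib)
    also have "\<dots> = \<one>" using ix(2) by simp
    finally have *: "inv \<xi> [^] q \<otimes> inv \<xi> = \<one>" .
    have "inv \<xi> [^] q = inv \<xi> [^] q \<otimes> (inv \<xi> \<otimes> \<xi>)" using ix by simp
    also have "\<dots> = (inv \<xi> [^] q \<otimes> inv \<xi>) \<otimes> \<xi>" using ix(1) x(1) by (simp add: m_assoc)
    finally show ?thesis using * x(1) by simp
  qed
  have "(\<xi> \<oplus> inv \<xi>) [^] q = \<xi> [^] q \<oplus> inv \<xi> [^] q"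
    unfolding assms(2)
    by (rule frobenius_iter_add[OF assms(1)]) (use finite_subfield_char[OF assms(3)] assms(2,4) x ix in auto)
  also have "\<dots> = \<xi> \<oplus> inv \<xi>" unfolding xq ixq by (rule a_comm[OF ix(1) x(1)])
  finally have tF: "\<xi> \<oplus> inv \<xi> \<in> F"
    using pow_card_imp_mem[OF assms(3) fin] x(1) ix(1) assms(4) by simp
  have inF: "\<xi> = inv \<xi>" if "\<xi> \<in> F"
    using finite_subfield_pow_card[OF assms(3) fin that] xq assms(4) by simp
  \<comment> \<open>The instance over F itself provides that \<xi> is algebraic over F.\<close>
  have FQ: "unit_quadratic R F \<xi>"
    by (rule unit_quadratic.intro[OF field_axioms unit_quadratic_axioms.intro[OF assms(3) x(1,2) tF inF]])
  have M: "subfield M R" "F \<subseteq> M" "{x \<in> M. (algebraic over F) x} = F"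
    using assms(7) unfolding full_constant_field_def field_extension_def by auto
  have inM: "\<xi> = inv \<xi>" if "\<xi> \<in> M"
    using unit_quadratic.xi_algebraic[OF FQ] M(3) that inF by blast
  have tM: "\<xi> \<oplus> inv \<xi> \<in> M" using tF M(2) by blast
  show ?thesis
    by (rule unit_quadratic.intro[OF field_axioms unit_quadratic_axioms.intro[OF M(1) x(1,2) tM inM]])
qed

end

section \<open>Kummer generators and their traces\<close>

text \<open>g replaces y by z in polynomial expressions. Two expressions for the same element differ
  by a multiple of \<open>Irr K y\<close>, which vanishes at z.\<close>

lemma (in field) hom_of_root:
  assumes "subfield K R" "y \<in> carrier R" "(algebraic over K) y" "z \<in> carrier R" "eval (Irr K y) z = \<zero>"
  obtains g where "subfield_hom R (adjoin R K y) g" "\<And>p. p \<in> carrier (K[X]) \<Longrightarrow> g (eval p y) = eval p z"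
proof -
  note K = subfieldE(1)[OF assms(1)]
  interpret UP: domain "K[X]" using univ_poly_is_domain[OF K] .
  interpret ey: ring_hom_ring "K[X]" R "\<lambda>p. eval p y" using eval_ring_hom[OF K assms(2)] .
  interpret ez: ring_hom_ring "K[X]" R "\<lambda>p. eval p z" using eval_ring_hom[OF K assms(4)] .
  note I = IrrE[OF assms(1-3)]
  have wd: "eval p z = eval q z" if pq: "p \<in> carrier (K[X])" "q \<in> carrier (K[X])" "eval p y = eval q y" for p q
  proof -
    let ?d = "p \<ominus>\<^bsub>K[X]\<^esub> q"
    have d: "?d \<in> carrier (K[X])" using pq by simp
    have "eval ?d y = \<zero>" using pq by (simp add: a_minus_def r_neg)
    then have "Irr K y pdivides ?d" by (rule Irr_minimal[OF assms(1-3) d])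
    then obtain c where c: "c \<in> carrier (K[X])" "?d = Irr K y \<otimes>\<^bsub>K[X]\<^esub> c"
      unfolding pdivides_iff_shell[OF assms(1) I(1) d] factor_def by blast
    have "eval ?d z = \<zero>" unfolding c(2) using c(1) I(1) assms(5) by simp
    then have "eval p z \<ominus> eval q z = \<zero>" using pq by (simp add: a_minus_def)
    then show ?thesis using pq by (simp add: r_right_minus_eq)
  qed
  define g where "g = (\<lambda>x. eval (SOME p. p \<in> carrier (K[X]) \<and> x = eval p y) z)"
  have g: "g (eval p y) = eval p z" if "p \<in> carrier (K[X])" for p
  proof -
    have "(SOME p'. p' \<in> carrier (K[X]) \<and> eval p y = eval p' y) \<in> carrier (K[X]) \<and>
        eval p y = eval (SOME p'. p' \<in> carrier (K[X]) \<and> eval p y = eval p' y) y"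
      by (rule someI[of _ p]) (use that in simp)
    then show ?thesis unfolding g_def using wd[OF _ that] by simp
  qed
  have E: "subfield (adjoin R K y) R" by (rule adjoin_props(1)[OF assms(1,2)])
  have rep: "\<exists>p\<in>carrier (K[X]). x = eval p y" if "x \<in> adjoin R K y" for x
    using adjoin_eq_eval_image[OF assms(1-3) that] by metis
  have "subfield_hom R (adjoin R K y) g"
  proof (rule subfield_homI[OF E])
    fix x assume "x \<in> adjoin R K y"
    then obtain p where "p \<in> carrier (K[X])" "x = eval p y" using rep by blast
    then show "g x \<in> carrier R" using g by simp
  next
    fix x x' assume "x \<in> adjoin R K y" "x' \<in> adjoin R K y"
    then obtain p q where pq: "p \<in> carrier (K[X])" "x = eval p y" "q \<in> carrier (K[X])" "x' = eval q y"
      using rep by metis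
    have "x \<oplus> x' = eval (p \<oplus>\<^bsub>K[X]\<^esub> q) y" "x \<otimes> x' = eval (p \<otimes>\<^bsub>K[X]\<^esub> q) y" using pq by simp_all
    moreover have "g (eval (p \<oplus>\<^bsub>K[X]\<^esub> q) y) = g x \<oplus> g x'" "g (eval (p \<otimes>\<^bsub>K[X]\<^esub> q) y) = g x \<otimes> g x'"
      using pq by (simp_all only: g UP.add.m_closed UP.m_closed ez.hom_add ez.hom_mult)
    ultimately show "g (x \<oplus> x') = g x \<oplus> g x'" "g (x \<otimes> x') = g x \<otimes> g x'" by simp_all
  next
    have "eval \<one>\<^bsub>K[X]\<^esub> y = \<one>" "eval \<one>\<^bsub>K[X]\<^esub> z = \<one>" by (rule ey.hom_one, rule ez.hom_one)
    then show "g \<one> = \<one>" using g[OF UP.one_closed] by simp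
  qed
  then show ?thesis using g that by blast
qed

text \<open>A basis of K(y) has l elements and stays independent in L, so it already spans
  L.\<close>

lemma (in field) adjoin_eq_if_degree_eq_dimension:
  assumes "subfield K R" "subfield L R" "K \<subseteq> L" "y \<in> L" "dimension l K L" "length (Irr K y) = Suc l"
  shows "L = adjoin R K y"
proof -
  have y: "y \<in> carrier R" using assms subfield_closed(1) by blast
  have alg: "(algebraic over K) y"
    using finite_dimension_imp_algebraic[OF assms(1) subfieldE(1)[OF assms(2)] finite_dimensionI[OF assms(5)] assms(4)] .
  have "dimension l K (adjoin R K y)"
    using dimension_simple_extension[OF assms(1) y alg] assms(6) adjoin_eq_simple_extension[OF assms(1) y alg] by simp
  then obtain Us where Us: "set Us \<subseteq> carrier R" "independent K Us" "length Us = l" "Span K Us = adjoin R K y"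
    using exists_base[OF assms(1)] by blast
  have "adjoin R K y \<subseteq> L" using adjoin_props(4)[OF assms(1) y assms(2,3,4)] .
  then have "set Us \<subseteq> L" using Span_base_incl[OF assms(1) Us(1)] Us(4) by blast
  then show ?thesis using independent_length_eq_dimension[OF assms(1,5) Us(2)] Us(3,4) by simp
qed

section \<open>The tower of K, L, K(\<xi>) and L(\<xi>)\<close>

locale kummer_tower = field R for R (structure) +
  fixes K L :: "'a set" and \<xi> :: 'a and l :: nat
  assumes K_quadratic: "unit_quadratic R K \<xi>" and L_quadratic: "unit_quadratic R L \<xi>"
    and KL: "K \<subseteq> L" and prim: "primitive_root_of_unity R l \<xi>"
begin

sublocale KQ: unit_quadratic R K \<xi> by (rule K_quadratic)
sublocale LQ: unit_quadratic R L \<xi> by (rule L_quadratic)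

abbreviation "Kxi \<equiv> adjoin R K \<xi>"
abbreviation "Lxi \<equiv> adjoin R L \<xi>"
abbreviation "\<sigma> \<equiv> xi_conj R L \<xi>"

sublocale S: subfield_hom R Lxi \<sigma> by (rule LQ.conj_facts(1))

lemmas xi = primitive_root_props[OF prim]
lemmas ixi = LQ.inv_xi

text \<open>In L, \<xi> is its own inverse, hence 1 or -1. So \<xi> is missing from L exactly when
  it is missing from K.\<close>

lemma xi_in_K: "\<xi> \<in> L \<Longrightarrow> \<xi> \<in> K"
proof -
  assume "\<xi> \<in> L"
  then have "\<xi> = inv \<xi>" by (rule LQ.xi_in)
  then have "\<xi> \<otimes> \<xi> = \<one>" using ixi by metis
  moreover have "(\<xi> \<ominus> \<one>) \<otimes> (\<xi> \<oplus> \<one>) = \<xi> \<otimes> \<xi> \<ominus> \<one>" using xi(1) by algebra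
  ultimately have "(\<xi> \<ominus> \<one>) \<otimes> (\<xi> \<oplus> \<one>) = \<zero>" using r_right_minus_eq[of \<one> \<one>] by simp
  then have "\<xi> \<ominus> \<one> = \<zero> \<or> \<xi> \<oplus> \<one> = \<zero>" using integral[of "\<xi> \<ominus> \<one>" "\<xi> \<oplus> \<one>"] xi(1) by blast
  then have "\<xi> = \<one> \<or> \<xi> = \<ominus> \<one>"
    using xi(1) r_right_minus_eq[of \<xi> \<one>] minus_equality[of \<xi> \<one>] by auto
  then show "\<xi> \<in> K" using KQ.M_closed(3,4) by auto
qed

lemma Kxi_Lxi: "Kxi \<subseteq> Lxi"
  by (rule adjoin_props(4)[OF KQ.M xi(1) LQ.N_subfield]) (use KL LQ.M_subset LQ.xi_N in auto)

lemma conj_agree: assumes "x \<in> Kxi" shows "xi_conj R K \<xi> x = \<sigma> x"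
proof -
  obtain a b where ab: "a \<in> K" "b \<in> K" "x = a \<oplus> b \<otimes> \<xi>" by (rule KQ.N_repr[OF assms])
  moreover from this have "a \<in> L" "b \<in> L" using KL by auto
  ultimately show ?thesis using KQ.conj_facts(2) LQ.conj_facts(2) by simp
qed

text \<open>The conjugation of L(\<xi>) restricts to that of K(\<xi>), and their fixed fields are L
  and K.\<close>

lemma Kxi_Int_L: "x \<in> Kxi \<Longrightarrow> x \<in> L \<Longrightarrow> x \<in> K"
  using conj_agree[of x] KQ.conj_facts(5)[of x] LQ.conj_facts(5)[of x] LQ.M_subset by auto

text \<open>The claim on elements fixed by \<tau> is conditional because the converse extends a map
  g whose fixed field is not yet known.\<close>

lemma extend_aut:
  assumes "subfield_hom R L g" "g ` L \<subseteq> L" "\<And>x. x \<in> K \<Longrightarrow> g x = x"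
  obtains \<tau> where "subfield_hom R Lxi \<tau>" "\<tau> ` Lxi \<subseteq> Lxi" "\<And>x. x \<in> L \<Longrightarrow> \<tau> x = g x"
    "\<And>x. x \<in> Kxi \<Longrightarrow> \<tau> x = x" "\<And>x. x \<in> Lxi \<Longrightarrow> \<tau> (\<sigma> x) = \<sigma> (\<tau> x)"
    "(\<And>x. x \<in> L \<Longrightarrow> g x = x \<Longrightarrow> x \<in> K) \<Longrightarrow> (\<And>x. x \<in> Lxi \<Longrightarrow> \<tau> x = x \<Longrightarrow> x \<in> Kxi)"
proof -
  interpret g: subfield_hom R L g by fact
  have gL: "\<And>x. x \<in> L \<Longrightarrow> g x \<in> L" using assms(2) by blast
  obtain \<tau> where T: "subfield_hom R Lxi \<tau>"
    and T1: "\<And>a b. a \<in> L \<Longrightarrow> b \<in> L \<Longrightarrow> \<tau> (a \<oplus> b \<otimes> \<xi>) = g a \<oplus> g b \<otimes> \<xi>"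
  proof (cases "\<xi> \<in> L")
    case True
    then have "Lxi = L" "g \<xi> = \<xi>" using adjoin_absorb[OF LQ.M] xi_in_K assms(3) by auto
    then show ?thesis using that[of g] assms(1) True by (simp add: g.h_add g.h_mult g.E_closed)
  next
    case False
    show ?thesis
      by (rule LQ.extend_hom[OF False assms(1) _ xi(1) LQ.xi_square(1)]) (use assms(3) KQ.trace that in auto)
  qed
  interpret T: subfield_hom R Lxi \<tau> by (rule T)
  have TL: "\<tau> x = g x" if "x \<in> L" for x
    using T1[OF that LQ.M_closed(2)] that xi(1) g.h_zero g.h_closed LQ.M_closed(1) by simp
  have Txi: "\<tau> \<xi> = \<xi>"
    using T1[OF LQ.M_closed(2,3)] xi(1) g.h_zero g.h_one by simp
  have Tixi: "\<tau> (inv \<xi>) = inv \<xi>" using T.h_inv(1)[OF LQ.xi_N xi(2)] Txi by simp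
  have img: "\<tau> ` Lxi \<subseteq> Lxi"
  proof
    fix z assume "z \<in> \<tau> ` Lxi"
    then obtain x where x: "x \<in> Lxi" "z = \<tau> x" by blast
    obtain a b where ab: "a \<in> L" "b \<in> L" "x = a \<oplus> b \<otimes> \<xi>" by (rule LQ.N_repr[OF x(1)])
    then show "z \<in> Lxi" using x T1 gL LQ.repr_N by simp
  qed
  have fixK: "\<tau> x = x" if x: "x \<in> Kxi" for x
  proof -
    obtain a b where ab: "a \<in> K" "b \<in> K" "x = a \<oplus> b \<otimes> \<xi>" by (rule KQ.N_repr[OF x])
    moreover from this have "a \<in> L" "b \<in> L" using KL by auto
    ultimately show ?thesis using T1 assms(3) by simp
  qed
  have comm: "\<tau> (\<sigma> x) = \<sigma> (\<tau> x)" if x: "x \<in> Lxi" for x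
  proof -
    obtain a b where ab: "a \<in> L" "b \<in> L" "x = a \<oplus> b \<otimes> \<xi>" by (rule LQ.N_repr[OF x])
    have ab': "a \<in> Lxi" "b \<in> Lxi" using ab LQ.M_subset by auto
    have "\<tau> (\<sigma> x) = \<tau> (a \<oplus> b \<otimes> inv \<xi>)" using ab LQ.conj_facts(2) by simp
    also have "\<dots> = g a \<oplus> g b \<otimes> inv \<xi>"
      using ab ab' LQ.inv_xi_N TL Tixi LQ.N_closed(6) by (simp add: T.h_add T.h_mult)
    also have "\<dots> = \<sigma> (\<tau> x)" using ab T1 LQ.conj_facts(2) gL by simp
    finally show ?thesis .
  qed
  have fixT: "x \<in> Kxi" if fx: "\<And>x. x \<in> L \<Longrightarrow> g x = x \<Longrightarrow> x \<in> K" and x: "x \<in> Lxi" "\<tau> x = x" for x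
  proof (cases "\<xi> \<in> L")
    case True
    then have "Lxi = L" using adjoin_absorb[OF LQ.M] by simp
    then show ?thesis using fx x TL KQ.M_subset by auto
  next
    case False
    obtain a b where ab: "a \<in> L" "b \<in> L" "x = a \<oplus> b \<otimes> \<xi>" by (rule LQ.N_repr[OF x(1)])
    have "g a \<oplus> g b \<otimes> \<xi> = a \<oplus> b \<otimes> \<xi>" using x(2) T1 ab by simp
    then have "g a = a" "g b = b" using LQ.repr_unique[OF False gL gL] ab by blast+
    then show ?thesis using fx ab KQ.repr_N by blast
  qed
  show ?thesis by (rule that[OF T img TL fixK comm fixT])
qed

lemma pow_inj:
  assumes "i < l" "j < l" "\<xi> [^] i = \<xi> [^] j" shows "i = j"
proof -
  have main: "i = j" if "i \<le> j" "j < l" "\<xi> [^] i = \<xi> [^] j" for i j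
  proof -
    have "\<xi> [^] i \<otimes> \<xi> [^] (j - i) = \<xi> [^] i \<otimes> \<one>"
      using that nat_pow_mult[OF xi(1), of i "j - i"] xi(1) by simp
    moreover have "\<xi> [^] i \<noteq> \<zero>"
    proof (induction i)
      case (Suc i)
      then show ?case using integral[of "\<xi> [^] i" \<xi>] xi(1,2) by auto
    qed simp
    ultimately have "\<xi> [^] (j - i) = \<one>"
      using m_lcancel[of "\<xi> [^] i" "\<xi> [^] (j - i)" \<one>] xi(1) by simp
    then have "l dvd (j - i)" using xi(4) by simp
    then have "j - i = 0" using that dvd_imp_le[of l "j - i"] by linarith
    then show ?thesis using that by simp
  qed
  show ?thesis using main[of i j] main[of j i] assms by (metis linear)
qed

lemma xi_pow_conj: "\<xi> [^] (i::nat) \<otimes> inv \<xi> [^] i = \<one>"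
  using xi(1) ixi by (simp add: nat_pow_distrib[symmetric])

end

text \<open>Read A = \<xi>^i and B = \<xi>^j, with inverses A' and B'. Multiplied by A B, the
  equality of two twisted traces factors as (A - B)(A B w - v) = 0.\<close>

lemma (in field) twisted_sum_eq:
  assumes "A \<in> carrier R" "B \<in> carrier R" "A' \<in> carrier R" "B' \<in> carrier R" "w \<in> carrier R" "v \<in> carrier R"
    and "A \<otimes> A' = \<one>" "B \<otimes> B' = \<one>" "A \<noteq> B" "A' \<otimes> v \<oplus> A \<otimes> w = B' \<otimes> v \<oplus> B \<otimes> w"
  shows "A \<otimes> B \<otimes> w = v"
proof -
  note c = assms(1-6)
  have "B \<otimes> (A \<otimes> A') \<otimes> v \<oplus> A \<otimes> (A \<otimes> B \<otimes> w) = A \<otimes> B \<otimes> (A' \<otimes> v \<oplus> A \<otimes> w)" using c by algebra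
  also have "\<dots> = A \<otimes> (B \<otimes> B') \<otimes> v \<oplus> B \<otimes> (A \<otimes> B \<otimes> w)" unfolding assms(10) using c by algebra
  finally have e: "B \<otimes> v \<oplus> A \<otimes> (A \<otimes> B \<otimes> w) = A \<otimes> v \<oplus> B \<otimes> (A \<otimes> B \<otimes> w)" using assms(7,8) c by simp
  have lin: "(A \<ominus> B) \<otimes> (z \<ominus> v) = (B \<otimes> v \<oplus> A \<otimes> z) \<ominus> (A \<otimes> v \<oplus> B \<otimes> z)" if "z \<in> carrier R" for z
    using c that by algebra
  have z: "A \<otimes> B \<otimes> w \<in> carrier R" using c by simp
  have "(A \<ominus> B) \<otimes> (A \<otimes> B \<otimes> w \<ominus> v) = \<zero>"
    unfolding lin[OF z] e using c by (simp add: r_right_minus_eq)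
  moreover have "A \<ominus> B \<noteq> \<zero>" using assms(9) c by (simp add: r_right_minus_eq)
  ultimately have "A \<otimes> B \<otimes> w \<ominus> v = \<zero>" using integral[of "A \<ominus> B" "A \<otimes> B \<otimes> w \<ominus> v"] c by auto
  then show ?thesis using c by (simp add: r_right_minus_eq)
qed

section \<open>Eigenvectors of \<tau> and the trace generator of a cyclic extension\<close>

context kummer_tower
begin

text \<open>w and v are eigenvectors of \<tau> whose eigenvalues, \<xi> and its inverse, are
  themselves fixed by \<tau>.\<close>

lemma twist_iterates:
  assumes "subfield_hom R Lxi \<tau>" "\<tau> ` Lxi \<subseteq> Lxi" "\<forall>x\<in>Kxi. \<tau> x = x"
    and "w \<in> Lxi" "v \<in> Lxi" "\<tau> w = \<xi> \<otimes> w" "\<tau> v = inv \<xi> \<otimes> v"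
  shows "(\<tau> ^^ i) w = \<xi> [^] i \<otimes> w" "(\<tau> ^^ i) v = inv \<xi> [^] i \<otimes> v"
    "(\<tau> ^^ i) (v \<oplus> w) = inv \<xi> [^] i \<otimes> v \<oplus> \<xi> [^] i \<otimes> w"
    "\<And>x. x \<in> Kxi \<Longrightarrow> (\<tau> ^^ i) x = x"
proof -
  interpret T: subfield_hom R Lxi \<tau> by fact
  have car: "w \<in> carrier R" "v \<in> carrier R" using assms T.E_closed(1) by auto
  have x: "\<xi> \<in> Lxi" "inv \<xi> \<in> Lxi" "\<tau> \<xi> = \<xi>" "\<tau> (inv \<xi>) = inv \<xi>"
    using LQ.xi_N LQ.inv_xi_N assms(3) KQ.xi_N KQ.inv_xi_N by auto
  show 1: "(\<tau> ^^ i) w = \<xi> [^] i \<otimes> w" for i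
  proof (induction i)
    case (Suc i)
    have "(\<tau> ^^ Suc i) w = \<tau> (\<xi> [^] i) \<otimes> \<tau> w"
      using Suc T.h_mult[OF T.E_closed(9)[OF x(1)] assms(4)] by simp
    also have "\<tau> (\<xi> [^] i) = \<xi> [^] i" using T.h_pow[OF x(1)] x(3) by simp
    finally show ?case using assms(6) car xi(1) by (simp add: m_assoc)
  qed (use car in simp)
  show 2: "(\<tau> ^^ i) v = inv \<xi> [^] i \<otimes> v" for i
  proof (induction i)
    case (Suc i)
    have "(\<tau> ^^ Suc i) v = \<tau> (inv \<xi> [^] i) \<otimes> \<tau> v"
      using Suc T.h_mult[OF T.E_closed(9)[OF x(2)] assms(5)] by simp
    also have "\<tau> (inv \<xi> [^] i) = inv \<xi> [^] i" using T.h_pow[OF x(2)] x(4) by simp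
    finally show ?case using assms(7) car ixi(1) by (simp add: m_assoc)
  qed (use car in simp)
  show "(\<tau> ^^ i) (v \<oplus> w) = inv \<xi> [^] i \<otimes> v \<oplus> \<xi> [^] i \<otimes> w"
    using subfield_hom.h_add[OF subfield_hom_funpow(1)[OF assms(1,2)] assms(5,4)] 1 2 by simp
  show "(\<tau> ^^ i) x = x" if "x \<in> Kxi" for x
    using bspec[OF assms(3) that] by (induction i) auto
qed

text \<open>Equal conjugates leave a single possibility. It is refuted by applying \<tau> once more
  in the one direction, and by comparing l-th powers in the other.\<close>

lemma twist_distinct:
  assumes "subfield_hom R Lxi \<tau>" "\<tau> ` Lxi \<subseteq> Lxi" "\<forall>x\<in>Kxi. \<tau> x = x"
    and "w \<in> Lxi" "v \<in> Lxi" "\<tau> w = \<xi> \<otimes> w" "\<tau> v = inv \<xi> \<otimes> v"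
    and "i < j" "j < l" "(\<tau> ^^ i) (v \<oplus> w) = (\<tau> ^^ j) (v \<oplus> w)"
  shows "\<xi> [^] (i + j) \<otimes> w = v"
proof -
  have car: "w \<in> carrier R" "v \<in> carrier R" using assms LQ.N_closed(1) by auto
  have "inv \<xi> [^] i \<otimes> v \<oplus> \<xi> [^] i \<otimes> w = inv \<xi> [^] j \<otimes> v \<oplus> \<xi> [^] j \<otimes> w"
    using assms(10) twist_iterates(3)[OF assms(1-7), of i] twist_iterates(3)[OF assms(1-7), of j] by simp
  moreover have "\<xi> [^] i \<noteq> \<xi> [^] j" using pow_inj[of i j] assms(8,9) by auto
  ultimately have "\<xi> [^] i \<otimes> \<xi> [^] j \<otimes> w = v"
    using xi(1) ixi(1) car xi_pow_conj
    by (intro twisted_sum_eq[of _ _ "inv \<xi> [^] i" "inv \<xi> [^] j"]) auto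
  then show ?thesis using xi(1) by (simp add: nat_pow_mult)
qed

lemma card_conjugates:
  assumes "\<And>i j. i < j \<Longrightarrow> j < l \<Longrightarrow> f i \<noteq> f j"
  shows "card (f ` {..<l}) = l"
proof -
  have "inj_on f {..<l}" 
    by (rule inj_onI) (metis assms lessThan_iff linorder_neqE_nat)
  then show ?thesis by (simp add: card_image)
qed

theorem cyclic_imp_kummer_trace:
  assumes "dimension l K L" "subfield_hom R L g" "g ` L = L" "\<And>x. x \<in> L \<Longrightarrow> g x = x \<longleftrightarrow> x \<in> K"
  shows "\<exists>w a y u \<alpha>.
            kummer_generator R K L \<xi> l w \<and> a \<in> Kxi \<and>
            Irr Kxi w = kummer_poly R Kxi l a \<and>
            y = \<sigma> w \<oplus> w \<and> L = adjoin R K y \<and>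
            u = \<sigma> w \<otimes> w \<and> u \<in> K \<and>
            \<alpha> = a \<oplus> xi_conj R K \<xi> a \<and>
            Irr K y = P_poly R K l u \<alpha>"
proof -
  interpret g: subfield_hom R L g by fact
  have gL: "g ` L \<subseteq> L" using assms(3) by simp
  note gn = subfield_hom_funpow[OF assms(2) gL]
  have ord: "\<And>x. x \<in> L \<Longrightarrow> (g ^^ l) x = x" "\<And>i. 0 < i \<Longrightarrow> i < l \<Longrightarrow> \<exists>z\<in>L. (g ^^ i) z \<noteq> z"
    using fixed_field_order[OF assms(2) gL KQ.M KL _ assms(1)] assms(4) by blast+
  obtain \<tau> where T: "subfield_hom R Lxi \<tau>" "\<tau> ` Lxi \<subseteq> Lxi" "\<And>x. x \<in> L \<Longrightarrow> \<tau> x = g x"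
    "\<And>x. x \<in> Kxi \<Longrightarrow> \<tau> x = x" "\<And>x. x \<in> Lxi \<Longrightarrow> \<tau> (\<sigma> x) = \<sigma> (\<tau> x)"
    "\<And>x. x \<in> Lxi \<Longrightarrow> \<tau> x = x \<Longrightarrow> x \<in> Kxi"
  proof -
    have gK: "\<And>x. x \<in> K \<Longrightarrow> g x = x" and fx: "\<And>x. x \<in> L \<Longrightarrow> g x = x \<Longrightarrow> x \<in> K"
      using assms(4) KL by auto
    show thesis
    proof (rule extend_aut[OF assms(2) gL gK])
      fix \<tau>
      assume 1: "subfield_hom R Lxi \<tau>" "\<tau> ` Lxi \<subseteq> Lxi" "\<And>x. x \<in> L \<Longrightarrow> \<tau> x = g x"
        "\<And>x. x \<in> Kxi \<Longrightarrow> \<tau> x = x" "\<And>x. x \<in> Lxi \<Longrightarrow> \<tau> (\<sigma> x) = \<sigma> (\<tau> x)"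
        and 2: "(\<And>x. x \<in> L \<Longrightarrow> g x = x \<Longrightarrow> x \<in> K) \<Longrightarrow> (\<And>x. x \<in> Lxi \<Longrightarrow> \<tau> x = x \<Longrightarrow> x \<in> Kxi)"
      show thesis by (rule that[OF 1 2[OF fx]])
    qed
  qed
  interpret T: subfield_hom R Lxi \<tau> by (rule T(1))
  have TL: "\<And>x. x \<in> Lxi \<Longrightarrow> \<tau> x \<in> Lxi" using T(2) by blast
  have xiN: "\<xi> \<in> Lxi" "inv \<xi> \<in> Lxi" "\<tau> \<xi> = \<xi>" "\<tau> (inv \<xi>) = inv \<xi>"
    using LQ.xi_N LQ.inv_xi_N T(4) KQ.xi_N KQ.inv_xi_N by auto
  have ixil: "inv \<xi> [^] l = \<one>" 
    using xi_pow_conj[of l] xi(4)[of l] ixi(1) by simp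

  \<comment> \<open>Summands of the Lagrange resolvent; weighting by powers of inv \<xi> produces
    the eigenvalue \<xi>.\<close>
  define f where "f = (\<lambda>x i. inv \<xi> [^] i \<otimes> (g ^^ i) x)"
  have fN: "f x i \<in> Lxi" if "x \<in> L" for x i
    unfolding f_def using gn(2)[OF that] LQ.M_subset T.E_closed(6,9) xiN(2) by blast
  have fC: "f x i \<in> carrier R" if "x \<in> L" for x i using fN[OF that] T.E_closed(1) by blast
  have "\<exists>x\<in>L. (\<Oplus>i\<in>{..<l}. f x i) \<noteq> \<zero>"
  proof (rule ccontr)
    assume "\<not> ?thesis"
    then have zero: "\<And>x. x \<in> L \<Longrightarrow> (\<Oplus>i\<in>{..<l}. inv \<xi> [^] i \<otimes> (g ^^ i) x) = \<zero>"
      unfolding f_def by blast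
    \<comment> \<open>The exact order l of g enters here: no earlier positive power is trivial, so
      the characters are distinct.\<close>
    have dist: "\<exists>z\<in>L. (g ^^ i) z \<noteq> (g ^^ j) z" if ij: "i < j" "j < l" for i j
    proof -
      have "0 < j - i" "j - i < l" using ij by auto
      then obtain z where z: "z \<in> L" "(g ^^ (j - i)) z \<noteq> z" using ord(2) by blast
      have "(g ^^ i) ((g ^^ (j - i)) z) \<noteq> (g ^^ i) z"
        using subfield_hom.h_inj[OF gn(1)[of i]] z gn(2) by (meson inj_onD)
      moreover have "(g ^^ i) ((g ^^ (j - i)) z) = (g ^^ j) z"
        using ij by (metis add_diff_inverse_nat comp_apply funpow_add less_imp_le_nat not_less)
      ultimately show ?thesis using z(1) by metis
    qed
    \<comment> \<open>Vanishing on all of L would make every coefficient zero, including the one at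
      index 0, which is 1.\<close>
    have "inv \<xi> [^] (0::nat) = \<zero>"
      by (rule dedekind_independence[OF xi(3), where h = "\<lambda>i. g ^^ i" and E = L and c = "\<lambda>i. inv \<xi> [^] i"])
         (rule gn(1) | rule nat_pow_closed[OF ixi(1)] | erule dist, assumption | erule zero)+
    then show False by simp
  qed
  then obtain x where x: "x \<in> L" "(\<Oplus>i\<in>{..<l}. f x i) \<noteq> \<zero>" by blast
  define w where "w = (\<Oplus>i\<in>{..<l}. f x i)"
  have w: "w \<in> Lxi" "w \<noteq> \<zero>" unfolding w_def using x fN T.E_closed(10)[of "f x" "{..<l}"] by auto
  have wC: "w \<in> carrier R" using w T.E_closed(1) by blast
  have Tf: "inv \<xi> \<otimes> \<tau> (f x i) = f x (Suc i)" for i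
  proof -
    have gi: "(g ^^ i) x \<in> L" "(g ^^ i) x \<in> Lxi" "g ((g ^^ i) x) \<in> carrier R"
      using gn(2)[OF x(1)] LQ.M_subset g.h_closed by auto
    have "\<tau> (f x i) = inv \<xi> [^] i \<otimes> g ((g ^^ i) x)"
      unfolding f_def using T.h_mult[OF T.E_closed(9)[OF xiN(2)] gi(2)] T.h_pow[OF xiN(2)] xiN(4) T(3)[OF gi(1)] by simp
    then show ?thesis
      unfolding f_def nat_pow_Suc2[OF ixi(1)] using gi(3) ixi(1) by (simp add: m_assoc)
  qed
  have Tw: "\<tau> w = \<xi> \<otimes> w"
  proof -
    have TfC: "\<tau> (f x i) \<in> carrier R" for i using T.h_closed[OF fN[OF x(1)]] .
    have "inv \<xi> \<otimes> \<tau> w = inv \<xi> \<otimes> (\<Oplus>i\<in>{..<l}. \<tau> (f x i))"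
      unfolding w_def using T.h_finsum[of "{..<l}" "f x"] fN[OF x(1)] by simp
    also have "\<dots> = (\<Oplus>i\<in>{..<l}. inv \<xi> \<otimes> \<tau> (f x i))"
      using TfC ixi(1) by (intro finsum_rdistr) auto
    also have "\<dots> = (\<Oplus>i\<in>{..<l}. f x (Suc i))" unfolding Tf ..
    also have "\<dots> = w"
    proof -
      \<comment> \<open>The factor inv \<xi> has shifted the index by one. The sum closes up because
        the summand at l equals that at 0, by g^l = id and \<xi>^l = 1.\<close>
      have shift: "(\<Oplus>i\<in>{..<n}. h (Suc i)) \<oplus> h 0 = (\<Oplus>i\<in>{..<n}. h i) \<oplus> h n"
        if h: "\<And>i. h i \<in> carrier R" for n :: nat and h
      proof (induction n)
        case (Suc n)
        have c: "(\<Oplus>i\<in>{..<n}. h (Suc i)) \<in> carrier R" "(\<Oplus>i\<in>{..<n}. h i) \<in> carrier R"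
          using h by (auto intro!: finsum_closed)
        have "(\<Oplus>i\<in>{..<Suc n}. h (Suc i)) = (\<Oplus>i\<in>{..<n}. h (Suc i)) \<oplus> h (Suc n)"
          "(\<Oplus>i\<in>{..<Suc n}. h i) = (\<Oplus>i\<in>{..<n}. h i) \<oplus> h n"
          by (rule finsum_lessThan_Suc, rule h)+
        moreover have "((\<Oplus>i\<in>{..<n}. h (Suc i)) \<oplus> h (Suc n)) \<oplus> h 0 = ((\<Oplus>i\<in>{..<n}. h (Suc i)) \<oplus> h 0) \<oplus> h (Suc n)"
          using c h by (simp add: a_assoc a_comm[of "h (Suc n)" "h 0"])
        ultimately show ?case unfolding Suc by simp
      qed (use h in simp)
      have "f x l = f x 0" unfolding f_def using ord(1)[OF x(1)] ixil by simp
      then have "(\<Oplus>i\<in>{..<l}. f x (Suc i)) \<oplus> f x 0 = w \<oplus> f x 0"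
        using shift[of "f x" l] fC[OF x(1)] unfolding w_def by simp
      then show ?thesis
        by (rule add.r_cancel) (use fC[OF x(1)] wC in \<open>auto intro!: finsum_closed\<close>)
    qed
    finally have "\<xi> \<otimes> (inv \<xi> \<otimes> \<tau> w) = \<xi> \<otimes> w" by simp
    then show ?thesis using T.h_closed[OF w(1)] xi(1) ixi by (simp add: m_assoc[symmetric])
  qed

  define v where "v = \<sigma> w"
  have v: "v \<in> Lxi" "v \<in> carrier R" "\<sigma> v = w"
    unfolding v_def using LQ.conj_facts(3,4)[OF w(1)] T.E_closed(1) by auto
  have Tv: "\<tau> v = inv \<xi> \<otimes> v"
    unfolding v_def using T(5)[OF w(1)] Tw S.h_mult[OF xiN(1) w(1)] LQ.conj_facts(6) by simp
  have T4: "\<forall>x\<in>Kxi. \<tau> x = x" using T(4) by blast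
  note it = twist_iterates[OF T(1,2) T4 w(1) v(1) Tw Tv]
  define y where "y = v \<oplus> w"
  define u where "u = v \<otimes> w"
  define a where "a = w [^] l"
  define \<alpha> where "\<alpha> = a \<oplus> xi_conj R K \<xi> a"
  have yN: "y \<in> Lxi" and uN: "u \<in> Lxi" and aN: "a \<in> Lxi"
    unfolding y_def u_def a_def using w v T.E_closed(5,6,9) by auto
  have "\<sigma> y = y" unfolding y_def using S.h_add[OF v(1) w(1)] v wC by (simp add: v_def[symmetric] a_comm)
  then have yL: "y \<in> L" using LQ.conj_facts(5)[OF yN] by blast
  have yC: "y \<in> carrier R" using yL LQ.M_closed(1) by blast
  have "\<sigma> u = u" unfolding u_def using S.h_mult[OF v(1) w(1)] v wC by (simp add: v_def[symmetric] m_comm)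
  then have uL: "u \<in> L" using LQ.conj_facts(5)[OF uN] by blast
  have "\<tau> u = (inv \<xi> \<otimes> v) \<otimes> (\<xi> \<otimes> w)" unfolding u_def using T.h_mult[OF v(1) w(1)] Tv Tw by simp
  also have "\<dots> = (inv \<xi> \<otimes> \<xi>) \<otimes> (v \<otimes> w)" using xi(1) ixi(1) wC v(2) by algebra
  finally have "\<tau> u = u" using ixi(3) wC v(2) unfolding u_def by simp
  then have uK: "u \<in> K" using Kxi_Int_L T(6) uN uL by blast
  have uC: "u \<in> carrier R" using uK KQ.M_closed(1) by blast
  have "\<tau> a = (\<xi> \<otimes> w) [^] l" unfolding a_def using T.h_pow[OF w(1)] Tw by simp
  also have "\<dots> = a" unfolding a_def using xi(1) wC xi(4)[of l] by (simp add: nat_pow_distrib)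
  finally have aK: "a \<in> Kxi" using T(6) aN by blast
  have aC: "a \<in> carrier R" using aN T.E_closed(1) by blast
  have sa: "xi_conj R K \<xi> a = v [^] l"
    using conj_agree[OF aK] S.h_pow[OF w(1)] unfolding a_def v_def by simp
  have sK: "xi_conj R K \<xi> a \<in> Kxi" using KQ.conj_facts(3)[OF aK] .
  have saC: "xi_conj R K \<xi> a \<in> carrier R" using sK KQ.N_closed(1) by blast
  have "xi_conj R K \<xi> \<alpha> = \<alpha>"
    unfolding \<alpha>_def using subfield_hom.h_add[OF KQ.conj_facts(1) aK sK] KQ.conj_facts(4)[OF aK] aC saC
    by (simp add: a_comm)
  then have alK: "\<alpha> \<in> K"
    using KQ.conj_facts(5)[of \<alpha>] KQ.N_closed(5)[OF aK sK] unfolding \<alpha>_def by blast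

  \<comment> \<open>The l conjugates \<xi>^i w are distinct because w is nonzero.\<close>
  have irr_w: "Irr Kxi w = kummer_poly R Kxi l a"
  proof -
    obtain r where r: "r \<in> carrier (Kxi[X])" "length r \<le> l"
      "kummer_poly R Kxi l a = X [^]\<^bsub>Kxi[X]\<^esub> l \<oplus>\<^bsub>Kxi[X]\<^esub> r" "\<And>x. x \<in> carrier R \<Longrightarrow> eval r x = \<ominus> a"
      using kummer_poly_eq[OF KQ.N_subfield aK xi(3)] by metis
    note p = monic_polynomial[OF KQ.N_subfield r(1,2)]
    have ev: "eval (X [^]\<^bsub>Kxi[X]\<^esub> l \<oplus>\<^bsub>Kxi[X]\<^esub> r) w = \<zero>"
      using p(5)[OF wC] r(4)[OF wC] aC unfolding a_def by (simp add: r_neg)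
    have alg: "(algebraic over Kxi) w" by (rule algebraicI[OF p(1) _ ev]) (use p(2) in auto)
    note I = IrrE[OF KQ.N_subfield wC alg]
    have "Irr Kxi w = X [^]\<^bsub>Kxi[X]\<^esub> l \<oplus>\<^bsub>Kxi[X]\<^esub> r"
    proof (rule Irr_eqI[OF KQ.N_subfield wC r(1,2) ev])
      let ?S = "(\<lambda>i. (\<tau> ^^ i) w) ` {..<l}"
      show "?S \<subseteq> carrier R" using it(1) xi(1) wC by auto
      show "card ?S = l"
      proof (rule card_conjugates)
        fix i j assume ij: "i < j" "j < l"
        show "(\<tau> ^^ i) w \<noteq> (\<tau> ^^ j) w"
          unfolding it(1) using pow_inj[of i j] ij m_rcancel[OF w(2) wC, of "\<xi> [^] i" "\<xi> [^] j"] xi(1) by auto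
      qed
      fix z assume "z \<in> ?S"
      then obtain i where i: "z = (\<tau> ^^ i) w" by blast
      have sub: "set (Irr Kxi w) \<subseteq> Kxi" using I(1) unfolding univ_poly_carrier[symmetric] polynomial_def by auto
      have "(\<tau> ^^ i) (eval (Irr Kxi w) w) = eval (Irr Kxi w) ((\<tau> ^^ i) w)"
        using subfield_hom.h_eval[OF subfield_hom_funpow(1)[OF T(1,2)] _ w(1), of "Irr Kxi w" i] sub Kxi_Lxi it(4) by blast
      then show "eval (Irr Kxi w) z = \<zero>"
        using I(4) i subfield_hom.h_zero[OF subfield_hom_funpow(1)[OF T(1,2)]] by simp
    qed
    then show ?thesis using r(3) by simp
  qed

  \<comment> \<open>A coincidence makes v a multiple of w by a power of \<xi>, so both have the same
    eigenvalue and l = 2. Then \<sigma> is the identity, v = w, and i = 0, j = 1 yields \<xi> =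
    \<one>.\<close>
  have distinct: "(\<tau> ^^ i) y \<noteq> (\<tau> ^^ j) y" if ij: "i < j" "j < l" for i j
  proof
    assume "(\<tau> ^^ i) y = (\<tau> ^^ j) y"
    then have k: "\<xi> [^] (i + j) \<otimes> w = v"
      using twist_distinct[OF T(1,2) T4 w(1) v(1) Tw Tv ij] unfolding y_def by blast
    have xk: "\<xi> [^] (i + j) \<in> Kxi" using KQ.N_closed(9)[OF KQ.xi_N] .
    have "inv \<xi> \<otimes> v = \<tau> (\<xi> [^] (i + j) \<otimes> w)" using Tv k by simp
    also have "\<dots> = \<xi> [^] (i + j) \<otimes> (\<xi> \<otimes> w)"
      using T.h_mult[OF _ w(1)] T(4)[OF xk] xk Kxi_Lxi Tw by auto
    also have "\<dots> = \<xi> \<otimes> (\<xi> [^] (i + j) \<otimes> w)" using xi(1) wC by (simp add: m_lcomm)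
    finally have "inv \<xi> \<otimes> v = \<xi> \<otimes> v" unfolding k .
    moreover have "v \<noteq> \<zero>" using S.h_eq_zero_iff[OF w(1)] w(2) unfolding v_def by blast
    ultimately have "inv \<xi> = \<xi>" using m_rcancel v(2) xi(1) ixi(1) by blast
    then have "\<xi> [^] (2::nat) = \<one>" using ixi(2) xi(1) by (simp add: numeral_2_eq_2)
    then have "l dvd 2" using xi(4) by blast
    then have l2: "l = 2" using ij by (auto dest: dvd_imp_le)
    have "(\<xi> \<ominus> \<one>) \<otimes> (\<xi> \<oplus> \<one>) = \<xi> [^] (2::nat) \<ominus> \<one>"
      using xi(1) by (simp add: numeral_2_eq_2) algebra
    then have "(\<xi> \<ominus> \<one>) \<otimes> (\<xi> \<oplus> \<one>) = \<zero>" using \<open>\<xi> [^] (2::nat) = \<one>\<close> by (simp add: r_right_minus_eq)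
    then have "\<xi> \<ominus> \<one> = \<zero> \<or> \<xi> \<oplus> \<one> = \<zero>" using integral[of "\<xi> \<ominus> \<one>" "\<xi> \<oplus> \<one>"] xi(1) by blast
    then have "\<xi> = \<one> \<or> \<xi> = \<ominus> \<one>"
      using xi(1) r_right_minus_eq[of \<xi> \<one>] minus_equality[of \<xi> \<one>] by auto
    then have "\<xi> \<in> L" using LQ.M_closed(3,4) by auto
    then have "v = w" unfolding v_def using LQ.conj_facts(5)[OF w(1)] w(1) adjoin_absorb[OF LQ.M] by simp
    moreover have "i = 0" "j = 1" using ij l2 by auto
    ultimately have "\<xi> \<otimes> w = \<one> \<otimes> w" using k wC xi(1) by simp
    then have "\<xi> [^] (1::nat) = \<one>" using m_rcancel[OF w(2) wC xi(1) one_closed] xi(1) by simp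
    then show False using xi(4)[of 1] l2 by simp
  qed

  have lucas: "lucasV y u l = \<alpha>"
    unfolding y_def u_def \<alpha>_def sa unfolding a_def using lucasV_eq_power_sum[OF v(2) wC, of l] v(2) wC by (simp add: a_comm)
  have irr_y: "Irr K y = P_poly R K l u \<alpha> \<and> length (Irr K y) = Suc l"
  proof -
    obtain r where r: "r \<in> carrier (K[X])" "length r \<le> l"
      "P_poly R K l u \<alpha> = X [^]\<^bsub>K[X]\<^esub> l \<oplus>\<^bsub>K[X]\<^esub> r"
      "\<And>x. x \<in> carrier R \<Longrightarrow> eval (P_poly R K l u \<alpha>) x = lucasV x u l \<ominus> \<alpha>"
      using P_poly_eq[OF KQ.M uK alK xi(3)] by metis
    note p = monic_polynomial[OF KQ.M r(1,2)]
    have ev: "eval (X [^]\<^bsub>K[X]\<^esub> l \<oplus>\<^bsub>K[X]\<^esub> r) y = \<zero>"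
      using r(3,4) yC lucas alK KQ.M_closed(1) by (simp add: r_right_minus_eq)
    have alg: "(algebraic over K) y" by (rule algebraicI[OF p(1) _ ev]) (use p(2) in auto)
    note I = IrrE[OF KQ.M yC alg]
    have "Irr K y = X [^]\<^bsub>K[X]\<^esub> l \<oplus>\<^bsub>K[X]\<^esub> r"
    proof (rule Irr_eqI[OF KQ.M yC r(1,2) ev])
      let ?S = "(\<lambda>i. (\<tau> ^^ i) y) ` {..<l}"
      show "?S \<subseteq> carrier R" using subfield_hom_funpow(2)[OF T(1,2) yN] T.E_closed(1) by blast
      show "card ?S = l" by (rule card_conjugates[OF distinct])
      fix z assume "z \<in> ?S"
      then obtain i where i: "z = (\<tau> ^^ i) y" by blast
      have sub: "set (Irr K y) \<subseteq> K" using I(1) unfolding univ_poly_carrier[symmetric] polynomial_def by auto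
      have "(\<tau> ^^ i) (eval (Irr K y) y) = eval (Irr K y) ((\<tau> ^^ i) y)"
        using subfield_hom.h_eval[OF subfield_hom_funpow(1)[OF T(1,2)] _ yN, of "Irr K y" i] sub KQ.M_subset Kxi_Lxi it(4) by blast
      then show "eval (Irr K y) z = \<zero>"
        using I(4) i subfield_hom.h_zero[OF subfield_hom_funpow(1)[OF T(1,2)]] by simp
    qed
    then show ?thesis using r(3) p(2) by simp
  qed
  then have L: "L = adjoin R K y"
    using adjoin_eq_if_degree_eq_dimension[OF KQ.M LQ.M KL yL assms(1)] by blast

  have "Lxi = adjoin R Kxi w"
  proof
    note A = adjoin_props[OF KQ.N_subfield wC] and Acl = subfield_closed[OF adjoin_props(1)[OF KQ.N_subfield wC]]
    show "adjoin R Kxi w \<subseteq> Lxi" by (rule A(4)[OF LQ.N_subfield Kxi_Lxi w(1)])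
    have KA: "K \<subseteq> adjoin R Kxi w" using A(2) KQ.M_subset by blast
    \<comment> \<open>v = u / w brings y, and with it L, into K(\<xi>)(w).\<close>
    have "v = u \<otimes> inv w"
      unfolding u_def using v(2) wC w(2) field_Units by (simp add: m_assoc)
    moreover have "u \<otimes> inv w \<in> adjoin R Kxi w"
      using KA uK Acl(6)[OF _ Acl(8)[OF A(3) w(2)]] by blast
    ultimately have "y \<in> adjoin R Kxi w" unfolding y_def using Acl(5)[OF _ A(3)] by simp
    then have "L \<subseteq> adjoin R Kxi w" using adjoin_props(4)[OF KQ.M yC A(1) KA] L by simp
    then show "Lxi \<subseteq> adjoin R Kxi w"
      using adjoin_props(4)[OF LQ.M xi(1) A(1)] A(2) KQ.xi_N by blast
  qed
  then have "kummer_generator R K L \<xi> l w"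
    unfolding kummer_generator_def using w(1) aK unfolding a_def by blast
  then show ?thesis using aK irr_w L uK irr_y
    unfolding y_def u_def v_def \<alpha>_def by blast
qed

end

text \<open>For \<open>w\<^sup>2 = y w - u\<close> one has \<open>w\<^sup>l = w U\<^sub>l - u U\<^sub>l\<^sub>-\<^sub>1\<close>; solving \<open>w\<^sup>l = a\<close> for \<open>w\<close>
  expresses the Kummer generator rationally through \<open>y\<close> and \<open>a\<close>.\<close>

lemma (in field) kummer_root_exists:
  assumes "y \<in> carrier R" "u \<in> carrier R" "a \<in> carrier R" "b \<in> carrier R" "a \<noteq> b"
    and "u [^] Suc m = a \<otimes> b" "lucasV y u (Suc m) = a \<oplus> b"
  defines "w \<equiv> (a \<oplus> u \<otimes> lucasU y u m) \<otimes> inv (lucasU y u (Suc m))"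
  shows "lucasU y u (Suc m) \<noteq> \<zero>" "w \<in> carrier R" "w \<otimes> w = y \<otimes> w \<ominus> u" "w [^] Suc m = a"
proof -
  define U where "U = lucasU y u (Suc m)"
  define V where "V = lucasU y u m"
  define e where "e = u \<otimes> V"
  have c: "U \<in> carrier R" "V \<in> carrier R" "e \<in> carrier R" unfolding U_def V_def e_def using assms(1,2) by auto
  \<comment> \<open>In terms of a root w still to be found, this and the next equation prescribe the
    trace and the norm of w U - e as a + b and a b.\<close>
  have tr: "y \<otimes> U \<ominus> (e \<oplus> e) = a \<oplus> b"
    using lucasV_eq_lucasU[OF assms(1,2), of m] assms(7) unfolding U_def V_def e_def by simp
  have nm: "u \<otimes> (U \<otimes> U) \<ominus> y \<otimes> (U \<otimes> e) \<oplus> e \<otimes> e = a \<otimes> b"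
  proof -
    have "u \<otimes> (U \<otimes> U) \<ominus> y \<otimes> (U \<otimes> e) \<oplus> e \<otimes> e = (U \<otimes> U \<ominus> y \<otimes> (U \<otimes> V) \<oplus> u \<otimes> (V \<otimes> V)) \<otimes> u"
      unfolding e_def using c(1,2) assms(1,2) by algebra
    also have "\<dots> = u [^] Suc m"
      using lucasU_cassini[OF assms(1,2), of m] unfolding U_def V_def by simp
    finally show ?thesis using assms(6) by simp
  qed
  \<comment> \<open>If U vanished, a and b would have sum -2e and product e^2, hence both equal
    -e.\<close>
  show U0: "lucasU y u (Suc m) \<noteq> \<zero>"
  proof
    assume "lucasU y u (Suc m) = \<zero>"
    then have "U = \<zero>" unfolding U_def .
    then have s: "\<ominus> (e \<oplus> e) = a \<oplus> b" and p: "e \<otimes> e = a \<otimes> b"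
      using tr nm assms(1,2) c by (simp_all add: a_minus_def)
    have "(a \<oplus> e) \<otimes> (b \<oplus> e) = a \<otimes> b \<oplus> e \<otimes> (a \<oplus> b) \<oplus> e \<otimes> e" using assms(3,4) c by algebra
    also have "\<dots> = \<zero>" unfolding s[symmetric] p[symmetric] using c by algebra
    finally have "a \<oplus> e = \<zero> \<or> b \<oplus> e = \<zero>" using integral[of "a \<oplus> e" "b \<oplus> e"] assms(3,4) c by auto
    moreover have "(a \<oplus> e) \<oplus> (b \<oplus> e) = (a \<oplus> b) \<oplus> (e \<oplus> e)" using assms(3,4) c by algebra
    then have "(a \<oplus> e) \<oplus> (b \<oplus> e) = \<zero>" unfolding s[symmetric] using c by (simp add: l_neg)
    ultimately have "a \<oplus> e = \<zero>" "b \<oplus> e = \<zero>" using assms(3,4) c by auto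
    then have "a = b" using assms(3,4) c by (metis add.r_cancel)
    then show False using assms(5) by blast
  qed
  have iU: "inv U \<in> carrier R" "inv U \<otimes> U = \<one>" using U0 c(1) field_Units unfolding U_def by auto
  have w_eq: "w = (a \<oplus> e) \<otimes> inv U" unfolding w_def U_def V_def e_def ..
  show w: "w \<in> carrier R" unfolding w_eq using assms(3) c iU by simp
  have wU: "w \<otimes> U = a \<oplus> e" unfolding w_eq using assms(3) c iU by (simp add: m_assoc)
  \<comment> \<open>With w U = a + e, the quadratic equation times U^2 becomes a multiple of the
    trace relation once the norm relation is inserted.\<close>
  have "(w \<otimes> w \<ominus> (y \<otimes> w \<ominus> u)) \<otimes> (U \<otimes> U) = (w \<otimes> U) \<otimes> (w \<otimes> U) \<ominus> y \<otimes> (w \<otimes> U) \<otimes> U \<oplus> u \<otimes> (U \<otimes> U)"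
    using w assms(1,2) c by algebra
  also have "\<dots> = a \<otimes> a \<oplus> a \<otimes> (e \<oplus> e) \<ominus> a \<otimes> (y \<otimes> U) \<oplus> (u \<otimes> (U \<otimes> U) \<ominus> y \<otimes> (U \<otimes> e) \<oplus> e \<otimes> e)"
    unfolding wU using assms(1,2,3) c by algebra
  also have "\<dots> = a \<otimes> ((a \<oplus> b) \<ominus> (y \<otimes> U \<ominus> (e \<oplus> e)))"
    unfolding nm using assms(1,3,4) c by algebra
  also have "\<dots> = \<zero>" unfolding tr unfolding a_minus_def using assms(3,4) by (simp add: r_neg)
  finally have z: "(w \<otimes> w \<ominus> (y \<otimes> w \<ominus> u)) \<otimes> (U \<otimes> U) = \<zero>" .
  have "U \<otimes> U \<noteq> \<zero>" using U0 c(1) integral unfolding U_def by blast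
  then have "w \<otimes> w \<ominus> (y \<otimes> w \<ominus> u) = \<zero>"
    using integral[OF z] w assms(1,2) c(1) by simp
  then show sq: "w \<otimes> w = y \<otimes> w \<ominus> u" using w assms(1,2) by (simp add: r_right_minus_eq)
  have "w [^] Suc m = w \<otimes> U \<ominus> e"
    using power_eq_lucasU[OF assms(1,2) w sq, of m] unfolding U_def V_def e_def .
  also have "\<dots> = a" unfolding wU using assms(3) c by algebra
  finally show "w [^] Suc m = a" .
qed

lemma (in field) quadratic_roots:
  assumes "x \<in> carrier R" "w \<in> carrier R" "v \<in> carrier R" "x \<otimes> x = (w \<oplus> v) \<otimes> x \<ominus> w \<otimes> v"
  shows "x = w \<or> x = v"
proof -
  have "(x \<ominus> w) \<otimes> (x \<ominus> v) = x \<otimes> x \<ominus> ((w \<oplus> v) \<otimes> x \<ominus> w \<otimes> v)" using assms(1-3) by algebra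
  also have "\<dots> = \<zero>" unfolding assms(4) using assms(1-3) by (simp add: r_right_minus_eq)
  finally have "x \<ominus> w = \<zero> \<or> x \<ominus> v = \<zero>" using integral[of "x \<ominus> w" "x \<ominus> v"] assms(1-3) by auto
  then show ?thesis using assms(1-3) by (simp add: r_right_minus_eq)
qed

section \<open>The converse: constructing the automorphism from the root of P\<close>

context kummer_tower
begin

theorem kummer_trace_imp_cyclic:
  assumes "dimension l K L" "L = adjoin R K y" "u \<in> K" "\<alpha> \<in> K" "Irr K y = P_poly R K l u \<alpha>"
    and "a \<in> Kxi - K" "u [^] l = a \<otimes> xi_conj R K \<xi> a" "\<alpha> = a \<oplus> xi_conj R K \<xi> a"
  shows "cyclic_extension R K L"
proof -
  have aK: "a \<in> Kxi" and a_nK: "a \<notin> K" using assms(6) by auto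
  define b where "b = xi_conj R K \<xi> a"
  have bK: "b \<in> Kxi" and ab: "a \<noteq> b"
    unfolding b_def using KQ.conj_facts(3,5)[OF aK] a_nK by auto
  have sab: "\<sigma> a = b" unfolding b_def using conj_agree[OF aK] by simp
  have aN: "a \<in> Lxi" "b \<in> Lxi" and abC: "a \<in> carrier R" "b \<in> carrier R"
    using aK bK Kxi_Lxi LQ.N_closed(1) by auto
  have yL: "y \<in> L" using assms(2) unfolding adjoin_def by (simp add: generate_field.incl)
  have yN: "y \<in> Lxi" and yC: "y \<in> carrier R" using yL LQ.M_subset LQ.M_closed(1) by auto
  have uL: "u \<in> L" and uN: "u \<in> Lxi" and uC: "u \<in> carrier R"
    using assms(3) KL LQ.M_subset LQ.M_closed(1) by auto
  have alg: "(algebraic over K) y"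
    using finite_dimension_imp_algebraic[OF KQ.M subfieldE(1)[OF LQ.M] finite_dimensionI[OF assms(1)] yL] .
  note I = IrrE[OF KQ.M yC alg]
  obtain r where r: "r \<in> carrier (K[X])" "length r \<le> l"
    "P_poly R K l u \<alpha> = X [^]\<^bsub>K[X]\<^esub> l \<oplus>\<^bsub>K[X]\<^esub> r"
    "\<And>x. x \<in> carrier R \<Longrightarrow> eval (P_poly R K l u \<alpha>) x = lucasV x u l \<ominus> \<alpha>"
    using P_poly_eq[OF KQ.M assms(3,4) xi(3)] by metis
  have alC: "\<alpha> \<in> carrier R" using assms(4) KQ.M_closed(1) by blast
  have len: "length (Irr K y) = Suc l" using assms(5) r(3) monic_polynomial(2)[OF KQ.M r(1,2)] by simp
  have root_iff: "eval (Irr K y) z = \<zero> \<longleftrightarrow> lucasV z u l = \<alpha>" if "z \<in> carrier R" for z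
    using r(4)[OF that] assms(5) that uC alC by (simp add: r_right_minus_eq)
  have setI: "set (Irr K y) \<subseteq> K" using I(1) unfolding univ_poly_carrier[symmetric] polynomial_def by auto
  have Vy: "lucasV y u l = a \<oplus> b" using root_iff[OF yC] I(4) assms(8) unfolding b_def by simp
  obtain m where m: "l = Suc m" using xi(3) gr0_conv_Suc by blast
  define w where "w = (a \<oplus> u \<otimes> lucasU y u m) \<otimes> inv (lucasU y u (Suc m))"
  note kr = kummer_root_exists[OF yC uC abC ab assms(7)[folded b_def, unfolded m] Vy[unfolded m], folded w_def m]
  have wC: "w \<in> carrier R" by (rule kr(2))
  have lucN: "lucasU y u n \<in> Lxi" for n
    by (induction n rule: induct_nat_012) (simp_all add: yN uN LQ.N_closed(2,3,6,7))
  have wN: "w \<in> Lxi"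
    unfolding w_def using LQ.N_closed(5)[OF aN(1) LQ.N_closed(6)[OF uN lucN]] LQ.N_closed(8)[OF lucN] kr(1)
    by (auto simp: m intro!: LQ.N_closed(6))
  define v where "v = y \<ominus> w"
  have vN: "v \<in> Lxi" and vC: "v \<in> carrier R" unfolding v_def using yN wN yC wC LQ.N_closed(7) by auto
  have wv: "w \<oplus> v = y" unfolding v_def using yC wC by algebra
  have wv_mult: "w \<otimes> v = u"
  proof -
    have "w \<otimes> v = y \<otimes> w \<ominus> w \<otimes> w" unfolding v_def using yC wC by algebra
    also have "\<dots> = u" unfolding kr(3) using yC wC uC by algebra
    finally show ?thesis .
  qed
  have vl: "v [^] l = b"
  proof -
    have "a \<oplus> v [^] l = a \<oplus> b"
      using lucasV_eq_power_sum[OF wC vC, of l] Vy kr(4) unfolding wv wv_mult by simp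
    then show ?thesis using abC vC by simp
  qed

  \<comment> \<open>\<sigma> fixes the coefficients of the quadratic, so \<sigma> w is w or v; it is
    not w, because \<sigma> moves a = w^l.\<close>
  have sw: "\<sigma> w = v"
  proof -
    have sy: "\<sigma> y = y" "\<sigma> u = u" using LQ.conj_facts(5)[OF yN] LQ.conj_facts(5)[OF uN] yL uL by auto
    have "\<sigma> w \<otimes> \<sigma> w = \<sigma> (y \<otimes> w \<ominus> u)" using S.h_mult[OF wN wN] kr(3) by simp
    also have "\<dots> = (w \<oplus> v) \<otimes> \<sigma> w \<ominus> w \<otimes> v"
      using S.h_diff[OF LQ.N_closed(6)[OF yN wN] uN] S.h_mult[OF yN wN] sy wv wv_mult by simp
    finally have "\<sigma> w = w \<or> \<sigma> w = v"
      by (rule quadratic_roots[OF S.h_closed[OF wN] wC vC])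
    moreover have "\<sigma> w \<noteq> w"
    proof
      assume "\<sigma> w = w"
      then have "\<sigma> a = a" using S.h_pow[OF wN, of l] kr(4) by simp
      then show False using sab ab by simp
    qed
    ultimately show ?thesis by blast
  qed
  then have sv: "\<sigma> v = w" using LQ.conj_facts(4)[OF wN] by simp

  \<comment> \<open>the image of \<open>y\<close> under the automorphism to be constructed\<close>
  define z where "z = inv \<xi> \<otimes> v \<oplus> \<xi> \<otimes> w"
  have xN: "\<xi> \<in> Lxi" "inv \<xi> \<in> Lxi" by (rule LQ.xi_N, rule LQ.inv_xi_N)
  have pN: "\<xi> \<otimes> w \<in> Lxi" "inv \<xi> \<otimes> v \<in> Lxi" using xN wN vN LQ.N_closed(6) by auto
  have pC: "\<xi> \<otimes> w \<in> carrier R" "inv \<xi> \<otimes> v \<in> carrier R" using pN LQ.N_closed(1) by auto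
  have zN: "z \<in> Lxi" unfolding z_def using pN LQ.N_closed(5) by blast
  have six: "\<sigma> (inv \<xi>) = \<xi>" using LQ.conj_facts(4,6) LQ.xi_N by metis
  \<comment> \<open>\<sigma> exchanges v with w and \<xi> with its inverse, hence the two summands
    of z; this is what puts z into L.\<close>
  have "\<sigma> z = \<xi> \<otimes> w \<oplus> inv \<xi> \<otimes> v"
    unfolding z_def S.h_add[OF pN(2,1)] S.h_mult[OF xN(1) wN] S.h_mult[OF xN(2) vN] six sv sw LQ.conj_facts(6) ..
  then have "\<sigma> z = z" unfolding z_def using pC by (simp add: a_comm)
  then have zL: "z \<in> L" using LQ.conj_facts(5)[OF zN] by blast
  have zC: "z \<in> carrier R" using zL LQ.M_closed(1) by blast
  have zu: "(inv \<xi> \<otimes> v) \<otimes> (\<xi> \<otimes> w) = u"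
  proof -
    have "(inv \<xi> \<otimes> v) \<otimes> (\<xi> \<otimes> w) = (inv \<xi> \<otimes> \<xi>) \<otimes> (w \<otimes> v)" using xi(1) ixi(1) wC vC by algebra
    then show ?thesis using ixi(3) wv_mult uC by simp
  qed
  have xil: "\<xi> [^] l = \<one>" "inv \<xi> [^] l = \<one>" using xi(4)[of l] xi_pow_conj[of l] ixi(1) by auto
  have pl: "(\<xi> \<otimes> w) [^] l = a" "(inv \<xi> \<otimes> v) [^] l = b"
    using nat_pow_distrib[OF xi(1) wC, of l] nat_pow_distrib[OF ixi(1) vC, of l] xil kr(4) vl abC by simp_all
  \<comment> \<open>The summands of z have the same product u and the same l-th powers as v and w,
    so V_l takes the same value at z as at y.\<close>
  have "lucasV z u l = b \<oplus> a"
    using lucasV_eq_power_sum[OF pC(2,1), of l] unfolding zu pl z_def[symmetric] .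
  then have z_root: "eval (Irr K y) z = \<zero>"
    using root_iff[OF zC] assms(8) abC unfolding b_def by (simp add: a_comm)
  obtain g where g: "subfield_hom R L g" "\<And>p. p \<in> carrier (K[X]) \<Longrightarrow> g (eval p y) = eval p z"
    using hom_of_root[OF KQ.M yC alg zC z_root] assms(2) by metis
  interpret g: subfield_hom R L g by (rule g(1))
  have K_sub: "subring K R" by (rule subfieldE(1)[OF KQ.M])
  have gy: "g y = z"
    using g(2)[OF var_closed(1)[OF K_sub]] eval_var[OF yC] eval_var[OF zC] by simp
  have gK: "\<And>k. k \<in> K \<Longrightarrow> g k = k"
    using g(2)[OF poly_of_const_props(1)[OF KQ.M]] poly_of_const_props(3)[OF KQ.M _ yC]
      poly_of_const_props(3)[OF KQ.M _ zC] by simp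
  have repr: "\<exists>p. p \<in> carrier (K[X]) \<and> set p \<subseteq> K \<and> length p \<le> l \<and> x = eval p y" if "x \<in> L" for x
  proof -
    have "x \<in> adjoin R K y" using that assms(2) by simp
    from adjoin_eq_eval_image[OF KQ.M yC alg this] show ?thesis
      using len unfolding univ_poly_carrier[symmetric] polynomial_def by (metis empty_set empty_subsetI less_Suc_eq_le)
  qed
  have gL: "g ` L \<subseteq> L"
  proof
    fix x assume "x \<in> g ` L"
    then obtain p where p: "p \<in> carrier (K[X])" "x = eval p z" using repr g(2) by blast
    have "eval p z \<in> simple_extension K z"
      using simple_extension_as_eval_img[OF subfieldE(3)[OF KQ.M] zC] p(1) by blast
    then show "x \<in> L" using p(2) simple_extension_subring_incl[OF subfieldE(1)[OF LQ.M] KL zL] by blast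
  qed
  obtain \<tau> where T: "subfield_hom R Lxi \<tau>" "\<tau> ` Lxi \<subseteq> Lxi" "\<And>x. x \<in> L \<Longrightarrow> \<tau> x = g x"
    "\<And>x. x \<in> Kxi \<Longrightarrow> \<tau> x = x"
  proof (rule extend_aut[OF g(1) gL gK])
    fix \<tau>
    assume "subfield_hom R Lxi \<tau>" "\<tau> ` Lxi \<subseteq> Lxi" "\<And>x. x \<in> L \<Longrightarrow> \<tau> x = g x"
      "\<And>x. x \<in> Kxi \<Longrightarrow> \<tau> x = x"
    then show thesis by (rule that)
  qed
  interpret T: subfield_hom R Lxi \<tau> by (rule T(1))
  have Ty: "\<tau> y = z" using T(3)[OF yL] gy by simp
  \<comment> \<open>\<tau> carries the quadratic of w to X^2 - z X + u, with roots inv \<xi> v and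
    \<xi> w. The former has l-th power b, whereas \<tau> fixes a.\<close>
  have Tw: "\<tau> w = \<xi> \<otimes> w"
  proof -
    have "\<tau> w \<otimes> \<tau> w = \<tau> (y \<otimes> w \<ominus> u)" using T.h_mult[OF wN wN] kr(3) by simp
    also have "\<dots> = z \<otimes> \<tau> w \<ominus> u"
      using T.h_diff[OF LQ.N_closed(6)[OF yN wN] uN] T.h_mult[OF yN wN] Ty T(3)[OF uL] gK[OF assms(3)] by simp
    finally have "\<tau> w \<otimes> \<tau> w = (inv \<xi> \<otimes> v \<oplus> \<xi> \<otimes> w) \<otimes> \<tau> w \<ominus> (inv \<xi> \<otimes> v) \<otimes> (\<xi> \<otimes> w)"
      unfolding zu z_def .
    then have "\<tau> w = inv \<xi> \<otimes> v \<or> \<tau> w = \<xi> \<otimes> w"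
      by (rule quadratic_roots[OF T.h_closed[OF wN] pC(2,1)])
    moreover have "\<tau> w \<noteq> inv \<xi> \<otimes> v"
    proof
      assume "\<tau> w = inv \<xi> \<otimes> v"
      then have "\<tau> a = b" using T.h_pow[OF wN, of l] kr(4) pl(2) by simp
      then show False using T(4)[OF aK] ab by simp
    qed
    ultimately show ?thesis by blast
  qed
  have Tv: "\<tau> v = inv \<xi> \<otimes> v"
  proof -
    have "\<tau> v = z \<ominus> \<xi> \<otimes> w" unfolding v_def using T.h_diff[OF yN wN] Ty Tw by simp
    also have "\<dots> = inv \<xi> \<otimes> v" unfolding z_def using pC by (simp add: a_minus_def a_assoc r_neg)
    finally show ?thesis .
  qed
  have T4: "\<forall>x\<in>Kxi. \<tau> x = x" using T(4) by blast
  note it = twist_iterates[OF T(1,2) T4 wN vN Tw Tv]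
  have y_eq: "v \<oplus> w = y" using wv wC vC by (simp add: a_comm)
  have Tg: "(\<tau> ^^ i) x = (g ^^ i) x \<and> (g ^^ i) x \<in> L" if "x \<in> L" for i x
    using that gL T(3) by (induction i) auto
  note gn = subfield_hom_funpow[OF g(1) gL]
  have gnK: "\<And>k i. k \<in> K \<Longrightarrow> (g ^^ i) k = k"
  proof -
    fix k i assume "k \<in> K"
    then show "(g ^^ i) k = k" using gK by (induction i) auto
  qed
  have gn_eval: "(g ^^ i) (eval p y) = eval p ((g ^^ i) y)" if "set p \<subseteq> K" for i p
    using subfield_hom.h_eval[OF gn(1) _ yL, of p i] that KL gnK by blast
  \<comment> \<open>A coincidence would give v^l = w^l, that is b = a.\<close>
  have distinct: "(g ^^ i) y \<noteq> (g ^^ j) y" if ij: "i < j" "j < l" for i j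
  proof
    assume "(g ^^ i) y = (g ^^ j) y"
    then have "(\<tau> ^^ i) (v \<oplus> w) = (\<tau> ^^ j) (v \<oplus> w)" unfolding y_eq using Tg[OF yL] by simp
    then have "\<xi> [^] (i + j) \<otimes> w = v"
      using twist_distinct[OF T(1,2) T4 wN vN Tw Tv ij] by blast
    then have "v [^] l = (\<xi> [^] (i + j)) [^] l \<otimes> w [^] l"
      using nat_pow_distrib[OF nat_pow_closed[OF xi(1)] wC] by metis
    also have "(\<xi> [^] (i + j)) [^] l = \<one>"
      using xi(1) xi(4)[of "(i + j) * l"] by (simp add: nat_pow_pow)
    finally show False using vl kr(4) abC ab by simp
  qed
  let ?S = "(\<lambda>i. (g ^^ i) y) ` {..<l}"
  have cardS: "card ?S = l" by (rule card_conjugates[OF distinct])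
  have SL: "?S \<subseteq> L" using gn(2)[OF yL] by blast
  then have SC: "?S \<subseteq> carrier R" using LQ.M_closed(1) by blast
  have S_root: "eval (Irr K y) s = \<zero>" if s: "s \<in> ?S" for s
  proof -
    obtain i where "s = (g ^^ i) y" using s by blast
    then show ?thesis using gn_eval[OF setI, of i] I(4) subfield_hom.h_zero[OF gn(1)] by simp
  qed

  \<comment> \<open>p - x has degree below l and vanishes at all l conjugates of y, so p is the
    constant x; the coefficients of p lie in K.\<close>
  have fixed: "x \<in> K" if x: "x \<in> L" "g x = x" for x
  proof -
    obtain p where p: "p \<in> carrier (K[X])" "set p \<subseteq> K" "length p \<le> l" "x = eval p y" using repr[OF x(1)] by blast
    interpret UP: domain "L[X]" using univ_poly_is_domain[OF subfieldE(1)[OF LQ.M]] .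
    have pL: "p \<in> carrier (L[X])" using p(1,2) KL unfolding univ_poly_carrier[symmetric] polynomial_def by auto
    note cx = poly_of_const_props[OF LQ.M x(1)]
    let ?d = "p \<ominus>\<^bsub>L[X]\<^esub> poly_of_const x"
    have d: "?d \<in> carrier (L[X])" using pL cx by simp
    have "length ?d \<le> l"
      unfolding a_minus_def
      by (rule length_poly_ring_add[OF LQ.M pL])
         (use cx p(3) xi(3) univ_poly_a_inv_length[OF subfieldE(1)[OF LQ.M] cx(1)] in auto)
    moreover have "eval ?d s = \<zero>" if s: "s \<in> ?S" for s
    proof -
      obtain i where i: "s = (g ^^ i) y" using s by blast
      have sC: "s \<in> carrier R" using s SC by blast
      interpret ev: ring_hom_ring "L[X]" R "\<lambda>p. eval p s" using eval_ring_hom[OF subfieldE(1)[OF LQ.M] sC] .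
      have "(g ^^ i) x = x" using x(2) by (induction i) auto
      then have "eval p s = x" using gn_eval[OF p(2), of i] p(4) i by simp
      then show ?thesis unfolding a_minus_def using pL cx sC x(1) LQ.M_closed(1) by (simp add: r_neg)
    qed
    ultimately have "?d = []" using polynomial_eq_Nil_if_many_roots[OF LQ.M d SC] cardS by simp
    then have "?d = \<zero>\<^bsub>L[X]\<^esub>" by (simp add: univ_poly_zero)
    then have "p = poly_of_const x" using UP.r_right_minus_eq[OF pL cx(1)] by blast
    then show ?thesis using p(2) KQ.M_closed(2) by (cases "x = \<zero>") (auto simp: poly_of_const_def)
  qed

  have surj: "g ` L = L"
  proof
    \<comment> \<open>\<xi>^l = 1 makes g^l trivial on y, hence on L, and surjectivity of g
      follows.\<close>
    have "(g ^^ l) y = y" using Tg[OF yL, of l] it(3)[of l] xil y_eq vC wC by simp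
    then have gl: "(g ^^ l) x = x" if "x \<in> L" for x using repr[OF that] gn_eval by metis
    have "x \<in> g ` L" if "x \<in> L" for x
      using gl[OF that] gn(2)[OF that, of m] unfolding m by (metis comp_apply funpow.simps(2) image_eqI)
    then show "L \<subseteq> g ` L" by blast
  qed (rule gL)

  show ?thesis
  proof (rule cyclic_extensionI[OF KQ.M LQ.M KL finite_dimensionI[OF assms(1)] g(1) surj])
    show "g x = x \<longleftrightarrow> x \<in> K" if "x \<in> L" for x using fixed[OF that] gK by blast
    fix f assume f: "f \<in> carrier (galois_group R K L)"
    note fd = galois_memD[OF LQ.M f]
    have f_eval: "f (eval p y) = eval p (f y)" if "set p \<subseteq> K" for p
      using subfield_hom.h_eval[OF fd(1) _ yL, of p] that KL fd(4) by blast
    have "eval (Irr K y) (f y) = \<zero>" using f_eval[OF setI] I(4) subfield_hom.h_zero[OF fd(1)] by simp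
    have fyC: "f y \<in> carrier R" using subfield_hom.h_closed[OF fd(1) yL] .
    \<comment> \<open>The l conjugates exhaust the roots of \<open>Irr K y\<close>, so every
      automorphism agrees with an iterate of g at y, and therefore on L.\<close>
    have "f y \<in> ?S"
    proof (rule ccontr)
      assume "f y \<notin> ?S"
      then have "card (insert (f y) ?S) = Suc l" using cardS by simp
      then have "Irr K y = []"
        using polynomial_eq_Nil_if_many_roots[OF KQ.M I(1), of "insert (f y) ?S"] SC fyC S_root
          \<open>eval (Irr K y) (f y) = \<zero>\<close> len by auto
      then show False using len by simp
    qed
    then obtain i where i: "f y = (g ^^ i) y" by blast
    have "f x = (g ^^ i) x" if "x \<in> L" for x
      using repr[OF that] f_eval gn_eval i by metis
    then show "\<exists>n. \<forall>x\<in>L. f x = (g ^^ n) x" by blast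
  qed
qed

end

theorem theorem1p5:
  fixes R :: "('a, 'b) ring_scheme" (structure)
    and F K :: "'a set" and p n q l :: nat and \<xi> :: 'a
  assumes "field R"
    and "Factorial_Ring.prime p" and "q = p ^ n"
    and "function_field R F K" and "card F = q"
    and "0 < l" and "coprime l p" and "[int q = - 1] (mod int l)"
    and "primitive_root_of_unity R l \<xi>"
  shows
    "(\<forall>L. geometric_extension R F K L \<and> cyclic_extension R K L \<and> ring.dimension R l K L \<longrightarrow>
        (\<exists>w a y u \<alpha>.
            kummer_generator R K L \<xi> l w \<and> a \<in> adjoin R K \<xi> \<and>
            ring.Irr R (adjoin R K \<xi>) w = kummer_poly R (adjoin R K \<xi>) l a \<and>
            y = xi_conj R L \<xi> w \<oplus> w \<and> L = adjoin R K y \<and>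
            u = xi_conj R L \<xi> w \<otimes> w \<and> u \<in> K \<and>
            \<alpha> = a \<oplus> xi_conj R K \<xi> a \<and>
            ring.Irr R K y = P_poly R K l u \<alpha>))
   \<and> (\<forall>L. geometric_extension R F K L \<and> ring.dimension R l K L \<and>
        (\<exists>y u \<alpha> a.
            L = adjoin R K y \<and> u \<in> K \<and> \<alpha> \<in> K \<and>
            ring.Irr R K y = P_poly R K l u \<alpha> \<and>
            a \<in> adjoin R K \<xi> - K \<and>
            u [^] l = a \<otimes> xi_conj R K \<xi> a \<and> \<alpha> = a \<oplus> xi_conj R K \<xi> a)
        \<longrightarrow> cyclic_extension R K L)"
proof -
  interpret field R by fact
  have F: "subfield F R" and K: "subfield K R" and full_K: "full_constant_field R F K"
    using assms(4) unfolding function_field_def full_constant_field_def field_extension_def by auto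
  \<comment> \<open>K and L both have F as full field of constants, which provides the two instances
    of \<open>unit_quadratic\<close>.\<close>
  have tower: "kummer_tower R K L \<xi> l" if "geometric_extension R F K L" for L
  proof -
    have "K \<subseteq> L" "full_constant_field R F L"
      using that unfolding geometric_extension_def field_extension_def by auto
    then show ?thesis
      using root_of_unity_unit_quadratic[OF assms(2,3) F assms(5,8,9)] full_K assms(9)
      by (intro kummer_tower.intro field_axioms kummer_tower_axioms.intro) auto
  qed
  show ?thesis
  proof (intro conjI allI impI; (elim conjE exE)?)
    fix L assume L: "geometric_extension R F K L" "cyclic_extension R K L" "dimension l K L"
    interpret kummer_tower R K L \<xi> l by (rule tower[OF L(1)])
    obtain g where "subfield_hom R L g" "g ` L = L" "\<And>x. x \<in> L \<Longrightarrow> g x = x \<longleftrightarrow> x \<in> K"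
      using cyclic_extension_generator[OF KQ.M LQ.M KL L(2)] by blast
    then show "\<exists>w a y u \<alpha>.
            kummer_generator R K L \<xi> l w \<and> a \<in> adjoin R K \<xi> \<and>
            Irr (adjoin R K \<xi>) w = kummer_poly R (adjoin R K \<xi>) l a \<and>
            y = xi_conj R L \<xi> w \<oplus> w \<and> L = adjoin R K y \<and>
            u = xi_conj R L \<xi> w \<otimes> w \<and> u \<in> K \<and>
            \<alpha> = a \<oplus> xi_conj R K \<xi> a \<and>
            Irr K y = P_poly R K l u \<alpha>"
      by (rule cyclic_imp_kummer_trace[OF L(3)])
  next
    fix L y u \<alpha> a
    assume L: "geometric_extension R F K L" "dimension l K L"
      and rest: "L = adjoin R K y" "u \<in> K" "\<alpha> \<in> K" "Irr K y = P_poly R K l u \<alpha>"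
        "a \<in> adjoin R K \<xi> - K" "u [^] l = a \<otimes> xi_conj R K \<xi> a" "\<alpha> = a \<oplus> xi_conj R K \<xi> a"
    interpret kummer_tower R K L \<xi> l by (rule tower[OF L(1)])
    show "cyclic_extension R K L" by (rule kummer_trace_imp_cyclic[OF L(2) rest])
  qed
qed

end
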